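(* Let $G$ be a countable group. Suppose that $G$ is not a Tararin group. If $\mathrm{LO}(G)$ contains an isolated point, then $E_{\mathsf{lo}}(G)$ is not smooth.
   Context: A positive cone of a group $G$ is a subset $P\subseteq G$ with $P\cdot P\subseteq P$ and $P\sqcup P^{-1}=G\setminus\{id\}$ (disjoint union). Positive cones correspond to left-orderings (strict total orders $<$ with $g<h\Rightarrow fg<fh$) via $P=\{g: g>id\}$; $G$ is left-orderable if it has a positive cone. For a countable group $G$, $\mathrm{LO}(G)\subseteq\{0,1\}^G$ is the set of all positive cones with the subspace topology of the product topology ($\{0,1\}$ discrete); it is a compact Polish space when $G$ is left-orderable. $G$ acts on $\mathrm{LO}(G)$ by homeomorphisms via $g\cdot P=gPg^{-1}$, and $E_{\mathsf{lo}}(G)$ is the orbit equivalence relation of this action. A left-orderable group is Tararin if it admits only finitely many left-orderings. A point $P\in\mathrm{LO}(G)$ is isolated if $\{P\}$ is open in $\mathrm{LO}(G)$. A Borel equivalence relation $E$ on a Polish space $X$ is smooth if there are a standard Borel space $Y$ and a Borel map $\theta\colon X\to Y$ such that $x_1\mathbin{E}x_2\iff\theta(x_1)=\theta(x_2)$. *)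

theory Defs
  imports "HOL-Analysis.Analysis" "HOL-Algebra.Group_Action"
begin

section \<open>Positive cones and left-orderings\<close>

definition positive_cone :: "('a, 'm) monoid_scheme \<Rightarrow> 'a set \<Rightarrow> bool" where
  "positive_cone G P \<longleftrightarrow>
     P \<subseteq> carrier G \<and>
     P <#>\<^bsub>G\<^esub> P \<subseteq> P \<and>
     P \<inter> set_inv\<^bsub>G\<^esub> P = {} \<and>
     P \<union> set_inv\<^bsub>G\<^esub> P = carrier G - {\<one>\<^bsub>G\<^esub>}"

text \<open>A left-ordering is given as the set of pairs \<open>(g, h)\<close> with \<open>g < h\<close>.\<close>

definition left_ordering :: "('a, 'm) monoid_scheme \<Rightarrow> ('a \<times> 'a) set \<Rightarrow> bool" where
  "left_ordering G r \<longleftrightarrow>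
     r \<subseteq> carrier G \<times> carrier G \<and> irrefl r \<and> trans r \<and> total_on (carrier G) r \<and>
     (\<forall>f\<in>carrier G. \<forall>g\<in>carrier G. \<forall>h\<in>carrier G.
        (g, h) \<in> r \<longrightarrow> (f \<otimes>\<^bsub>G\<^esub> g, f \<otimes>\<^bsub>G\<^esub> h) \<in> r)"

definition left_orderable :: "('a, 'm) monoid_scheme \<Rightarrow> bool" where
  "left_orderable G \<longleftrightarrow> (\<exists>P. positive_cone G P)"

definition tararin :: "('a, 'm) monoid_scheme \<Rightarrow> bool" where
  "tararin G \<longleftrightarrow> left_orderable G \<and> finite {r. left_ordering G r}"

lemma (in group) bij_betw_left_orderings_positive_cones:
  "bij_betw (\<lambda>r. {g \<in> carrier G. (\<one>, g) \<in> r}) {r. left_ordering G r} {P. positive_cone G P}"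
proof (rule bij_betwI[where g = "\<lambda>P. {(g, h). g \<in> carrier G \<and> h \<in> carrier G \<and> inv g \<otimes> h \<in> P}"])
  show "(\<lambda>r. {g \<in> carrier G. (\<one>, g) \<in> r}) \<in> {r. left_ordering G r} \<rightarrow> {P. positive_cone G P}"
  proof (intro funcsetI CollectI)
    fix r assume "r \<in> {r. left_ordering G r}"
    then have irr: "irrefl r" and tr: "trans r" and tot: "total_on (carrier G) r"
      and inv: "\<And>f g h. \<lbrakk>f \<in> carrier G; g \<in> carrier G; h \<in> carrier G; (g, h) \<in> r\<rbrakk>
                  \<Longrightarrow> (f \<otimes> g, f \<otimes> h) \<in> r"
      by (auto simp: left_ordering_def)
    have neg: "(\<one>, inv g) \<in> r \<longleftrightarrow> (g, \<one>) \<in> r" if "g \<in> carrier G" for g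
      using inv[of g \<one> "inv g"] inv[of "inv g" g \<one>] that by auto
    have mult: "(\<one>, g \<otimes> h) \<in> r"
      if "g \<in> carrier G" "h \<in> carrier G" "(\<one>, g) \<in> r" "(\<one>, h) \<in> r" for g h
      using inv[of g \<one> h] that tr by (metis one_closed r_one transD)
    have setinv: "set_inv {g \<in> carrier G. (\<one>, g) \<in> r} = {g \<in> carrier G. (g, \<one>) \<in> r}"
    proof (intro equalityI subsetI)
      fix x assume "x \<in> set_inv {g \<in> carrier G. (\<one>, g) \<in> r}"
      then obtain g where "g \<in> carrier G" "(\<one>, g) \<in> r" "x = inv g"
        by (auto simp: SET_INV_def)
      then show "x \<in> {g \<in> carrier G. (g, \<one>) \<in> r}"
        using neg[of "inv g"] by simp
    next
      fix x assume "x \<in> {g \<in> carrier G. (g, \<one>) \<in> r}"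
      then have "inv x \<in> {g \<in> carrier G. (\<one>, g) \<in> r}" "x = inv (inv x)"
        using neg by auto
      then show "x \<in> set_inv {g \<in> carrier G. (\<one>, g) \<in> r}"
        unfolding SET_INV_def by blast
    qed
    have disj: False if "(\<one>, g) \<in> r" "(g, \<one>) \<in> r" for g
      using irr tr that by (meson irrefl_def transD)
    have tot1: "(\<one>, g) \<in> r \<or> (g, \<one>) \<in> r" if "g \<in> carrier G" "g \<noteq> \<one>" for g
      using tot that by (auto simp: total_on_def)
    have notone: "(\<one>, \<one>) \<notin> r"
      using irr by (auto simp: irrefl_def)
    show "positive_cone G {g \<in> carrier G. (\<one>, g) \<in> r}"
      unfolding positive_cone_def setinv
      using mult disj tot1 notone by (auto simp: set_mult_def)
  qed
next
  show "(\<lambda>P. {(g, h). g \<in> carrier G \<and> h \<in> carrier G \<and> inv g \<otimes> h \<in> P})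
          \<in> {P. positive_cone G P} \<rightarrow> {r. left_ordering G r}"
  proof (intro funcsetI CollectI)
    fix P assume "P \<in> {P. positive_cone G P}"
    then have P: "P \<subseteq> carrier G" "P <#> P \<subseteq> P" "P \<inter> set_inv P = {}"
      "P \<union> set_inv P = carrier G - {\<one>}"
      by (auto simp: positive_cone_def)
    have mult: "x \<otimes> y \<in> P" if "x \<in> P" "y \<in> P" for x y
      using P(2) that by (auto simp: set_mult_def)
    have one: "\<one> \<notin> P" using P(4) by auto
    have tot: "x \<in> P \<or> inv x \<in> P" if "x \<in> carrier G" "x \<noteq> \<one>" for x
    proof -
      have "x \<in> P \<or> x \<in> set_inv P" using that P(4) by auto
      then show ?thesis using P(1) by (auto simp: SET_INV_def)
    qed
    have canc: "inv (f \<otimes> g) \<otimes> (f \<otimes> h) = inv g \<otimes> h"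
      if "f \<in> carrier G" "g \<in> carrier G" "h \<in> carrier G" for f g h
      using that by (simp add: inv_mult_group m_assoc) (metis inv_closed l_inv l_one m_assoc)
    let ?r = "{(g, h). g \<in> carrier G \<and> h \<in> carrier G \<and> inv g \<otimes> h \<in> P}"
    have "trans ?r"
    proof (rule transI)
      fix x y z assume "(x, y) \<in> ?r" "(y, z) \<in> ?r"
      then have c: "x \<in> carrier G" "y \<in> carrier G" "z \<in> carrier G"
        and "inv x \<otimes> y \<in> P" "inv y \<otimes> z \<in> P" by auto
      then have "(inv x \<otimes> y) \<otimes> (inv y \<otimes> z) \<in> P" using mult by blast
      moreover have "(inv x \<otimes> y) \<otimes> (inv y \<otimes> z) = inv x \<otimes> z"
        using c by (metis inv_closed m_assoc m_closed r_inv r_one)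
      ultimately show "(x, z) \<in> ?r" using c by auto
    qed
    moreover have "total_on (carrier G) ?r"
    proof (rule total_onI)
      fix x y assume c: "x \<in> carrier G" "y \<in> carrier G" "x \<noteq> y"
      then have "inv x \<otimes> y \<noteq> \<one>" by (metis inv_closed inv_equality inv_inv)
      then show "(x, y) \<in> ?r \<or> (y, x) \<in> ?r"
        using tot[of "inv x \<otimes> y"] c by (auto simp: inv_mult_group)
    qed
    moreover have "irrefl ?r" using one by (auto simp: irrefl_def)
    ultimately show "left_ordering G ?r"
      unfolding left_ordering_def using canc by auto
  qed
next
  fix r assume "r \<in> {r. left_ordering G r}"
  then have sub: "r \<subseteq> carrier G \<times> carrier G"
    and inv: "\<And>f g h. \<lbrakk>f \<in> carrier G; g \<in> carrier G; h \<in> carrier G; (g, h) \<in> r\<rbrakk>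
                \<Longrightarrow> (f \<otimes> g, f \<otimes> h) \<in> r"
    unfolding left_ordering_def by blast+
  have "(\<one>, inv g \<otimes> h) \<in> r \<longleftrightarrow> (g, h) \<in> r" if "g \<in> carrier G" "h \<in> carrier G" for g h
  proof
    assume "(\<one>, inv g \<otimes> h) \<in> r"
    then have "(g \<otimes> \<one>, g \<otimes> (inv g \<otimes> h)) \<in> r"
      using inv[of g \<one> "inv g \<otimes> h"] that by simp
    moreover have "g \<otimes> (inv g \<otimes> h) = h"
      using that by (simp add: m_assoc[symmetric])
    ultimately show "(g, h) \<in> r" using that by simp
  next
    assume "(g, h) \<in> r"
    then show "(\<one>, inv g \<otimes> h) \<in> r" using inv[of "inv g" g h] that by simp
  qed
  then show "{(g, h). g \<in> carrier G \<and> h \<in> carrier G \<and>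
                inv g \<otimes> h \<in> {g \<in> carrier G. (\<one>, g) \<in> r}} = r"
    using sub by auto
next
  fix P assume "P \<in> {P. positive_cone G P}"
  then show "{g \<in> carrier G. (\<one>, g) \<in>
      {(g, h). g \<in> carrier G \<and> h \<in> carrier G \<and> inv g \<otimes> h \<in> P}} = P"
    by (auto simp: positive_cone_def)
qed


section \<open>The space of left-orderings\<close>

definition LO :: "('a, 'm) monoid_scheme \<Rightarrow> 'a set set" where
  "LO G = {P. positive_cone G P}"

text \<open>The product topology on \<open>{0,1}\<close> to the power \<open>G\<close> is carried over to the subsets of \<open>G\<close> by
  identifying a subset with its indicator function, restricted to the carrier because the points
  of a \<^const>\<open>product_topology\<close> are extensional functions.\<close>

definition LO_topology :: "('a, 'm) monoid_scheme \<Rightarrow> 'a set topology" where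
  "LO_topology G =
     subtopology
       (pullback_topology (Pow (carrier G)) (\<lambda>P. \<lambda>g\<in>carrier G. g \<in> P)
          (product_topology (\<lambda>_. discrete_topology (UNIV :: bool set)) (carrier G)))
       (LO G)"

lemma topspace_LO_topology [simp]: "topspace (LO_topology G) = LO G"
  by (auto simp: LO_topology_def topspace_pullback_topology LO_def positive_cone_def)

definition isolated_point :: "'x topology \<Rightarrow> 'x \<Rightarrow> bool" where
  "isolated_point X x \<longleftrightarrow> x \<in> topspace X \<and> openin X {x}"

definition cone_conjugation :: "('a, 'm) monoid_scheme \<Rightarrow> 'a \<Rightarrow> 'a set \<Rightarrow> 'a set" where
  "cone_conjugation G g = (\<lambda>P\<in>LO G. g <#\<^bsub>G\<^esub> P #>\<^bsub>G\<^esub> inv\<^bsub>G\<^esub> g)"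

definition E_lo :: "('a, 'm) monoid_scheme \<Rightarrow> ('a set \<times> 'a set) set" where
  "E_lo G = {(P, Q). P \<in> LO G \<and> Q \<in> orbit G (cone_conjugation G) P}"

lemma (in group) positive_cone_conjugate:
  assumes "positive_cone G P" "g \<in> carrier G"
  shows "positive_cone G (g <#\<^bsub>G\<^esub> P #> inv g)"
proof -
  have P: "P \<subseteq> carrier G" "P <#> P \<subseteq> P" "P \<inter> set_inv P = {}"
    "P \<union> set_inv P = carrier G - {\<one>}"
    using assms by (auto simp: positive_cone_def)
  let ?c = "\<lambda>x. g \<otimes> x \<otimes> inv g"
  have Q: "g <#\<^bsub>G\<^esub> P #> inv g = ?c ` P"
    by (auto simp: l_coset_def r_coset_def)
  have cinv: "inv (?c x) = ?c (inv x)" if "x \<in> carrier G" for x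
    using that assms(2) by (simp add: inv_mult_group m_assoc)
  have cmult: "?c x \<otimes> ?c y = ?c (x \<otimes> y)" if "x \<in> carrier G" "y \<in> carrier G" for x y
    using that assms(2) by (simp add: m_assoc) (metis inv_closed l_inv l_one m_assoc m_closed)
  have bij: "bij_betw ?c (carrier G) (carrier G)"
    using conjugation_is_bij[OF assms(2)] by (simp cong: bij_betw_cong)
  have inj: "inj_on ?c (carrier G)" using bij by (rule bij_betw_imp_inj_on)
  have Pi: "set_inv P \<subseteq> carrier G" using P(4) by auto
  have Qi: "set_inv (?c ` P) = ?c ` (set_inv P)"
  proof -
    have im: "set_inv A = m_inv G ` A" for A by (auto simp: SET_INV_def)
    have "m_inv G ` ?c ` P = ?c ` m_inv G ` P"
      unfolding image_image using cinv P(1) by (intro image_cong) auto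
    then show ?thesis unfolding im .
  qed
  have "?c ` P \<inter> ?c ` (set_inv P) = ?c ` (P \<inter> set_inv P)"
    using inj_on_image_Int[OF inj P(1) Pi] by simp
  moreover have "?c ` P \<union> ?c ` (set_inv P) = ?c ` (carrier G - {\<one>})"
    using P(4) by (metis image_Un)
  moreover have "?c ` (carrier G - {\<one>}) = carrier G - {\<one>}"
  proof -
    have "?c ` (carrier G - {\<one>}) = ?c ` carrier G - ?c ` {\<one>}"
      using inj_on_image_set_diff[OF inj, of "carrier G" "{\<one>}"] by simp
    then show ?thesis using bij assms(2) by (simp add: bij_betw_def)
  qed
  moreover have "?c ` P <#> ?c ` P \<subseteq> ?c ` P"
  proof
    fix z assume "z \<in> ?c ` P <#> ?c ` P"
    then obtain x y where xy: "x \<in> P" "y \<in> P" "z = ?c x \<otimes> ?c y"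
      by (auto simp: set_mult_def)
    then have "z = ?c (x \<otimes> y)" using cmult P(1) by blast
    moreover have "x \<otimes> y \<in> P" using xy P(2) by (auto simp: set_mult_def)
    ultimately show "z \<in> ?c ` P" by blast
  qed
  moreover have "?c ` P \<subseteq> carrier G" using P(1) assms(2) by auto
  ultimately show ?thesis
    unfolding positive_cone_def Q Qi using P(3) by simp
qed

lemma (in group) equiv_E_lo: "equiv (LO G) (E_lo G)"
proof -
  have E: "E_lo G = {(P, Q). P \<in> LO G \<and> (\<exists>g\<in>carrier G. Q = g <#\<^bsub>G\<^esub> P #> inv g)}"
    by (auto simp: E_lo_def orbit_def cone_conjugation_def)
  have sub: "P \<subseteq> carrier G" if "P \<in> LO G" for P
    using that by (simp add: LO_def positive_cone_def)
  have closed: "g <#\<^bsub>G\<^esub> P #> inv g \<in> LO G" if "P \<in> LO G" "g \<in> carrier G" for P g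
    using positive_cone_conjugate that by (simp add: LO_def)
  have one: "\<one> <#\<^bsub>G\<^esub> P #> inv \<one> = P" if "P \<in> LO G" for P
    using sub[OF that] by (simp add: lcos_mult_one)
  have mult: "h <#\<^bsub>G\<^esub> (g <#\<^bsub>G\<^esub> P #> inv g) #> inv h = (h \<otimes> g) <#\<^bsub>G\<^esub> P #> inv (h \<otimes> g)"
    if "P \<in> LO G" "g \<in> carrier G" "h \<in> carrier G" for P g h
    using sub[OF that(1)] that
    by (simp add: coset_assoc coset_mult_assoc inv_mult_group l_coset_subset_G lcos_m_assoc
        r_coset_subset_G)
  show ?thesis
  proof (rule equivI)
    show "E_lo G \<subseteq> LO G \<times> LO G" using closed by (auto simp: E)
    show "refl_on (LO G) (E_lo G)" using one closed by (auto simp: refl_on_def E intro!: bexI[of _ \<one>])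
    show "sym (E_lo G)"
    proof (rule symI)
      fix P Q assume "(P, Q) \<in> E_lo G"
      then obtain g where "P \<in> LO G" "g \<in> carrier G" "Q = g <#\<^bsub>G\<^esub> P #> inv g" by (auto simp: E)
      then have g: "P \<in> LO G" "g \<in> carrier G" "Q = g <#\<^bsub>G\<^esub> P #> inv g" .
      have "inv g <#\<^bsub>G\<^esub> Q #> inv (inv g) = P"
        using mult[of P g "inv g"] one[of P] g by simp
      moreover have "Q \<in> LO G" using closed g by simp
      ultimately show "(Q, P) \<in> E_lo G" using g(2) unfolding E by blast
    qed
    show "trans (E_lo G)"
    proof (rule transI)
      fix P Q R assume "(P, Q) \<in> E_lo G" "(Q, R) \<in> E_lo G"
      then obtain g h where "P \<in> LO G" "g \<in> carrier G" "h \<in> carrier G"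
        "Q = g <#\<^bsub>G\<^esub> P #> inv g" "R = h <#\<^bsub>G\<^esub> Q #> inv h" by (auto simp: E)
      then show "(P, R) \<in> E_lo G"
        using mult by (auto simp: E intro!: bexI[of _ "h \<otimes> g"])
    qed
  qed
qed


section \<open>Smooth equivalence relations\<close>

definition polish_topology :: "'x topology \<Rightarrow> bool" where
  "polish_topology X \<longleftrightarrow> completely_metrizable_space X \<and> second_countable X"

definition borel_of :: "'x topology \<Rightarrow> 'x measure" where
  "borel_of X = sigma (topspace X) {U. openin X U}"

definition standard_borel :: "'y measure \<Rightarrow> bool" where
  "standard_borel Y \<longleftrightarrow>
     (\<exists>S. polish_topology S \<and> space Y = topspace S \<and> sets Y = sets (borel_of S))"

text \<open>Intended for a Borel equivalence relation \<open>E\<close> on a Polish space \<open>X\<close>. HOL has no quantifier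
  over types, so the type on which the standard Borel space \<open>Y\<close> lives is a parameter: a theorem
  asserting non-smoothness for a free type variable rules out the standard Borel spaces of all
  types.\<close>

definition smooth :: "'y itself \<Rightarrow> 'x topology \<Rightarrow> ('x \<times> 'x) set \<Rightarrow> bool" where
  "smooth (_ :: 'y itself) X E \<longleftrightarrow>
     (\<exists>Y :: 'y measure. standard_borel Y \<and>
        (\<exists>\<theta>. \<theta> \<in> measurable (borel_of X) Y \<and>
           (\<forall>x1\<in>topspace X. \<forall>x2\<in>topspace X. (x1, x2) \<in> E \<longleftrightarrow> \<theta> x1 = \<theta> x2)))"

end

theory Submission
  imports Defs
begin

text \<open>
Let \<open>P\<close> be an isolated point of the space of left-orderings of \<open>G\<close>, and suppose that \<open>G\<close> has infinitely
many left-orderings. The proof finds a left-ordering that is a limit of conjugates of itself different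
from itself, and then applies the Baire category theorem.

Isolation means that \<open>P\<close> is determined by a finite set \<open>F\<close> of positive elements. Reversing signs
between two convex subgroups gives new cones, so different convex subgroups meet \<open>F\<close> in
different sets (\<open>finite_convex_subgroups\<close>): there are finitely many of them. Let \<open>C\<close> be the largest
one that has only finitely many left-orderings, and let \<open>D\<close> be the next one.

The group \<open>D\<close> acts on the ordered set of cosets of \<open>C\<close>, and no convex subgroup lies strictly between
\<open>C\<close> and \<open>D\<close>. There are two possibilities (\<open>jump_dichotomy\<close>). Either the order on the cosets is invariant under conjugation,
and then Hoelder's theorem embeds \<open>D / C\<close> into the real numbers. Or arbitrarily
close to the coset \<open>C\<close> there are cosets \<open>g C\<close> from which the action looks different, and
conjugation by such \<open>g\<close> moves the cones that agree with \<open>P\<close> outside \<open>C\<close> to other cones close by.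

The first possibility would make the number of left-orderings of \<open>D\<close> finite
(\<open>finite_cones_extension\<close>). The reason is that a small perturbation of a real homomorphism, or more
generally of a cocycle, that is compatible with an isolated cone is still compatible with it.
This forces \<open>D / C\<close> to have rank one and, if \<open>C\<close> is nontrivial, some element of \<open>D\<close> to reverse, by conjugation, the
essentially unique homomorphism from \<open>C\<close> to the reals. Such an element (or triviality) makes \<open>C\<close> convex in each left-ordering of
\<open>D\<close>, which leaves finitely many of them.

So the second possibility holds. The cones that agree with \<open>P\<close> outside \<open>C\<close> form a finite set, each of them has
infinitely many conjugates that accumulate in this set, and one whose orbit closure is minimal
is an accumulation point of its own orbit (\<open>self_accumulating_cone\<close>). The closure of this orbit is a
compact space without isolated points, with a dense orbit. There invariant Borel sets are meager or comeager, so a Borel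
reduction to equality would be constant on a comeager set, although orbits are countable (\<open>not_smooth_if_recurrent\<close>).
\<close>

section \<open>Cones on subgroups and their convex subgroups\<close>

context group
begin

lemma mult_inv_cancel:
  assumes "x \<in> carrier G" "y \<in> carrier G"
  shows "x \<otimes> (inv x \<otimes> y) = y" "inv x \<otimes> (x \<otimes> y) = y"
  using assms by (simp_all add: m_assoc[symmetric])

lemmas group_word = m_assoc inv_mult_group mult_inv_cancel

text \<open>The order given by a cone \<open>P\<close> is \<open>x < y \<longleftrightarrow> inv x \<otimes> y \<in> P\<close>. A subgroup is convex for it as soon as
\<open>\<one> < x < x \<otimes> y \<in> C\<close> forces \<open>x \<in> C\<close>, because every interval with end points in \<open>C\<close> can be translated
so that it starts at \<open>\<one>\<close>.\<close>

definition convex_subgroup :: "'a set \<Rightarrow> 'a set \<Rightarrow> 'a set \<Rightarrow> bool" where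
  "convex_subgroup K P C \<longleftrightarrow>
     subgroup C G \<and> C \<subseteq> K \<and> (\<forall>x\<in>P. \<forall>y\<in>P. x \<otimes> y \<in> C \<longrightarrow> x \<in> C)"

definition conj_by :: "'a \<Rightarrow> 'a set \<Rightarrow> 'a set" where
  "conj_by g A = (\<lambda>x. g \<otimes> x \<otimes> inv g) ` A"

lemma mem_conj_by_iff:
  assumes "A \<subseteq> carrier G" "g \<in> carrier G" "x \<in> carrier G"
  shows "x \<in> conj_by g A \<longleftrightarrow> inv g \<otimes> x \<otimes> g \<in> A"
proof
  assume "x \<in> conj_by g A"
  then obtain a where a: "a \<in> A" "x = g \<otimes> a \<otimes> inv g" by (auto simp: conj_by_def)
  then have "inv g \<otimes> x \<otimes> g = a" using assms by (simp add: group_word subset_iff)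
  then show "inv g \<otimes> x \<otimes> g \<in> A" using a by simp
next
  assume "inv g \<otimes> x \<otimes> g \<in> A"
  moreover have "x = g \<otimes> (inv g \<otimes> x \<otimes> g) \<otimes> inv g" using assms by (simp add: group_word)
  ultimately show "x \<in> conj_by g A" unfolding conj_by_def by blast
qed

lemma conj_by_subset: "\<lbrakk>A \<subseteq> carrier G; g \<in> carrier G\<rbrakk> \<Longrightarrow> conj_by g A \<subseteq> carrier G"
  by (auto simp: conj_by_def)

lemma conj_by_mult:
  assumes "A \<subseteq> carrier G" "g \<in> carrier G" "h \<in> carrier G"
  shows "conj_by g (conj_by h A) = conj_by (g \<otimes> h) A"
  unfolding conj_by_def image_image
  by (intro image_cong refl) (use assms in \<open>auto simp: group_word subset_iff\<close>)

lemma conj_by_one: "A \<subseteq> carrier G \<Longrightarrow> conj_by \<one> A = A"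
  unfolding conj_by_def by (force simp: image_iff subset_iff)

lemma conj_by_inv:
  assumes "A \<subseteq> carrier G" "g \<in> carrier G"
  shows "conj_by (inv g) (conj_by g A) = A" "conj_by g (conj_by (inv g) A) = A"
  using assms by (simp_all add: conj_by_mult conj_by_one)

lemma conj_by_mono: "A \<subseteq> B \<Longrightarrow> conj_by g A \<subseteq> conj_by g B"
  by (auto simp: conj_by_def)

lemma conj_by_subgroup:
  assumes "subgroup C G" "g \<in> carrier G"
  shows "subgroup (conj_by g C) G"
proof -
  interpret C: subgroup C G by fact
  note mem = mem_conj_by_iff[OF C.subset assms(2)]
  show ?thesis
  proof (rule subgroupI)
    show "conj_by g C \<subseteq> carrier G" using conj_by_subset C.subset assms by simp
    show "conj_by g C \<noteq> {}" using C.one_closed unfolding conj_by_def by blast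
  next
    fix a assume "a \<in> conj_by g C"
    then show "inv a \<in> conj_by g C"
      using assms C.mem_carrier C.m_inv_closed
      by (auto simp: conj_by_def inv_mult_group m_assoc image_iff intro!: bexI[of _ "inv _"])
  next
    fix a b assume "a \<in> conj_by g C" "b \<in> conj_by g C"
    then obtain x y where "x \<in> C" "y \<in> C" "a = g \<otimes> x \<otimes> inv g" "b = g \<otimes> y \<otimes> inv g"
      by (auto simp: conj_by_def)
    then have "a \<otimes> b = g \<otimes> (x \<otimes> y) \<otimes> inv g" "x \<otimes> y \<in> C"
      using assms C.mem_carrier by (auto simp: group_word)
    then show "a \<otimes> b \<in> conj_by g C" unfolding conj_by_def by blast
  qed
qed

end

locale subgroup_of = group G for G (structure) +
  fixes K
  assumes subgroup_K: "subgroup K G"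
begin

lemma K_carrier [simp]: "x \<in> K \<Longrightarrow> x \<in> carrier G"
  using subgroup_K subgroup.subset by blast

lemma K_mult [simp]: "\<lbrakk>x \<in> K; y \<in> K\<rbrakk> \<Longrightarrow> x \<otimes> y \<in> K"
  using subgroup_K subgroup.m_closed by metis

lemma K_one [simp]: "\<one> \<in> K"
  using subgroup_K subgroup.one_closed by metis

lemma K_inv [simp]: "x \<in> K \<Longrightarrow> inv x \<in> K"
  using subgroup_K subgroup.m_inv_closed by metis

lemma K_pow [simp]: assumes "x \<in> K" shows "x [^] (n::nat) \<in> K"
proof (induction n)
  case (Suc n)
  show ?case unfolding nat_pow_Suc using Suc assms by (rule K_mult)
qed simp

lemma K_int_pow [simp]: "x \<in> K \<Longrightarrow> x [^] (n::int) \<in> K"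
  by (cases n rule: int_cases2) (simp_all add: int_pow_int int_pow_neg_int)

end

text \<open>A cone on a subgroup \<open>K\<close> of a fixed ambient group. Cones on several subgroups occur side by side, and
they are conjugated by elements of larger subgroups, so that a group record for each subgroup would
only be in the way.\<close>

locale ordered_subgroup = subgroup_of +
  fixes P
  assumes pos_sub: "P \<subseteq> K"
    and pos_mult: "\<lbrakk>x \<in> P; y \<in> P\<rbrakk> \<Longrightarrow> x \<otimes> y \<in> P"
    and pos_one: "\<one> \<notin> P"
    and pos_total: "\<lbrakk>x \<in> K; x \<noteq> \<one>\<rbrakk> \<Longrightarrow> x \<in> P \<or> inv x \<in> P"

lemmas (in group) ordered_subgroupI =
  ordered_subgroup.intro[OF subgroup_of.intro[OF group_axioms subgroup_of_axioms.intro]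
    ordered_subgroup_axioms.intro]

definition (in group) cones :: "'a set \<Rightarrow> 'a set set" where
  "cones K = {P. ordered_subgroup G K P}"

context ordered_subgroup
begin

lemma pos_K [simp]: "x \<in> P \<Longrightarrow> x \<in> K"
  using pos_sub by blast

lemma pos_carrier [simp]: "x \<in> P \<Longrightarrow> x \<in> carrier G"
  by simp

lemma pos_inv: "x \<in> P \<Longrightarrow> inv x \<notin> P"
  using pos_mult[of x "inv x"] pos_one by auto

lemma cone_eqI:
  assumes "ordered_subgroup G K Q" "P \<subseteq> Q"
  shows "Q = P"
proof (rule ccontr)
  interpret Q: ordered_subgroup G K Q by fact
  assume "Q \<noteq> P"
  then obtain x where x: "x \<in> Q" "x \<notin> P" using assms(2) by blast
  then have "inv x \<in> P" using pos_total[of x] Q.pos_one by auto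
  then show False using x assms(2) Q.pos_inv by auto
qed

lemma conj_cone_K:
  assumes "g \<in> K"
  shows "ordered_subgroup G K (conj_by g P)"
proof -
  have mem: "x \<in> conj_by g P \<longleftrightarrow> inv g \<otimes> x \<otimes> g \<in> P" if "x \<in> carrier G" for x
    by (rule mem_conj_by_iff) (use assms that in auto)
  show ?thesis
  proof (rule ordered_subgroupI)
    show "subgroup K G" by (rule subgroup_K)
    show sub: "conj_by g P \<subseteq> K" using assms by (auto simp: conj_by_def)
    show "x \<otimes> y \<in> conj_by g P" if "x \<in> conj_by g P" "y \<in> conj_by g P" for x y
    proof -
      have c: "x \<in> carrier G" "y \<in> carrier G" using that sub by auto
      have "inv g \<otimes> (x \<otimes> y) \<otimes> g = (inv g \<otimes> x \<otimes> g) \<otimes> (inv g \<otimes> y \<otimes> g)"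
        using c assms by (simp add: group_word)
      then show ?thesis using that mem c pos_mult by simp
    qed
    show "\<one> \<notin> conj_by g P" using mem[of \<one>] assms pos_one by simp
    show "x \<in> conj_by g P \<or> inv x \<in> conj_by g P" if "x \<in> K" "x \<noteq> \<one>" for x
    proof -
      have "inv g \<otimes> x \<otimes> g \<noteq> \<one>"
      proof
        assume "inv g \<otimes> x \<otimes> g = \<one>"
        then have "g \<otimes> (inv g \<otimes> x \<otimes> g) \<otimes> inv g = \<one>" using assms by simp
        then show False using that assms by (simp add: group_word)
      qed
      then have "inv g \<otimes> x \<otimes> g \<in> P \<or> inv (inv g \<otimes> x \<otimes> g) \<in> P"
        using pos_total assms that by auto
      moreover have "inv (inv g \<otimes> x \<otimes> g) = inv g \<otimes> inv x \<otimes> g"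
        using assms that by (simp add: group_word)
      ultimately show ?thesis using mem that by auto
    qed
  qed
qed

lemma convex_conj:
  assumes "convex_subgroup K P C" "g \<in> K"
  shows "convex_subgroup K (conj_by g P) (conj_by g C)"
proof -
  have C: "subgroup C G" "C \<subseteq> K" "\<And>x y. \<lbrakk>x \<in> P; y \<in> P; x \<otimes> y \<in> C\<rbrakk> \<Longrightarrow> x \<in> C"
    using assms by (auto simp: convex_subgroup_def)
  have inj: "g \<otimes> x \<otimes> inv g = g \<otimes> y \<otimes> inv g \<Longrightarrow> x = y" if "x \<in> carrier G" "y \<in> carrier G" for x y
    using that assms by simp
  show ?thesis unfolding convex_subgroup_def
  proof (intro conjI ballI impI)
    show "subgroup (conj_by g C) G" using C assms by (simp add: conj_by_subgroup)
    show "conj_by g C \<subseteq> K" using C assms by (auto simp: conj_by_def)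
  next
    fix a b assume "a \<in> conj_by g P" "b \<in> conj_by g P" "a \<otimes> b \<in> conj_by g C"
    then obtain x y z where *: "x \<in> P" "y \<in> P" "z \<in> C" "a = g \<otimes> x \<otimes> inv g" "b = g \<otimes> y \<otimes> inv g"
       "a \<otimes> b = g \<otimes> z \<otimes> inv g" by (auto simp: conj_by_def)
    moreover have "a \<otimes> b = g \<otimes> (x \<otimes> y) \<otimes> inv g" using * assms by (simp add: group_word)
    moreover have "x \<otimes> y \<in> carrier G" "z \<in> carrier G" using * C(2) by auto
    ultimately have "x \<otimes> y = z" using inj[of "x \<otimes> y" z] by metis
    then have "x \<in> C" using C(3)[of x y] * by simp
    then show "a \<in> conj_by g C" using * by (auto simp: conj_by_def)
  qed
qed

lemma convex_K: "convex_subgroup K P K"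
  using subgroup_K unfolding convex_subgroup_def by auto

lemma convex_one: "convex_subgroup K P {\<one>}"
  unfolding convex_subgroup_def
  using pos_mult pos_one by (auto simp: triv_subgroup) metis

text \<open>Given positive \<open>c \<in> C - D\<close> and \<open>d \<in> D - C\<close>, the smaller of the two lies between \<open>\<one>\<close> and the
larger one, hence in the subgroup of the larger one.\<close>

lemma convex_comparable:
  assumes C: "convex_subgroup K P C" and D: "convex_subgroup K P D"
  shows "C \<subseteq> D \<or> D \<subseteq> C"
proof (rule ccontr)
  have sub: "subgroup C G" "subgroup D G" "C \<subseteq> K" "D \<subseteq> K"
    using C D by (auto simp: convex_subgroup_def)
  interpret C: subgroup C G by fact
  interpret D: subgroup D G by fact
  have pos: "\<exists>x\<in>P. x \<in> A \<and> x \<notin> B"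
    if "\<not> A \<subseteq> B" "subgroup A G" "subgroup B G" "A \<subseteq> K" for A B
  proof -
    from that obtain a where a: "a \<in> A" "a \<notin> B" by blast
    then have "a \<noteq> \<one>" using that subgroup.one_closed by metis
    then have "a \<in> P \<or> inv a \<in> P" using a that pos_total by blast
    moreover have "inv a \<in> A" using a that subgroup.m_inv_closed by metis
    moreover have "inv a \<notin> B" using a that subgroup.m_inv_closed
      by (metis K_carrier inv_inv subsetD)
    ultimately show ?thesis using a by blast
  qed
  assume "\<not> ?thesis"
  then obtain c d where c: "c \<in> P" "c \<in> C" "c \<notin> D" and d: "d \<in> P" "d \<in> D" "d \<notin> C"
    using pos[of C D] pos[of D C] sub by blast
  have "inv c \<otimes> d \<noteq> \<one>" using c d by (metis inv_equality inv_inv pos_carrier inv_closed)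
  then consider "inv c \<otimes> d \<in> P" | "inv (inv c \<otimes> d) \<in> P"
    using pos_total[of "inv c \<otimes> d"] c d by (meson K_inv K_mult pos_K)
  then show False
  proof cases
    case 1
    have "c \<otimes> (inv c \<otimes> d) = d" using c d by (simp add: group_word)
    then show False using D 1 c d unfolding convex_subgroup_def by metis
  next
    case 2
    have "d \<otimes> inv (inv c \<otimes> d) = c" using c d by (simp add: group_word)
    then show False using C 2 c d unfolding convex_subgroup_def by metis
  qed
qed

end

locale ordered_with_convex = ordered_subgroup +
  fixes C
  assumes convex_C: "convex_subgroup K P C"
begin

abbreviation S :: "'a set" where "S \<equiv> P - C"

lemma subgroup_C: "subgroup C G" and C_sub: "C \<subseteq> K"
  using convex_C by (auto simp: convex_subgroup_def)

lemma C_K [simp]: "x \<in> C \<Longrightarrow> x \<in> K" using C_sub by blast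
lemma C_carrier [simp]: "x \<in> C \<Longrightarrow> x \<in> carrier G" by simp
lemma C_mult [simp]: "\<lbrakk>x \<in> C; y \<in> C\<rbrakk> \<Longrightarrow> x \<otimes> y \<in> C" using subgroup_C subgroup.m_closed by metis
lemma C_one [simp]: "\<one> \<in> C" using subgroup_C subgroup.one_closed by metis
lemma C_inv [simp]: "x \<in> C \<Longrightarrow> inv x \<in> C" using subgroup_C subgroup.m_inv_closed by metis

lemma C_inv_iff [simp]: "x \<in> K \<Longrightarrow> inv x \<in> C \<longleftrightarrow> x \<in> C"
  using C_inv by (metis K_carrier inv_inv)

lemma C_mult_cancel [simp]:
  assumes "c \<in> C" "x \<in> K"
  shows "x \<otimes> c \<in> C \<longleftrightarrow> x \<in> C" "c \<otimes> x \<in> C \<longleftrightarrow> x \<in> C"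
proof -
  have e: "x \<otimes> c \<otimes> inv c = x" "inv c \<otimes> (c \<otimes> x) = x" using assms by (simp_all add: group_word)
  show "x \<otimes> c \<in> C \<longleftrightarrow> x \<in> C" "c \<otimes> x \<in> C \<longleftrightarrow> x \<in> C"
    using C_mult[of "x \<otimes> c" "inv c"] C_mult[of x c] C_mult[of "inv c" "c \<otimes> x"] C_mult[of c x] 
      assms(1) C_inv[OF assms(1)] unfolding e by meson+
qed

lemma convexD: "\<lbrakk>x \<in> P; y \<in> P; x \<otimes> y \<in> C\<rbrakk> \<Longrightarrow> x \<in> C"
  using bspec[OF bspec[OF convex_C[unfolded convex_subgroup_def, THEN conjunct2, THEN conjunct2]], of x y]
  by (rule mp)

lemma convexD2: assumes "x \<in> P" "y \<in> P" "x \<otimes> y \<in> C" shows "y \<in> C"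
  using convexD[OF assms] assms by simp

text \<open>If \<open>x\<close> is positive and outside \<open>C\<close>, then \<open>x \<otimes> c\<close> cannot be negative: otherwise \<open>x\<close> would lie between
\<open>\<one>\<close> and \<open>inv c\<close>. Together with its mirror image below this says that the elements of \<open>P - C\<close> form
a cone modulo \<open>C\<close> from both sides.\<close>

lemma S_mult_C: assumes "x \<in> S" "c \<in> C" shows "x \<otimes> c \<in> S"
proof (rule ccontr)
  have "x \<otimes> c \<notin> C" using assms by simp
  moreover have "x \<otimes> c \<noteq> \<one>" using calculation C_one by metis
  moreover assume "x \<otimes> c \<notin> S"
  ultimately have "inv (x \<otimes> c) \<in> P" using pos_total[of "x \<otimes> c"] assms by simp
  moreover have "inv (x \<otimes> c) \<otimes> x = inv c" using assms by (simp add: group_word)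
  moreover have "x \<in> P" "inv c \<in> C" using assms by simp_all
  ultimately have "x \<in> C" using convexD2[of "inv (x \<otimes> c)" x] by metis
  then show False using assms by simp
qed

lemma C_mult_S: assumes "x \<in> S" "c \<in> C" shows "c \<otimes> x \<in> S"
proof (rule ccontr)
  have "c \<otimes> x \<notin> C" using assms by simp
  moreover have "c \<otimes> x \<noteq> \<one>" using calculation C_one by metis
  moreover assume "c \<otimes> x \<notin> S"
  ultimately have "inv (c \<otimes> x) \<in> P" using pos_total[of "c \<otimes> x"] assms by simp
  moreover have "x \<otimes> inv (c \<otimes> x) = inv c" using assms by (simp add: group_word)
  moreover have "x \<in> P" "inv c \<in> C" using assms by simp_all
  ultimately have "x \<in> C" using convexD[of x "inv (c \<otimes> x)"] by metis
  then show False using assms by simp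
qed

lemma S_mult: "\<lbrakk>x \<in> S; y \<in> S\<rbrakk> \<Longrightarrow> x \<otimes> y \<in> S"
  using convexD pos_mult by blast

lemma S_K: "x \<in> S \<Longrightarrow> x \<in> K" by simp

lemma S_total: "x \<in> K \<Longrightarrow> x \<in> S \<or> x \<in> C \<or> inv x \<in> S"
  using pos_total[of x] C_one C_inv_iff[of x] by (cases "x = \<one>") auto

lemma S_inv: "x \<in> S \<Longrightarrow> inv x \<notin> S"
  using pos_inv by auto

text \<open>The sign of an element outside \<open>C\<close> is a property of its coset, so the order on \<open>C\<close> may be
exchanged for any other one.\<close>

lemma replace_cone:
  assumes R: "ordered_subgroup G C R"
  shows "ordered_subgroup G K (S \<union> R)"
proof -
  interpret R: ordered_subgroup G C R by fact
  show ?thesis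
  proof (rule ordered_subgroupI)
    show "subgroup K G" by (rule subgroup_K)
    show "S \<union> R \<subseteq> K" by auto
    show "\<one> \<notin> S \<union> R" using R.pos_one pos_one by auto
    show "x \<otimes> y \<in> S \<union> R" if "x \<in> S \<union> R" "y \<in> S \<union> R" for x y
      using that S_mult[of x y] S_mult_C[of x y] C_mult_S[of y x] R.pos_mult[of x y] R.pos_K by blast
    show "x \<in> S \<union> R \<or> inv x \<in> S \<union> R" if "x \<in> K" "x \<noteq> \<one>" for x
      using that S_total[of x] R.pos_total[of x] by blast
  qed
qed

lemma inv_S_iff: "x \<in> K \<Longrightarrow> x \<in> m_inv G ` S \<longleftrightarrow> inv x \<in> S"
  by (metis (no_types, lifting) K_carrier S_K image_iff inv_inv)

text \<open>For the same reason all signs outside \<open>C\<close> may be reversed while the order on \<open>C\<close> is kept.\<close>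

lemma flip_cone: "ordered_subgroup G K (m_inv G ` S \<union> (P \<inter> C))"
proof (rule ordered_subgroupI)
  show "subgroup K G" by (rule subgroup_K)
  show "m_inv G ` S \<union> P \<inter> C \<subseteq> K" by auto
  show "\<one> \<notin> m_inv G ` S \<union> P \<inter> C" using pos_one inv_S_iff[of \<one>] by auto
  show "x \<otimes> y \<in> m_inv G ` S \<union> P \<inter> C" if xy: "x \<in> m_inv G ` S \<union> P \<inter> C" "y \<in> m_inv G ` S \<union> P \<inter> C" for x y
  proof -
    have K: "x \<in> K" "y \<in> K" using xy by auto
    have i: "inv (x \<otimes> y) = inv y \<otimes> inv x" using K by (simp add: group_word)
    have "inv (x \<otimes> y) \<in> S \<or> x \<otimes> y \<in> P \<inter> C"
      using xy K inv_S_iff[of x] inv_S_iff[of y] i S_mult[of "inv y" "inv x"] S_mult_C[of "inv y" "inv x"]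
        C_mult_S[of "inv x" "inv y"] pos_mult[of x y] C_inv C_mult[of x y] by auto
    then show ?thesis using inv_S_iff K by auto
  qed
  show "x \<in> m_inv G ` S \<union> P \<inter> C \<or> inv x \<in> m_inv G ` S \<union> P \<inter> C" if "x \<in> K" "x \<noteq> \<one>" for x
  proof -
    have "x \<in> S \<or> inv x \<in> S \<or> x \<in> P \<inter> C \<or> inv x \<in> P \<inter> C"
      using that S_total[of x] pos_total[of x] by auto
    then show ?thesis using inv_S_iff[of x] inv_S_iff[of "inv x"] that by auto
  qed
qed

lemma restrict_cone: "ordered_subgroup G C (P \<inter> C)"
  by (rule ordered_subgroupI) (use subgroup_C pos_mult pos_one pos_total in auto)

lemma agree_outside:
  assumes "ordered_subgroup G K Q" "S \<subseteq> Q"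
  shows "Q - C = S"
proof -
  interpret Q: ordered_subgroup G K Q by fact
  have "x \<in> S" if "x \<in> Q" "x \<notin> C" for x
    using S_total[of x] Q.pos_inv[of x] that assms by auto
  then show ?thesis using assms by auto
qed

text \<open>For \<open>D \<supseteq> C\<close> convexity is a statement about the order on cosets of \<open>C\<close>, and two cones that agree
outside \<open>C\<close> induce the same order on these cosets.\<close>

lemma convex_agree:
  assumes Q: "ordered_subgroup G K Q" "S \<subseteq> Q" and D: "C \<subseteq> D"
  shows "convex_subgroup K Q D \<longleftrightarrow> convex_subgroup K P D"
proof -
  have *: "convex_subgroup K Q2 D"
    if "convex_subgroup K Q1 D" "ordered_subgroup G K Q2" "Q2 - C = S" "Q1 - C = S" 
       "ordered_subgroup G K Q1" for Q1 Q2
  proof -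
    interpret Q2: ordered_subgroup G K Q2 by fact
    have cD: "subgroup D G" "D \<subseteq> K" "\<And>x y. \<lbrakk>x \<in> Q1; y \<in> Q1; x \<otimes> y \<in> D\<rbrakk> \<Longrightarrow> x \<in> D"
      using that by (auto simp: convex_subgroup_def)
    interpret D: subgroup D G by fact
    have "x \<in> D" if xy: "x \<in> Q2" "y \<in> Q2" "x \<otimes> y \<in> D" for x y
    proof (rule ccontr)
      assume x: "x \<notin> D"
      then have xC: "x \<notin> C" using D by auto
      show False
      proof (cases "y \<in> C")
        case True
        have "x \<otimes> y \<otimes> inv y \<in> D"
          using D.m_closed[OF xy(3) D.m_inv_closed[of y]] True D by blast
        moreover have "x \<in> carrier G" "y \<in> carrier G" using xy Q2.pos_carrier by simp_all
        ultimately show False using x by (simp add: m_assoc)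
      next
        case False
        then show False using cD(3)[of x y] xy x xC \<open>Q2 - C = S\<close> \<open>Q1 - C = S\<close> by blast
      qed
    qed
    then show ?thesis using cD(1,2) unfolding convex_subgroup_def by blast
  qed
  show ?thesis
    using *[OF _ ordered_subgroup_axioms refl agree_outside[OF Q] Q(1)]
      *[OF _ Q(1) agree_outside[OF Q] refl ordered_subgroup_axioms] by (rule iffI)
qed

end

section \<open>Hoelder's theorem\<close>

lemma bounded_multiples_zero:
  fixes d c :: real
  assumes "\<And>n::nat. \<bar>real n * d\<bar> \<le> c"
  shows "d = 0"
proof (rule ccontr)
  assume "d \<noteq> 0"
  then obtain n :: nat where "c < real n * \<bar>d\<bar>"
    using reals_Archimedean3[of "\<bar>d\<bar>"] by auto
  then show False using assms[of n] by (simp add: abs_mult)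
qed

text \<open>The slope is the supremum of the quotients \<open>a n / n\<close>. It satisfies the upper estimate because
\<open>m * a n \<le> a (m * n) \<le> n * (a m + 1)\<close> puts each \<open>a n / n\<close> below each \<open>(a m + 1) / m\<close>.\<close>

lemma almost_additive_sequence_slope:
  fixes a :: "nat \<Rightarrow> int"
  assumes lower: "\<And>n m. a n + a m \<le> a (n + m)"
    and upper: "\<And>n m. a (n + m) \<le> a n + a m + 1"
  shows "\<exists>t::real. \<forall>n. real_of_int (a n) \<le> real n * t \<and> real n * t \<le> real_of_int (a n) + 1"
proof -
  have lo: "int m * a n \<le> a (m * n)" if "m \<ge> 1" for m n
    using that
  proof (induction m rule: dec_induct)
    case (step m)
    then show ?case using lower[of n "m * n"] by (simp add: algebra_simps)
  qed simp
  have up: "a (m * n) \<le> int m * a n + int m - 1" if "m \<ge> 1" for m n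
    using that
  proof (induction m rule: dec_induct)
    case (step m)
    then show ?case using upper[of n "m * n"] by (simp add: algebra_simps)
  qed simp
  have quot: "real_of_int (a n) / real n \<le> (real_of_int (a m) + 1) / real m" if "n \<ge> 1" "m \<ge> 1" for n m
  proof -
    have "int m * a n \<le> int n * a m + int n - 1"
      using lo[of m n] up[of n m] that by (simp add: mult.commute)
    then have "real_of_int (int m * a n) \<le> real_of_int (int n * a m + int n)" by linarith
    then have "real m * real_of_int (a n) \<le> real n * (real_of_int (a m) + 1)"
      by (simp add: algebra_simps)
    then show ?thesis using that by (simp add: divide_simps mult.commute)
  qed
  define A where "A = (\<lambda>n. real_of_int (a n) / real n) ` {1..}"
  have bdd: "bdd_above A" using quot[of _ 1] by (auto simp: A_def bdd_above_def)
  have "real_of_int (a n) \<le> real n * Sup A \<and> real n * Sup A \<le> real_of_int (a n) + 1" for n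
  proof (cases "n = 0")
    case True
    then show ?thesis using lower[of 0 0] upper[of 0 0] by simp
  next
    case False
    then have n: "n \<ge> 1" by simp
    have "real_of_int (a n) / real n \<le> Sup A"
      using n bdd by (intro cSup_upper) (auto simp: A_def)
    moreover have "Sup A \<le> (real_of_int (a n) + 1) / real n"
      using n quot by (intro cSup_least) (auto simp: A_def)
    ultimately show ?thesis using n by (simp add: field_simps)
  qed
  then show ?thesis by blast
qed

definition (in group) real_hom :: "'a set \<Rightarrow> ('a \<Rightarrow> real) \<Rightarrow> bool" where
  "real_hom K f \<longleftrightarrow> (\<forall>x\<in>K. \<forall>y\<in>K. f (x \<otimes> y) = f x + f y)"

text \<open>\<open>W\<close> is the set of nonnegative elements of a bi-invariant total preorder on \<open>K\<close> in which the powers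
of \<open>h\<close> are cofinal. Let \<open>f x\<close> be the largest exponent \<open>k\<close> with \<open>h [^] k \<le> x\<close>. By bi-invariance
\<open>f\<close> is additive up to an error of 1, and \<open>\<tau> x\<close> is the slope of \<open>f (x [^] n)\<close>. As \<open>K\<close> is not known to be
commutative, additivity of \<open>\<tau>\<close> needs an argument: if \<open>x \<otimes> y \<le> y \<otimes> x\<close>, then \<open>(x \<otimes> y) [^] n\<close>
lies between \<open>x [^] n \<otimes> y [^] n\<close> and \<open>y [^] n \<otimes> x [^] n\<close>, on which \<open>f\<close> takes nearly the same value.\<close>

theorem (in subgroup_of) Hoelder_embedding:
  assumes W_sub: "W \<subseteq> K"
    and W_mult: "\<And>x y. \<lbrakk>x \<in> W; y \<in> W\<rbrakk> \<Longrightarrow> x \<otimes> y \<in> W"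
    and W_conj: "\<And>g x. \<lbrakk>g \<in> K; x \<in> W\<rbrakk> \<Longrightarrow> inv g \<otimes> x \<otimes> g \<in> W"
    and W_total: "\<And>x. x \<in> K \<Longrightarrow> x \<in> W \<or> inv x \<in> W"
    and h: "h \<in> W" "inv h \<notin> W"
    and arch: "\<And>x. x \<in> K \<Longrightarrow> \<exists>n::nat. inv x \<otimes> h [^] n \<in> W"
  shows "\<exists>\<tau>. real_hom K \<tau> \<and> (\<forall>x\<in>W. 0 \<le> \<tau> x) \<and> \<tau> h = 1"
proof -
  have hK [simp]: "h \<in> K" using h W_sub by blast
  have W1: "\<one> \<in> W" using W_total[of \<one>] by simp
  define le where "le x y \<longleftrightarrow> inv x \<otimes> y \<in> W" for x y
  have refl: "le x x" if "x \<in> K" for x using that W1 by (simp add: le_def)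
  have total: "le x y \<or> le y x" if "x \<in> K" "y \<in> K" for x y
    using W_total[of "inv x \<otimes> y"] that by (auto simp: le_def inv_mult_group)
  have trans: "le x z" if "le x y" "le y z" "x \<in> K" "y \<in> K" "z \<in> K" for x y z
    using W_mult[of "inv x \<otimes> y" "inv y \<otimes> z"] that by (simp add: le_def group_word)
  have lmult: "le (z \<otimes> x) (z \<otimes> y) \<longleftrightarrow> le x y" if "x \<in> K" "y \<in> K" "z \<in> K" for x y z
    using that by (simp add: le_def group_word)
  have rmult: "le (x \<otimes> z) (y \<otimes> z)" if "le x y" "x \<in> K" "y \<in> K" "z \<in> K" for x y z
    using W_conj[of z "inv x \<otimes> y"] that by (simp add: le_def group_word)
  have mono: "le (x \<otimes> u) (y \<otimes> v)" if "le x y" "le u v" "x \<in> K" "y \<in> K" "u \<in> K" "v \<in> K" for x y u v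
    using trans[of "x \<otimes> u" "y \<otimes> u" "y \<otimes> v"] rmult[of x y u] lmult[of u v y] that by simp
  have powW: "h [^] n \<in> W" for n :: nat
    by (induction n) (use W1 W_mult h in simp_all)
  have pow_mono: "le (h [^] j) (h [^] k)" if "j \<le> k" for j k :: int
  proof -
    have "inv (h [^] j) \<otimes> h [^] k = h [^] (k - j)"
      using int_pow_mult[of h "- j" k] by (simp add: int_pow_neg)
    also have "\<dots> = h [^] (nat (k - j))" using that by (metis int_pow_int zero_le_imp_eq_int diff_ge_0_iff_ge nat_int)
    finally show ?thesis using powW by (simp add: le_def)
  qed
  have not_le_Suc: "\<not> le (h [^] (k + 1)) (h [^] k)" for k :: int
  proof -
    have "inv (h [^] (k + 1)) \<otimes> h [^] k = h [^] (- 1 :: int)"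
      using int_pow_mult[of h "- (k + 1)" k] int_pow_neg[of h "k + 1"] by simp
    also have "\<dots> = inv h" by (simp add: int_pow_neg)
    finally show ?thesis using h by (simp add: le_def)
  qed
  have "\<exists>k::int. le (h [^] k) x \<and> \<not> le (h [^] (k + 1)) x" if x: "x \<in> K" for x
  proof (rule ccontr)
    assume "\<nexists>k::int. le (h [^] k) x \<and> \<not> le (h [^] (k + 1)) x"
    then have step: "le (h [^] k) x \<Longrightarrow> le (h [^] (k + 1)) x" for k :: int by blast
    obtain n m :: nat where n: "inv (inv x) \<otimes> h [^] n \<in> W" and m: "inv x \<otimes> h [^] m \<in> W"
      using arch x by (metis K_inv)
    have "inv (h [^] (- int n)) \<otimes> x = inv (inv (h [^] n)) \<otimes> (inv (inv x) \<otimes> h [^] n) \<otimes> inv (h [^] n)"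
      using x by (simp add: int_pow_neg_int group_word)
    then have start: "le (h [^] (- int n)) x"
      using W_conj[OF _ n, of "inv (h [^] n)"] x by (simp add: le_def)
    have "le (h [^] k) x" if "- int n \<le> k" for k
      using that by (induction k rule: int_ge_induct) (use start step in auto)
    then have "le (h [^] (int m + 1)) x" by simp
    moreover have "le x (h [^] int m)" using m by (simp add: le_def int_pow_int)
    ultimately show False using trans[of "h [^] (int m + 1)" x "h [^] int m"] not_le_Suc[of "int m"] x by simp
  qed
  then obtain f :: "'a \<Rightarrow> int" where f: "\<And>x. x \<in> K \<Longrightarrow> le (h [^] f x) x" "\<And>x. x \<in> K \<Longrightarrow> \<not> le (h [^] (f x + 1)) x"
    by metis
  have f_ge: "j \<le> f x" if "le (h [^] j) x" "x \<in> K" for x j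
  proof (rule ccontr)
    assume "\<not> j \<le> f x"
    then have "le (h [^] (f x + 1)) (h [^] j)" by (intro pow_mono) simp
    then show False using trans[of "h [^] (f x + 1)" "h [^] j" x] that f(2) by simp
  qed
  have f_mono: "f x \<le> f y" if "le x y" "x \<in> K" "y \<in> K" for x y
    using f_ge[of "f x" y] trans[of "h [^] f x" x y] f(1)[of x] that by simp
  have f_lower: "f x + f y \<le> f (x \<otimes> y)" if "x \<in> K" "y \<in> K" for x y
    using f_ge[of "f x + f y" "x \<otimes> y"] mono[of "h [^] f x" x "h [^] f y" y] f(1) that
    by (simp add: int_pow_mult)
  have f_upper: "f (x \<otimes> y) \<le> f x + f y + 1" if "x \<in> K" "y \<in> K" for x y
  proof (rule ccontr)
    assume "\<not> ?thesis"
    then have "le (h [^] (f x + f y + 2)) (h [^] f (x \<otimes> y))" by (intro pow_mono) simp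
    then have "le (h [^] (f x + f y + 2)) (x \<otimes> y)"
      using trans[of "h [^] (f x + f y + 2)" "h [^] f (x \<otimes> y)" "x \<otimes> y"] f(1) that by simp
    moreover have "le x (h [^] (f x + 1))" using total[of x "h [^] (f x + 1)"] f(2) that by auto
    then have "le (x \<otimes> y) (h [^] (f x + 1) \<otimes> y)" using rmult that by simp
    ultimately have "le (h [^] (f x + f y + 2)) (h [^] (f x + 1) \<otimes> y)"
      using trans[of "h [^] (f x + f y + 2)" "x \<otimes> y" "h [^] (f x + 1) \<otimes> y"] that by simp
    moreover have "h [^] (f x + f y + 2) = h [^] (f x + 1) \<otimes> h [^] (f y + 1)"
      by (simp add: int_pow_mult[symmetric] algebra_simps)
    ultimately show False using lmult[of "h [^] (f y + 1)" y "h [^] (f x + 1)"] f(2) that by simp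
  qed
  have "\<exists>t::real. \<forall>n::nat. real_of_int (f (x [^] n)) \<le> real n * t \<and> real n * t \<le> real_of_int (f (x [^] n)) + 1"
    if "x \<in> K" for x
    using f_lower f_upper that
    by (intro almost_additive_sequence_slope) (simp_all add: nat_pow_mult[symmetric])
  then obtain \<tau> :: "'a \<Rightarrow> real" where \<tau>:
    "\<And>x n. x \<in> K \<Longrightarrow> real_of_int (f (x [^] n)) \<le> real n * \<tau> x"
    "\<And>x n. x \<in> K \<Longrightarrow> real n * \<tau> x \<le> real_of_int (f (x [^] n)) + 1"
    by metis
  \<comment> \<open>Sorting the letters of \<open>(x \<otimes> y) [^] n\<close> moves the element monotonically: down if the \<open>x\<close> go to
    the left, up if they go to the right.\<close>
  have commute: "le (x [^] n \<otimes> y [^] n) ((x \<otimes> y) [^] n) \<and> le ((x \<otimes> y) [^] n) (y [^] n \<otimes> x [^] n)"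
    if "le (x \<otimes> y) (y \<otimes> x)" and xy: "x \<in> K" "y \<in> K" for x y and n :: nat
  proof -
    have sw: "le (x \<otimes> y [^] n) (y [^] n \<otimes> x)" for n :: nat
    proof (induction n)
      case 0
      then show ?case using xy refl by simp
    next
      case (Suc n)
      have "le (x \<otimes> y [^] n \<otimes> y) (y [^] n \<otimes> x \<otimes> y)" using Suc rmult xy by simp
      moreover have "le (y [^] n \<otimes> (x \<otimes> y)) (y [^] n \<otimes> (y \<otimes> x))" using that(1) lmult xy by simp
      ultimately show ?case
        using trans[of "x \<otimes> y [^] n \<otimes> y" "y [^] n \<otimes> x \<otimes> y" "y [^] n \<otimes> (y \<otimes> x)"] xy
        by (simp add: m_assoc)
    qed
    show ?thesis
    proof (induction n)
      case 0
      then show ?case using refl by simp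
    next
      case (Suc n)
      have "le (x [^] n \<otimes> (x \<otimes> y [^] n) \<otimes> y) (x [^] n \<otimes> (y [^] n \<otimes> x) \<otimes> y)"
        using sw lmult rmult xy by simp
      moreover have "le (x [^] n \<otimes> y [^] n \<otimes> (x \<otimes> y)) ((x \<otimes> y) [^] n \<otimes> (x \<otimes> y))"
        using Suc rmult xy by simp
      ultimately have 1: "le (x [^] Suc n \<otimes> y [^] Suc n) ((x \<otimes> y) [^] Suc n)"
        using trans[of "x [^] n \<otimes> (x \<otimes> y [^] n) \<otimes> y" "x [^] n \<otimes> (y [^] n \<otimes> x) \<otimes> y" "(x \<otimes> y) [^] n \<otimes> (x \<otimes> y)"] xy
        by (simp add: m_assoc)
      have sw': "le (x [^] m \<otimes> y) (y \<otimes> x [^] m)" for m :: nat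
      proof (induction m)
        case 0
        then show ?case using xy refl by simp
      next
        case (Suc m)
        have "le (x [^] m \<otimes> (x \<otimes> y)) (x [^] m \<otimes> (y \<otimes> x))" using that(1) lmult xy by simp
        moreover have "le (x [^] m \<otimes> y \<otimes> x) (y \<otimes> x [^] m \<otimes> x)" using Suc rmult xy by simp
        ultimately show ?case
          using trans[of "x [^] m \<otimes> (x \<otimes> y)" "x [^] m \<otimes> (y \<otimes> x)" "y \<otimes> x [^] m \<otimes> x"] xy
          by (simp add: m_assoc)
      qed
      have "le ((x \<otimes> y) [^] n \<otimes> (x \<otimes> y)) (y [^] n \<otimes> x [^] n \<otimes> (x \<otimes> y))"
        using Suc rmult xy by simp
      moreover have "le (y [^] n \<otimes> (x [^] Suc n \<otimes> y)) (y [^] n \<otimes> (y \<otimes> x [^] Suc n))"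
        using sw'[of "Suc n"] lmult xy by simp
      ultimately have 2: "le ((x \<otimes> y) [^] Suc n) (y [^] Suc n \<otimes> x [^] Suc n)"
        using trans[of "(x \<otimes> y) [^] n \<otimes> (x \<otimes> y)" "y [^] n \<otimes> x [^] n \<otimes> (x \<otimes> y)" "y [^] n \<otimes> (y \<otimes> x [^] Suc n)"] xy
        by (simp add: m_assoc)
      show ?case using 1 2 by simp
    qed
  qed
  have additive_le: "\<tau> (x \<otimes> y) = \<tau> x + \<tau> y" if xy: "x \<in> K" "y \<in> K" and le: "le (x \<otimes> y) (y \<otimes> x)" for x y
  proof -
    have "\<tau> (x \<otimes> y) - \<tau> x - \<tau> y = 0"
    proof (rule bounded_multiples_zero[where c = 3])
      fix n :: nat
      have "f (x [^] n) + f (y [^] n) \<le> f ((x \<otimes> y) [^] n)"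
        "f ((x \<otimes> y) [^] n) \<le> f (x [^] n) + f (y [^] n) + 1"
        using commute[OF le xy, of n] f_mono[of "x [^] n \<otimes> y [^] n" "(x \<otimes> y) [^] n"]
          f_mono[of "(x \<otimes> y) [^] n" "y [^] n \<otimes> x [^] n"] f_lower[of "x [^] n" "y [^] n"]
          f_upper[of "y [^] n" "x [^] n"] xy by auto
      then have "real_of_int (f (x [^] n)) + real_of_int (f (y [^] n)) \<le> real_of_int (f ((x \<otimes> y) [^] n))"
        "real_of_int (f ((x \<otimes> y) [^] n)) \<le> real_of_int (f (x [^] n)) + real_of_int (f (y [^] n)) + 1"
        by linarith+
      then show "\<bar>real n * (\<tau> (x \<otimes> y) - \<tau> x - \<tau> y)\<bar> \<le> 3"
        using \<tau>[of x n] \<tau>[of y n] \<tau>[of "x \<otimes> y" n] xy unfolding right_diff_distrib by (simp add: abs_le_iff)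
    qed
    then show ?thesis by simp
  qed
  \<comment> \<open>The \<open>n\<close>-th powers of \<open>x \<otimes> y\<close> and \<open>y \<otimes> x\<close> are conjugate by \<open>x\<close>, so \<open>f\<close> differs on them by
    at most 1; this settles the case \<open>y \<otimes> x \<le> x \<otimes> y\<close> by symmetry.\<close>
  have cyclic: "\<tau> (x \<otimes> y) = \<tau> (y \<otimes> x)" if xy: "x \<in> K" "y \<in> K" for x y
  proof -
    have e: "x \<otimes> (y \<otimes> x) [^] n = (x \<otimes> y) [^] n \<otimes> x" for n :: nat
    proof (induction n)
      case (Suc n)
      have "x \<otimes> (y \<otimes> x) [^] Suc n = (x \<otimes> (y \<otimes> x) [^] n) \<otimes> (y \<otimes> x)"
        using xy by (simp add: m_assoc)
      also have "\<dots> = (x \<otimes> y) [^] Suc n \<otimes> x" unfolding Suc using xy by (simp add: m_assoc)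
      finally show ?case .
    qed (use xy in simp)
    have "\<tau> (x \<otimes> y) - \<tau> (y \<otimes> x) = 0"
    proof (rule bounded_multiples_zero[where c = 2])
      fix n :: nat
      have "f ((x \<otimes> y) [^] n) \<le> f ((y \<otimes> x) [^] n) + 1" "f ((y \<otimes> x) [^] n) \<le> f ((x \<otimes> y) [^] n) + 1"
        using f_lower[of "(x \<otimes> y) [^] n" x] f_upper[of x "(y \<otimes> x) [^] n"]
          f_upper[of "(x \<otimes> y) [^] n" x] f_lower[of x "(y \<otimes> x) [^] n"] e[of n] xy by auto
      then have "real_of_int (f ((x \<otimes> y) [^] n)) \<le> real_of_int (f ((y \<otimes> x) [^] n)) + 1"
        "real_of_int (f ((y \<otimes> x) [^] n)) \<le> real_of_int (f ((x \<otimes> y) [^] n)) + 1" by linarith+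
      then show "\<bar>real n * (\<tau> (x \<otimes> y) - \<tau> (y \<otimes> x))\<bar> \<le> 2"
        using \<tau>[of "x \<otimes> y" n] \<tau>[of "y \<otimes> x" n] xy unfolding right_diff_distrib by (simp add: abs_le_iff)
    qed
    then show ?thesis by simp
  qed
  have additive: "\<tau> (x \<otimes> y) = \<tau> x + \<tau> y" if "x \<in> K" "y \<in> K" for x y
    using additive_le[of x y] additive_le[of y x] cyclic[of x y] total[of "x \<otimes> y" "y \<otimes> x"] that by auto
  have nonneg: "0 \<le> \<tau> x" if "x \<in> W" for x
  proof -
    have xK: "x \<in> K" using that W_sub by blast
    have "le (h [^] (0::int)) x" using that xK by (simp add: le_def)
    then have "0 \<le> f x" using f_ge xK by simp
    moreover have "real_of_int (f (x [^] (1::nat))) \<le> real 1 * \<tau> x" using \<tau>(1)[OF xK, of 1] .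
    ultimately show ?thesis using xK by simp
  qed
  have "f (h [^] n) = int n" for n :: nat
  proof (rule antisym)
    show "int n \<le> f (h [^] n)" using f_ge[of "int n" "h [^] n"] refl by (simp add: int_pow_int)
    have "\<not> int n + 1 \<le> f (h [^] n)"
    proof
      assume "int n + 1 \<le> f (h [^] n)"
      then have "le (h [^] (int n + 1)) (h [^] n)"
        using trans[OF pow_mono f(1)[of "h [^] n"]] by simp
      then show False using not_le_Suc[of "int n"] by (simp add: int_pow_int)
    qed
    then show "f (h [^] n) \<le> int n" by simp
  qed
  then have "\<bar>real n * (\<tau> h - 1)\<bar> \<le> 1" for n :: nat
    using \<tau>(1)[of h n] \<tau>(2)[of h n] by (simp add: right_diff_distrib)
  then have "\<tau> h - 1 = 0" by (rule bounded_multiples_zero)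
  then show ?thesis using additive nonneg by (auto simp: real_hom_def)
qed

section \<open>Left-invariant orders on cosets\<close>

text \<open>\<open>S\<close> consists of the elements \<open>x\<close> with \<open>C < x C\<close> for a left-invariant total order on the cosets of \<open>C\<close>.
For a cone \<open>P\<close> with convex subgroup \<open>C\<close> it is \<open>P - C\<close>; what follows depends on this set only, hence
holds simultaneously for all cones that agree outside \<open>C\<close>.\<close>

locale relative_cone = subgroup_of +
  fixes C S
  assumes subgroup_C: "subgroup C G"
    and C_K: "x \<in> C \<Longrightarrow> x \<in> K" and S_K: "x \<in> S \<Longrightarrow> x \<in> K"
    and S_mult: "\<lbrakk>x \<in> S; y \<in> S\<rbrakk> \<Longrightarrow> x \<otimes> y \<in> S"
    and S_mult_C: "\<lbrakk>x \<in> S; c \<in> C\<rbrakk> \<Longrightarrow> x \<otimes> c \<in> S"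
    and C_mult_S: "\<lbrakk>x \<in> S; c \<in> C\<rbrakk> \<Longrightarrow> c \<otimes> x \<in> S"
    and S_total: "x \<in> K \<Longrightarrow> x \<in> S \<or> x \<in> C \<or> inv x \<in> S"
    and S_inv: "x \<in> S \<Longrightarrow> inv x \<notin> S"
    and S_C: "x \<in> S \<Longrightarrow> x \<notin> C"
begin

lemma C_mult: "\<lbrakk>x \<in> C; y \<in> C\<rbrakk> \<Longrightarrow> x \<otimes> y \<in> C"
  using subgroup_C subgroup.m_closed by metis
lemma C_one: "\<one> \<in> C"
  using subgroup_C subgroup.one_closed by metis
lemma C_inv: "x \<in> C \<Longrightarrow> inv x \<in> C"
  using subgroup_C subgroup.m_inv_closed by metis

definition W where "W = S \<union> C"

lemma W_K: "x \<in> W \<Longrightarrow> x \<in> K" using S_K C_K by (auto simp: W_def)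
lemma W_mult: "\<lbrakk>x \<in> W; y \<in> W\<rbrakk> \<Longrightarrow> x \<otimes> y \<in> W"
  unfolding W_def using S_mult S_mult_C C_mult_S C_mult by blast
lemma W_mult_S: "\<lbrakk>x \<in> W; y \<in> S\<rbrakk> \<Longrightarrow> x \<otimes> y \<in> S"
  unfolding W_def using S_mult C_mult_S by blast
lemma S_mult_W: "\<lbrakk>x \<in> S; y \<in> W\<rbrakk> \<Longrightarrow> x \<otimes> y \<in> S"
  unfolding W_def using S_mult S_mult_C by blast
lemma not_W: assumes "x \<in> K" "x \<notin> W" shows "inv x \<in> S"
  using S_total[OF assms(1)] assms(2) by (auto simp: W_def)
lemma S_W: "x \<in> S \<Longrightarrow> x \<in> W" by (simp add: W_def)
lemma C_W: "x \<in> C \<Longrightarrow> x \<in> W" by (simp add: W_def)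
lemma W_inv: assumes "x \<in> S" shows "inv x \<notin> W"
  using S_inv[OF assms] S_C[OF assms] C_inv[of "inv x"] S_K[OF assms] by (auto simp: W_def)

text \<open>An element \<open>g\<close> belongs to this subgroup if the action of \<open>K\<close> on the ordered set of cosets looks the
same from \<open>g C\<close> as it does from \<open>C\<close>.\<close>

definition stab where
  "stab = {g \<in> K. \<forall>s\<in>K. s \<in> S \<longleftrightarrow> inv g \<otimes> s \<otimes> g \<in> S}"

lemma stab_K: "g \<in> stab \<Longrightarrow> g \<in> K" by (simp add: stab_def)
lemma stab_iff: "\<lbrakk>g \<in> stab; s \<in> K\<rbrakk> \<Longrightarrow> inv g \<otimes> s \<otimes> g \<in> S \<longleftrightarrow> s \<in> S"
  by (simp add: stab_def)
lemma stab_conj: "\<lbrakk>g \<in> stab; s \<in> S\<rbrakk> \<Longrightarrow> inv g \<otimes> s \<otimes> g \<in> S"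
  using stab_iff S_K by blast
lemma stab_conj': assumes "g \<in> stab" "s \<in> S" shows "g \<otimes> s \<otimes> inv g \<in> S"
proof -
  have K: "g \<in> K" "s \<in> K" using assms stab_K S_K by auto
  have "inv g \<otimes> (g \<otimes> s \<otimes> inv g) \<otimes> g = s" using K by (simp add: group_word)
  then show ?thesis using stab_iff[OF assms(1), of "g \<otimes> s \<otimes> inv g"] K assms by simp
qed

lemma stab_mult: assumes "g \<in> stab" "h \<in> stab" shows "g \<otimes> h \<in> stab"
proof -
  have K: "g \<in> K" "h \<in> K" using assms stab_K by auto
  have "s \<in> S \<longleftrightarrow> inv (g \<otimes> h) \<otimes> s \<otimes> (g \<otimes> h) \<in> S" if "s \<in> K" for s
  proof -
    have "inv (g \<otimes> h) \<otimes> s \<otimes> (g \<otimes> h) = inv h \<otimes> (inv g \<otimes> s \<otimes> g) \<otimes> h"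
      using K that by (simp add: group_word)
    then show ?thesis using stab_iff assms K that by simp
  qed
  then show ?thesis using K by (simp add: stab_def)
qed

lemma stab_inv: assumes "g \<in> stab" shows "inv g \<in> stab"
proof -
  have K: "g \<in> K" using assms stab_K by auto
  have "s \<in> S \<longleftrightarrow> inv (inv g) \<otimes> s \<otimes> inv g \<in> S" if "s \<in> K" for s
  proof -
    have "inv g \<otimes> (inv (inv g) \<otimes> s \<otimes> inv g) \<otimes> g = s"
      using K that by (simp add: group_word)
    then show ?thesis using stab_iff[OF assms, of "inv (inv g) \<otimes> s \<otimes> inv g"] K that by simp
  qed
  then show ?thesis using K by (simp add: stab_def)
qed

text \<open>The signs of \<open>s\<close> and \<open>inv s\<close> are tied to each other, so one of the two implications only has to be
checked on \<open>C\<close>.\<close>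

lemma stabI:
  assumes g: "g \<in> K" and 1: "\<And>s. s \<in> S \<Longrightarrow> inv g \<otimes> s \<otimes> g \<in> S"
    and 2: "\<And>c. c \<in> C \<Longrightarrow> inv g \<otimes> c \<otimes> g \<notin> S"
  shows "g \<in> stab"
proof -
  have "s \<in> S" if s: "s \<in> K" "inv g \<otimes> s \<otimes> g \<in> S" for s
  proof (rule ccontr)
    assume "s \<notin> S"
    then consider "s \<in> C" | "inv s \<in> S" using S_total s by blast
    then show False
    proof cases
      case 1
      then show False using 2 s by blast
    next
      case 2
      have "inv (inv g \<otimes> s \<otimes> g) = inv g \<otimes> inv s \<otimes> g" using g s by (simp add: group_word)
      then show False using 1[OF 2] S_inv[OF s(2)] by simp
    qed
  qed
  then have "\<forall>s\<in>K. s \<in> S \<longleftrightarrow> inv g \<otimes> s \<otimes> g \<in> S" by (metis 1)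
  then show ?thesis using g by (simp add: stab_def)
qed

lemma C_stab: assumes "c \<in> C" shows "c \<in> stab"
proof (rule stabI)
  show "c \<in> K" using assms C_K by blast
  show "inv c \<otimes> s \<otimes> c \<in> S" if "s \<in> S" for s
    using S_mult_C[OF C_mult_S[OF that C_inv[OF assms]] assms] .
  show "inv c \<otimes> d \<otimes> c \<notin> S" if "d \<in> C" for d
    using S_C[of "inv c \<otimes> d \<otimes> c"] C_mult[OF C_mult[OF C_inv[OF assms] that] assms] by blast
qed

lemma pow_stab: assumes "h \<in> stab" shows "h [^] (n::nat) \<in> stab"
proof (induction n)
  case 0
  show ?case using C_stab[OF C_one] by simp
next
  case (Suc n)
  show ?case unfolding nat_pow_Suc using Suc assms by (rule stab_mult)
qed

lemma pow_W: assumes "h \<in> S" shows "h [^] (n::nat) \<in> W"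
proof (induction n)
  case 0
  show ?case using C_W[OF C_one] by simp
next
  case (Suc n)
  show ?case unfolding nat_pow_Suc using Suc assms S_W by (intro W_mult)
qed

lemma pow_S: assumes "h \<in> S" shows "h [^] Suc n \<in> S"
  unfolding nat_pow_Suc using pow_W assms by (intro W_mult_S)

text \<open>The elements that lie strictly between \<open>inv (h [^] n)\<close> and \<open>h [^] n\<close> for some \<open>n\<close>.\<close>

definition cyclic_hull where
  "cyclic_hull h = {x \<in> K. \<exists>n::nat. inv x \<otimes> h [^] n \<in> S \<and> h [^] n \<otimes> x \<in> S}"

lemma C_hull: assumes "h \<in> S" shows "C \<subseteq> cyclic_hull h"
proof
  fix c assume c: "c \<in> C"
  have "h [^] Suc 0 = h" using S_K[OF assms] by simp
  then show "c \<in> cyclic_hull h"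
    using C_mult_S[OF assms C_inv[OF c]] S_mult_C[OF assms c] C_K[OF c]
    unfolding cyclic_hull_def by (metis (mono_tags, lifting) mem_Collect_eq)
qed

text \<open>Bounds can be multiplied: from \<open>x < h [^] n\<close> and \<open>y < h [^] m\<close> one gets \<open>x \<otimes> y < h [^] (n + m)\<close> because
powers of \<open>h\<close> and elements of the hull leave the order on the cosets invariant under conjugation.\<close>

lemma hull_subgroup:
  assumes h: "h \<in> S" and hs: "h \<in> stab" and sub: "cyclic_hull h \<subseteq> stab"
  shows "subgroup (cyclic_hull h) G"
proof (rule subgroupI)
  have hK: "h \<in> K" using S_K h .
  show "cyclic_hull h \<subseteq> carrier G" by (auto simp: cyclic_hull_def)
  have "\<one> \<in> cyclic_hull h" using C_hull[OF h] C_one by blast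
  then show "cyclic_hull h \<noteq> {}" by blast
next
  have hK: "h \<in> K" using S_K h .
  fix x assume x: "x \<in> cyclic_hull h"
  then obtain n :: nat where xK: "x \<in> K" and n: "inv x \<otimes> h [^] n \<in> S" "h [^] n \<otimes> x \<in> S"
    by (auto simp: cyclic_hull_def)
  have "inv (h [^] n) \<otimes> (h [^] n \<otimes> x) \<otimes> h [^] n \<in> S" using stab_conj[OF pow_stab[OF hs] n(2)] .
  moreover have "inv (h [^] n) \<otimes> (h [^] n \<otimes> x) \<otimes> h [^] n = inv (inv x) \<otimes> h [^] n"
    using xK hK by (simp add: group_word)
  moreover have "h [^] n \<otimes> (inv x \<otimes> h [^] n) \<otimes> inv (h [^] n) \<in> S"
    using stab_conj'[OF pow_stab[OF hs] n(1)] .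
  moreover have "h [^] n \<otimes> (inv x \<otimes> h [^] n) \<otimes> inv (h [^] n) = h [^] n \<otimes> inv x"
    using xK hK by (simp add: group_word)
  ultimately show "inv x \<in> cyclic_hull h" using xK by (auto simp: cyclic_hull_def)
next
  have hK: "h \<in> K" using S_K h .
  fix x y assume xy: "x \<in> cyclic_hull h" "y \<in> cyclic_hull h"
  then obtain n m :: nat where K: "x \<in> K" "y \<in> K"
    and n: "inv x \<otimes> h [^] n \<in> S" "h [^] n \<otimes> x \<in> S"
    and m: "inv y \<otimes> h [^] m \<in> S" "h [^] m \<otimes> y \<in> S"
    by (auto simp: cyclic_hull_def)
  have "inv y \<otimes> h [^] m \<otimes> (inv (h [^] m) \<otimes> (inv x \<otimes> h [^] n) \<otimes> h [^] m) \<in> S"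
    using stab_conj[OF pow_stab[OF hs] n(1)] m(1) S_mult by blast
  moreover have "inv y \<otimes> h [^] m \<otimes> (inv (h [^] m) \<otimes> (inv x \<otimes> h [^] n) \<otimes> h [^] m) = inv (x \<otimes> y) \<otimes> h [^] (n + m)"
    using K hK by (simp add: group_word nat_pow_mult[symmetric])
  moreover have "h [^] m \<otimes> y \<otimes> (inv y \<otimes> (h [^] n \<otimes> x) \<otimes> y) \<in> S"
    using stab_conj[OF _ n(2)] sub xy(2) m(2) S_mult by blast
  moreover have "h [^] m \<otimes> y \<otimes> (inv y \<otimes> (h [^] n \<otimes> x) \<otimes> y) = h [^] (m + n) \<otimes> (x \<otimes> y)"
    using K hK by (simp add: group_word nat_pow_mult[symmetric])
  ultimately show "x \<otimes> y \<in> cyclic_hull h" using K by (auto simp: cyclic_hull_def add.commute)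
qed

lemma self_hull: assumes "h \<in> S" shows "h \<in> cyclic_hull h"
proof -
  have hK: "h \<in> K" using S_K assms .
  have "inv h \<otimes> h [^] Suc 1 = h" "h [^] Suc 1 \<otimes> h = h [^] Suc 2"
    using hK by (simp_all add: numeral_2_eq_2 group_word)
  then show ?thesis using pow_S[OF assms, of 2] assms hK
    unfolding cyclic_hull_def by (metis (mono_tags, lifting) mem_Collect_eq)
qed

lemma hull_convex:
  assumes h: "h \<in> S" and xy: "x \<in> W" "y \<in> W" "x \<otimes> y \<in> cyclic_hull h"
  shows "x \<in> cyclic_hull h"
proof -
  have K: "h \<in> K" "x \<in> K" "y \<in> K" using S_K W_K h xy by auto
  obtain n :: nat where n: "inv (x \<otimes> y) \<otimes> h [^] n \<in> S" using xy by (auto simp: cyclic_hull_def)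
  have "y \<otimes> (inv (x \<otimes> y) \<otimes> h [^] n) \<otimes> h \<in> S" using W_mult_S[OF xy(2) n] h S_mult by blast
  moreover have "y \<otimes> (inv (x \<otimes> y) \<otimes> h [^] n) \<otimes> h = inv x \<otimes> h [^] Suc n"
    using K by (simp add: group_word)
  moreover have "h [^] Suc n \<otimes> x \<in> S" using pow_S[OF h] xy(1) by (rule S_mult_W)
  ultimately show ?thesis using K
    unfolding cyclic_hull_def by (metis (mono_tags, lifting) mem_Collect_eq)
qed

text \<open>No convex subgroup lies strictly between \<open>C\<close> and \<open>K\<close>.\<close>

definition primitive where
  "primitive \<longleftrightarrow> (\<forall>D. subgroup D G \<longrightarrow> C \<subseteq> D \<longrightarrow> D \<subseteq> K \<longrightarrow>
     (\<forall>x\<in>W. \<forall>y\<in>W. x \<otimes> y \<in> D \<longrightarrow> x \<in> D) \<longrightarrow> D = C \<or> D = K)"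

lemma hull_eq_K:
  assumes "primitive" "h \<in> S" "h \<in> stab" "cyclic_hull h \<subseteq> stab"
  shows "cyclic_hull h = K"
proof -
  have "cyclic_hull h \<subseteq> K" by (auto simp: cyclic_hull_def)
  then have "cyclic_hull h = C \<or> cyclic_hull h = K"
    using assms(1)[unfolded primitive_def, rule_format, OF hull_subgroup[OF assms(2-4)] C_hull[OF assms(2)]]
      hull_convex[OF assms(2)] by blast
  then show ?thesis using self_hull[OF assms(2)] S_C[OF assms(2)] by blast
qed

text \<open>If the interval from \<open>C\<close> to \<open>h C\<close> is contained in the stabilizer, then so is each of its translates
by powers of \<open>h\<close>, hence the hull of \<open>h\<close>. The hull is then a convex subgroup larger than \<open>C\<close>, that is, \<open>K\<close>.\<close>

lemma stab_eq_K:
  assumes prim: "primitive" and h: "h \<in> S" "h \<in> stab"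
    and small: "\<And>g. \<lbrakk>g \<in> W; inv g \<otimes> h \<in> S\<rbrakk> \<Longrightarrow> g \<in> stab"
  shows "stab = K"
proof -
  have hK: "h \<in> K" using S_K h by blast
  have step: "u \<in> stab" if "u \<in> W" "inv u \<otimes> h [^] m \<in> S" for u and m :: nat
    using that
  proof (induction m arbitrary: u)
    case 0
    then have "inv u \<in> S" using W_K by simp
    then show ?case using W_inv[of "inv u"] 0 W_K by simp
  next
    case (Suc m)
    have uK: "u \<in> K" using Suc W_K by blast
    show ?case
    proof (cases "inv u \<otimes> h \<in> S")
      case True
      then show ?thesis using small Suc by blast
    next
      case False
      define v where "v = inv h \<otimes> u"
      have v: "u = h \<otimes> v" "v \<in> K" using uK hK by (simp_all add: v_def group_word)
      show ?thesis
      proof (cases "v \<in> W")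
        case True
        have "h [^] Suc m = h \<otimes> h [^] m" using hK by (simp only: nat_pow_Suc2 K_carrier)
        then have "inv v \<otimes> h [^] m = inv u \<otimes> h [^] Suc m"
          unfolding v_def using uK hK by (simp del: nat_pow_Suc add: group_word)
        then have "v \<in> stab" using Suc.IH[OF True] Suc.prems by simp
        then show ?thesis unfolding v(1) using h(2) by (intro stab_mult)
      next
        case False
        then have "inv v \<in> S" using not_W v by blast
        moreover have "inv v = inv u \<otimes> h" using uK hK by (simp add: v_def group_word)
        ultimately show ?thesis using \<open>inv u \<otimes> h \<notin> S\<close> by simp
      qed
    qed
  qed
  have "cyclic_hull h \<subseteq> stab"
  proof
    fix x assume "x \<in> cyclic_hull h"
    then obtain n :: nat where x: "x \<in> K" and n: "inv x \<otimes> h [^] n \<in> S" "h [^] n \<otimes> x \<in> S"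
      by (auto simp: cyclic_hull_def)
    have "inv (h [^] n \<otimes> x) \<otimes> h [^] (n + n) = inv x \<otimes> h [^] n"
      using x hK by (simp add: group_word nat_pow_mult[symmetric])
    then have "h [^] n \<otimes> x \<in> stab" using step[OF S_W[OF n(2)], of "n + n"] n(1) by simp
    then have "inv (h [^] n) \<otimes> (h [^] n \<otimes> x) \<in> stab"
      using stab_mult[OF stab_inv[OF pow_stab[OF h(2)]]] by blast
    then show "x \<in> stab" using x hK by (simp add: group_word)
  qed
  then have "cyclic_hull h = K" "cyclic_hull h \<subseteq> stab" using hull_eq_K prim h by auto
  then show ?thesis using stab_K by blast
qed

text \<open>If the whole group preserves the order on the cosets by conjugation, then this order is bi-invariant,
and it is archimedean because each hull is a convex subgroup larger than \<open>C\<close>.\<close>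

lemma stab_eq_K_hom:
  assumes prim: "primitive" and stab: "stab = K" and ne: "S \<noteq> {}"
  shows "\<exists>\<tau>. real_hom K \<tau> \<and>
    (\<forall>x\<in>S. \<tau> x > 0) \<and> (\<forall>x\<in>C. \<tau> x = 0)"
proof -
  have hull: "cyclic_hull s = K" if "s \<in> S" for s
    using hull_eq_K[OF prim that] S_K[OF that] stab by (auto simp: cyclic_hull_def)
  obtain h where h: "h \<in> S" using ne by blast
  have "\<exists>\<tau>. real_hom K \<tau> \<and> (\<forall>x\<in>W. 0 \<le> \<tau> x) \<and> \<tau> h = 1"
  proof (rule Hoelder_embedding)
    show "W \<subseteq> K" using W_K by blast
    show "x \<otimes> y \<in> W" if "x \<in> W" "y \<in> W" for x y using that by (rule W_mult)
    show "inv g \<otimes> x \<otimes> g \<in> W" if g: "g \<in> K" and x: "x \<in> W" for g x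
    proof (rule ccontr)
      assume "inv g \<otimes> x \<otimes> g \<notin> W"
      then have "inv (inv g \<otimes> x \<otimes> g) \<in> S" using not_W g W_K[OF x] by simp
      moreover have "inv (inv g \<otimes> x \<otimes> g) = inv g \<otimes> inv x \<otimes> g" using g W_K[OF x] by (simp add: group_word)
      ultimately have "inv x \<in> S" using stab_iff[of g "inv x"] g W_K[OF x] stab by simp
      then show False using W_inv[of "inv x"] x W_K[OF x] by simp
    qed
    show "x \<in> W \<or> inv x \<in> W" if "x \<in> K" for x using that not_W S_W by blast
    show "h \<in> W" "inv h \<notin> W" using h S_W W_inv by auto
    show "\<exists>n::nat. inv x \<otimes> h [^] n \<in> W" if "x \<in> K" for x
      using that hull[OF h] S_W unfolding cyclic_hull_def by blast
  qed
  then obtain \<tau> :: "'a \<Rightarrow> real" where add: "\<And>x y. \<lbrakk>x \<in> K; y \<in> K\<rbrakk> \<Longrightarrow> \<tau> (x \<otimes> y) = \<tau> x + \<tau> y"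
    and nonneg: "\<And>x. x \<in> W \<Longrightarrow> 0 \<le> \<tau> x" and h1: "\<tau> h = 1"
    unfolding real_hom_def by blast
  have one: "\<tau> \<one> = 0" using add[of \<one> \<one>] by simp
  have inv: "\<tau> (inv x) = - \<tau> x" if "x \<in> K" for x using add[of x "inv x"] that one by simp
  have pow: "\<tau> (x [^] n) = real n * \<tau> x" if "x \<in> K" for x and n :: nat
    by (induction n) (use that one add in \<open>simp_all add: algebra_simps\<close>)
  \<comment> \<open>Some power of \<open>s\<close> exceeds \<open>h\<close>, so \<open>\<tau> s\<close> is not 0.\<close>
  have "\<tau> s > 0" if s: "s \<in> S" for s
  proof -
    have K: "s \<in> K" "h \<in> K" using s h S_K by auto
    obtain n :: nat where "inv h \<otimes> s [^] n \<in> S" using hull[OF s] K by (auto simp: cyclic_hull_def)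
    then have "0 \<le> \<tau> (inv h \<otimes> s [^] n)" using nonneg S_W by blast
    then have "1 \<le> real n * \<tau> s" using K add inv pow h1 by simp
    then show ?thesis by (metis mult_nonneg_nonpos not_le of_nat_0_le_iff order.trans zero_less_one)
  qed
  moreover have "\<tau> c = 0" if "c \<in> C" for c
    using nonneg[OF C_W[OF that]] nonneg[OF C_W[OF C_inv[OF that]]] inv[OF C_K[OF that]] by simp
  ultimately show ?thesis using add unfolding real_hom_def by blast
qed

text \<open>The elements of \<open>E\<close> move the coset \<open>C\<close> up. Let \<open>m C\<close> be the lowest of the cosets \<open>e C\<close>. For
\<open>C \<le> g C < m C\<close> each \<open>e \<in> E\<close> satisfies \<open>g C < m C \<le> e C \<le> e g C\<close>, so \<open>E\<close> also moves \<open>g C\<close> up. If all such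
\<open>g\<close> are in the stabilizer, then either there is an element \<open>h\<close> of \<open>S\<close> strictly below \<open>m\<close> to which
\<open>stab_eq_K\<close> applies, or \<open>m C\<close> is the immediate successor of \<open>C\<close>. In the latter case \<open>m\<close> is
itself in the stabilizer: taking successors commutes with the action of \<open>K\<close>.\<close>

theorem interval_dichotomy:
  assumes prim: "primitive" and ne: "S \<noteq> {}"
  shows "(\<exists>\<tau>. real_hom K \<tau> \<and>
      (\<forall>x\<in>S. \<tau> x > 0) \<and> (\<forall>x\<in>C. \<tau> x = 0)) \<or>
    (\<forall>E. finite E \<longrightarrow> E \<subseteq> S \<longrightarrow> (\<exists>g\<in>K - stab. \<forall>e\<in>E. inv g \<otimes> e \<otimes> g \<in> S))"
proof (rule disjCI)
  assume "\<not> (\<forall>E. finite E \<longrightarrow> E \<subseteq> S \<longrightarrow> (\<exists>g\<in>K - stab. \<forall>e\<in>E. inv g \<otimes> e \<otimes> g \<in> S))"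
  then obtain E0 where E0: "finite E0" "E0 \<subseteq> S"
    "\<forall>g\<in>K. (\<forall>e\<in>E0. inv g \<otimes> e \<otimes> g \<in> S) \<longrightarrow> g \<in> stab" by (metis DiffI)
  obtain s0 where s0: "s0 \<in> S" using ne by blast
  define E where "E = insert s0 E0"
  have E: "finite E" "E \<subseteq> S" "E \<noteq> {}" using E0 s0 by (auto simp: E_def)
  have stabE: "g \<in> stab" if gW: "g \<in> W" and ge: "\<And>e. e \<in> E \<Longrightarrow> inv g \<otimes> e \<in> S" for g
  proof (rule E0(3)[rule_format])
    show "g \<in> K" using W_K[OF gW] .
    show "inv g \<otimes> e \<otimes> g \<in> S" if e: "e \<in> E0" for e
      using S_mult_W[OF ge gW] e by (simp add: E_def)
  qed
  have EK: "e \<in> K" if "e \<in> E" for e using that E S_K by blast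
  \<comment> \<open>a lowest coset \<open>m C\<close> among the finitely many \<open>e C\<close>\<close>
  have "\<exists>m\<in>E. \<forall>e\<in>E. inv m \<otimes> e \<in> W"
    using E(1) E(3) E(2)
  proof (induction rule: finite_ne_induct)
    case (singleton x)
    then show ?case using C_W[OF C_one] S_K by auto
  next
    case (insert x F)
    then obtain m where m: "m \<in> F" "\<And>e. e \<in> F \<Longrightarrow> inv m \<otimes> e \<in> W" by blast
    have K: "x \<in> K" "\<And>e. e \<in> F \<Longrightarrow> e \<in> K" using insert S_K by auto
    show ?case
    proof (cases "inv m \<otimes> x \<in> W")
      case True
      then show ?thesis using m by blast
    next
      case False
      then have "inv (inv m \<otimes> x) \<in> S" using not_W K m by simp
      moreover have "inv (inv m \<otimes> x) = inv x \<otimes> m" using K m by (simp add: group_word)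
      ultimately have xm: "inv x \<otimes> m \<in> W" using S_W by simp
      have "inv x \<otimes> e \<in> W" if "e \<in> F" for e
      proof -
        have "inv x \<otimes> m \<otimes> (inv m \<otimes> e) = inv x \<otimes> e" using K m that by (simp add: group_word)
        then show ?thesis using W_mult[OF xm m(2)[OF that]] by simp
      qed
      moreover have "inv x \<otimes> x \<in> W" using K C_W[OF C_one] by simp
      ultimately show ?thesis by blast
    qed
  qed
  then obtain m where m: "m \<in> E" "\<And>e. e \<in> E \<Longrightarrow> inv m \<otimes> e \<in> W" by blast
  have mS: "m \<in> S" and mK: "m \<in> K" using m E EK by auto
  have below: "g \<in> stab" if "g \<in> W" "inv g \<otimes> m \<in> S" for g
  proof (rule stabE[OF that(1)])
    fix e assume e: "e \<in> E"
    have "inv g \<otimes> m \<otimes> (inv m \<otimes> e) = inv g \<otimes> e"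
      using W_K[OF that(1)] EK[OF e] mK by (simp add: group_word)
    then show "inv g \<otimes> e \<in> S" using S_mult_W[OF that(2) m(2)[OF e]] by simp
  qed
  have "stab = K"
  proof (cases "\<exists>h\<in>S. inv h \<otimes> m \<in> S")
    case True
    then obtain h where h: "h \<in> S" "inv h \<otimes> m \<in> S" by blast
    show ?thesis
    proof (rule stab_eq_K[OF prim h(1)])
      show "h \<in> stab" using below[OF S_W[OF h(1)] h(2)] .
      fix g assume g: "g \<in> W" "inv g \<otimes> h \<in> S"
      have "inv g \<otimes> h \<otimes> (inv h \<otimes> m) = inv g \<otimes> m"
        using W_K[OF g(1)] mK S_K[OF h(1)] by (simp add: group_word)
      then show "g \<in> stab" using S_mult[OF g(2) h(2)] below[OF g(1)] by simp
    qed
  next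
    case False
    then have least: "inv s \<otimes> m \<notin> S" if "s \<in> S" for s using that by blast
    have ge: "inv m \<otimes> s \<in> W" if "s \<in> S" for s
    proof (rule ccontr)
      assume "inv m \<otimes> s \<notin> W"
      then have "inv (inv m \<otimes> s) \<in> S" using not_W mK S_K[OF that] by simp
      moreover have "inv (inv m \<otimes> s) = inv s \<otimes> m" using mK S_K[OF that] by (simp add: group_word)
      ultimately show False using least[OF that] by simp
    qed
    show ?thesis
    proof (rule stab_eq_K[OF prim mS])
      show "m \<in> stab"
      proof (rule stabI[OF mK])
        show "inv m \<otimes> s \<otimes> m \<in> S" if "s \<in> S" for s using ge[OF that] mS by (rule W_mult_S)
        fix c assume c: "c \<in> C"
        have "inv m \<otimes> (inv c \<otimes> m) \<in> W" using ge[OF C_mult_S[OF mS C_inv[OF c]]] .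
        moreover have "inv m \<otimes> (inv c \<otimes> m) = inv (inv m \<otimes> c \<otimes> m)"
          using mK C_K[OF c] by (simp add: group_word)
        ultimately show "inv m \<otimes> c \<otimes> m \<notin> S" using W_inv by metis
      qed
      fix g assume "g \<in> W" "inv g \<otimes> m \<in> S"
      then show "g \<in> stab" using least C_stab by (auto simp: W_def)
    qed
  qed
  then show "\<exists>\<tau>. real_hom K \<tau> \<and>
      (\<forall>x\<in>S. \<tau> x > 0) \<and> (\<forall>x\<in>C. \<tau> x = 0)"
    using stab_eq_K_hom[OF prim _ ne] by blast
qed

end

section \<open>The dichotomy for a jump of convex subgroups\<close>

context ordered_with_convex
begin

sublocale coset: relative_cone G K C "P - C"
proof (rule relative_cone.intro[OF subgroup_of_axioms relative_cone_axioms.intro])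
  show "subgroup C G" by (rule subgroup_C)
  show "x \<in> K" if "x \<in> C" for x using that by simp
  show "x \<in> K" if "x \<in> P - C" for x using that by simp
  show "x \<otimes> y \<in> P - C" if "x \<in> P - C" "y \<in> P - C" for x y using that by (rule S_mult)
  show "x \<otimes> c \<in> P - C" if "x \<in> P - C" "c \<in> C" for x c using that by (rule S_mult_C)
  show "c \<otimes> x \<in> P - C" if "x \<in> P - C" "c \<in> C" for x c using that by (rule C_mult_S)
  show "x \<in> P - C \<or> x \<in> C \<or> inv x \<in> P - C" if "x \<in> K" for x using that by (rule S_total)
  show "inv x \<notin> P - C" if "x \<in> P - C" for x using that by (rule S_inv)
  show "x \<notin> C" if "x \<in> P - C" for x using that by simp
qed

text \<open>If conjugation by \<open>g\<close> leads from \<open>Q\<close> to another cone that agrees with \<open>P\<close> outside \<open>C\<close>, then both \<open>C\<close>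
and its conjugate are maximal proper convex subgroups for the latter cone. Convex subgroups form a
chain, so the two coincide, and \<open>g\<close> preserves \<open>P - C\<close>.\<close>

lemma stab_if_shared_complement:
  assumes proper: "C \<noteq> K"
    and maximal: "\<And>D. \<lbrakk>convex_subgroup K P D; C \<subseteq> D\<rbrakk> \<Longrightarrow> D = C \<or> D = K"
    and Q: "ordered_subgroup G K Q" "P - C \<subseteq> Q"
    and g: "g \<in> K" and sub: "P - C \<subseteq> conj_by g Q"
  shows "g \<in> coset.stab"
proof -
  interpret Q: ordered_subgroup G K Q by fact
  have gc: "g \<in> carrier G" using g by simp
  have Q': "ordered_subgroup G K (conj_by g Q)" using Q.conj_cone_K[OF g] .
  interpret Q': ordered_subgroup G K "conj_by g Q" by (rule Q')
  have CQ: "convex_subgroup K Q C" using convex_agree[OF Q, of C] convex_C by simp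
  have CQ': "convex_subgroup K (conj_by g Q) C" using convex_agree[OF Q' sub, of C] convex_C by simp
  have DQ': "convex_subgroup K (conj_by g Q) (conj_by g C)" using Q.convex_conj[OF CQ g] .
  have Cc: "C \<subseteq> carrier G" and Kc: "K \<subseteq> carrier G" and Qc: "Q \<subseteq> carrier G" by auto
  have conjK: "conj_by (inv g) K \<subseteq> K" "conj_by g K \<subseteq> K" using g by (auto simp: conj_by_def)
  have eq: "conj_by g C = C"
  proof (cases "C \<subseteq> conj_by g C")
    case True
    then have "convex_subgroup K P (conj_by g C)" using convex_agree[OF Q' sub True] DQ' by simp
    then consider "conj_by g C = C" | "conj_by g C = K" using maximal True by blast
    then show ?thesis
    proof cases
      case 2
      have "K = conj_by (inv g) (conj_by g K)" using conj_by_inv[OF Kc gc] by simp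
      also have "\<dots> \<subseteq> conj_by (inv g) K" using conjK by (intro conj_by_mono)
      also have "\<dots> = C" using 2 conj_by_inv[OF Cc gc] by simp
      finally show ?thesis using proper C_sub by blast
    qed
  next
    case False
    then have sub2: "conj_by g C \<subseteq> C" using Q'.convex_comparable[OF CQ' DQ'] by blast
    define D where "D = conj_by (inv g) C"
    have CD: "C \<subseteq> D" using conj_by_mono[OF sub2, of "inv g"] conj_by_inv[OF Cc gc] by (simp add: D_def)
    have "convex_subgroup K (conj_by (inv g) (conj_by g Q)) D"
      unfolding D_def using Q'.convex_conj[OF CQ'] g by simp
    then have "convex_subgroup K Q D" using conj_by_inv[OF Qc gc] by simp
    then have "convex_subgroup K P D" using convex_agree[OF Q CD] by simp
    then consider "D = C" | "D = K" using maximal CD by blast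
    then show ?thesis
    proof cases
      case 1
      then show ?thesis using conj_by_inv(2)[OF Cc gc] by (simp add: D_def)
    next
      case 2
      then have "C = conj_by g K" using conj_by_inv(2)[OF Cc gc] by (simp add: D_def)
      moreover have "K = conj_by g (conj_by (inv g) K)" using conj_by_inv[OF Kc gc] by simp
      ultimately have "K \<subseteq> C" using conj_by_mono[OF conjK(1), of g] by simp
      then show ?thesis using proper C_sub by blast
    qed
  qed
  have "s \<in> P - C \<longleftrightarrow> inv g \<otimes> s \<otimes> g \<in> P - C" if s: "s \<in> K" for s
  proof -
    have sc: "s \<in> carrier G" using s by simp
    have "s \<in> C \<longleftrightarrow> inv g \<otimes> s \<otimes> g \<in> C" using mem_conj_by_iff[OF Cc gc sc] unfolding eq .
    moreover have "s \<in> conj_by g Q \<longleftrightarrow> inv g \<otimes> s \<otimes> g \<in> Q" by (rule mem_conj_by_iff[OF Qc gc sc])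
    ultimately have "s \<in> conj_by g Q - C \<longleftrightarrow> inv g \<otimes> s \<otimes> g \<in> Q - C" unfolding Diff_iff by metis
    then show ?thesis unfolding agree_outside[OF Q] agree_outside[OF Q' sub] .
  qed
  with g show ?thesis unfolding coset.stab_def by (intro CollectI conjI ballI)
qed

end

text \<open>The finite subsets of \<open>P - C\<close> describe the neighbourhoods of the set of cones that agree with \<open>P\<close>
outside \<open>C\<close>. Each member of this set has conjugates in every neighbourhood that are not in the set;
moreover the conjugating element can be chosen for all members at once.\<close>

definition (in group) conjugates_accumulate :: "'a set \<Rightarrow> 'a set \<Rightarrow> 'a set \<Rightarrow> bool" where
  "conjugates_accumulate K P C \<longleftrightarrow> (\<forall>E. finite E \<longrightarrow> E \<subseteq> P - C \<longrightarrow>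
     (\<exists>g\<in>K. \<forall>Q. ordered_subgroup G K Q \<longrightarrow> P - C \<subseteq> Q \<longrightarrow>
        E \<subseteq> conj_by g Q \<and> \<not> P - C \<subseteq> conj_by g Q))"

lemma (in group) conjugates_accumulateE:
  assumes "conjugates_accumulate K P C" "finite E" "E \<subseteq> P - C"
  obtains g where "g \<in> K" "\<And>Q. \<lbrakk>ordered_subgroup G K Q; P - C \<subseteq> Q\<rbrakk> \<Longrightarrow>
    E \<subseteq> conj_by g Q \<and> \<not> P - C \<subseteq> conj_by g Q"
  using assms unfolding conjugates_accumulate_def by meson

text \<open>Conjugates of cones come from moving the base point: \<open>x\<close> is positive for the conjugate by \<open>g\<close> if \<open>x\<close>
moves \<open>g\<close> up. So the second alternative speaks of base points \<open>g\<close> outside the stabilizer that the elements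
of \<open>E\<close> still move up.\<close>

theorem (in ordered_with_convex) jump_dichotomy:
  assumes proper: "C \<noteq> K"
    and maximal: "\<And>D. \<lbrakk>convex_subgroup K P D; C \<subseteq> D\<rbrakk> \<Longrightarrow> D = C \<or> D = K"
  obtains (Archimedean) \<tau> where "real_hom K \<tau>" "\<And>x. x \<in> P - C \<Longrightarrow> \<tau> x > 0" "\<And>x. x \<in> C \<Longrightarrow> \<tau> x = 0"
  | (accumulation) "conjugates_accumulate K P C"
proof -
  have "D = C \<or> D = K"
    if D: "subgroup D G" "C \<subseteq> D" "D \<subseteq> K" "\<forall>x\<in>coset.W. \<forall>y\<in>coset.W. x \<otimes> y \<in> D \<longrightarrow> x \<in> D" for D
  proof (rule maximal)
    have "P \<subseteq> coset.W" by (auto simp: coset.W_def)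
    then show "convex_subgroup K P D" using D unfolding convex_subgroup_def by blast
  qed (rule D)
  then have prim: "coset.primitive" unfolding coset.primitive_def by blast
  have ne: "P - C \<noteq> {}"
  proof -
    obtain x where "x \<in> K" "x \<notin> C" using proper C_sub by blast
    then show ?thesis using S_total[of x] by blast
  qed
  show thesis
  proof (cases "\<exists>\<tau>. real_hom K \<tau> \<and>
      (\<forall>x\<in>P - C. \<tau> x > 0) \<and> (\<forall>x\<in>C. \<tau> x = 0)")
    case True
    then show thesis using Archimedean by blast
  next
    case False
    show thesis
    proof (rule accumulation, unfold conjugates_accumulate_def, intro allI impI)
      fix E assume E: "finite E" "E \<subseteq> P - C"
      then obtain g where g: "g \<in> K" "g \<notin> coset.stab" "\<forall>e\<in>E. inv g \<otimes> e \<otimes> g \<in> P - C"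
        using coset.interval_dichotomy[OF prim ne] False by (metis DiffD1 DiffD2)
      have "E \<subseteq> conj_by g Q \<and> \<not> P - C \<subseteq> conj_by g Q"
        if Q: "ordered_subgroup G K Q" "P - C \<subseteq> Q" for Q
      proof
        have Qc: "Q \<subseteq> carrier G" using ordered_subgroup.pos_carrier[OF Q(1)] by blast
        show "E \<subseteq> conj_by g Q"
        proof
          fix e assume e: "e \<in> E"
          then have "e \<in> carrier G" using E by auto
          then show "e \<in> conj_by g Q" using mem_conj_by_iff[OF Qc, of g e] g e Q(2) by auto
        qed
        show "\<not> P - C \<subseteq> conj_by g Q"
          using stab_if_shared_complement[OF proper maximal Q g(1)] g(2) by blast
      qed
      then show "\<exists>g\<in>K. \<forall>Q. ordered_subgroup G K Q \<longrightarrow> P - C \<subseteq> Q \<longrightarrow>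
        E \<subseteq> conj_by g Q \<and> \<not> P - C \<subseteq> conj_by g Q" using g(1) by blast
    qed
  qed
qed

section \<open>Isolated cones\<close>

text \<open>This is isolation in the space of cones on \<open>K\<close>: requiring finitely many elements to be positive describes
a basic open set, since an element other than \<open>\<one>\<close> is not positive iff its inverse is.\<close>

definition (in group) isolated_cone :: "'a set \<Rightarrow> 'a set \<Rightarrow> bool" where
  "isolated_cone K P \<longleftrightarrow> (\<exists>F. finite F \<and> F \<subseteq> P \<and> (\<forall>Q. ordered_subgroup G K Q \<longrightarrow> F \<subseteq> Q \<longrightarrow> Q = P))"

context ordered_subgroup
begin

lemma isolated_if_finite:
  assumes "finite (cones K)"
  shows "isolated_cone K P"
proof -
  define F where "F = (\<lambda>Q. SOME x. x \<in> P - Q) ` (cones K - {P})"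
  have ne: "\<exists>x. x \<in> P - Q" if "Q \<in> cones K - {P}" for Q
    using cone_eqI[of Q] that by (auto simp: cones_def)
  have mem: "(SOME x. x \<in> P - Q) \<in> P - Q" if "Q \<in> cones K - {P}" for Q
    using someI_ex[OF ne[OF that]] .
  have "finite F" "F \<subseteq> P" using assms mem by (auto simp: F_def)
  moreover have "Q = P" if Q: "ordered_subgroup G K Q" and sub: "F \<subseteq> Q" for Q
  proof (rule ccontr)
    assume "Q \<noteq> P"
    then have "Q \<in> cones K - {P}" using Q by (simp add: cones_def)
    then show False using mem[of Q] sub by (auto simp: F_def)
  qed
  ultimately show ?thesis unfolding isolated_cone_def by blast
qed

lemma isolated_restrict:
  assumes C: "convex_subgroup K P C" and "isolated_cone K P"
  shows "isolated_cone C (P \<inter> C)"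
proof -
  interpret ordered_with_convex G K P C by unfold_locales (rule C)
  obtain F where F: "finite F" "F \<subseteq> P" "\<And>Q. \<lbrakk>ordered_subgroup G K Q; F \<subseteq> Q\<rbrakk> \<Longrightarrow> Q = P"
    using assms(2) unfolding isolated_cone_def by blast
  have "R = P \<inter> C" if R: "ordered_subgroup G C R" and sub: "F \<inter> C \<subseteq> R" for R
  proof -
    interpret R: ordered_subgroup G C R by (rule R)
    have "P - C \<union> R = P" using F(3)[OF replace_cone[OF R]] F(2) sub by blast
    then have "R \<subseteq> P \<inter> C" using R.pos_sub by blast
    then show ?thesis using R.cone_eqI[OF restrict_cone] by simp
  qed
  then show ?thesis unfolding isolated_cone_def using F(1,2) by (intro exI[of _ "F \<inter> C"]) auto
qed

text \<open>Let the finite set \<open>F\<close> determine \<open>P\<close>. If \<open>C \<subset> D\<close> are convex and have the same intersection with \<open>F\<close>, then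
reversing the signs on \<open>D - C\<close> gives another cone that contains \<open>F\<close>.\<close>

lemma finite_convex_subgroups:
  assumes "isolated_cone K P"
  shows "finite {C. convex_subgroup K P C}"
proof -
  obtain F where F: "finite F" "F \<subseteq> P" "\<And>Q. \<lbrakk>ordered_subgroup G K Q; F \<subseteq> Q\<rbrakk> \<Longrightarrow> Q = P"
    using assms unfolding isolated_cone_def by blast
  have *: "C = D" if C: "convex_subgroup K P C" and D: "convex_subgroup K P D" and CD: "C \<subseteq> D"
    and eq: "F \<inter> C = F \<inter> D" for C D
  proof (rule ccontr)
    assume ne: "C \<noteq> D"
    interpret D: ordered_with_convex G K P D by unfold_locales (rule D)
    interpret PD: ordered_subgroup G D "P \<inter> D" by (rule D.restrict_cone)
    have "convex_subgroup D (P \<inter> D) C" using C CD unfolding convex_subgroup_def by blast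
    then interpret C: ordered_with_convex G D "P \<inter> D" C by unfold_locales
    have "P - D \<union> (m_inv G ` (P \<inter> D - C) \<union> (P \<inter> D \<inter> C)) = P"
      using F(3)[OF D.replace_cone[OF C.flip_cone]] F(2) eq CD by blast
    moreover obtain x where "x \<in> D" "x \<notin> C" using ne CD by blast
    then obtain y where y: "y \<in> P \<inter> D - C" using C.S_total[of x] by blast
    ultimately have "inv y \<in> P" by blast
    then show False using y pos_inv by blast
  qed
  have "inj_on (\<lambda>C. F \<inter> C) {C. convex_subgroup K P C}"
  proof (rule inj_onI)
    fix C D assume "C \<in> {C. convex_subgroup K P C}" "D \<in> {C. convex_subgroup K P C}" "F \<inter> C = F \<inter> D"
    then show "C = D" using *[of C D] *[of D C] convex_comparable[of C D] by auto
  qed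
  moreover have "(\<lambda>C. F \<inter> C) ` {C. convex_subgroup K P C} \<subseteq> Pow F" by blast
  ultimately show ?thesis by (rule inj_on_finite) (simp add: F(1))
qed

lemma maximal_convex_subgroup:
  assumes "isolated_cone K P" "K \<noteq> {\<one>}"
  obtains C where "convex_subgroup K P C" "C \<noteq> K"
    "\<And>D. \<lbrakk>convex_subgroup K P D; C \<subseteq> D\<rbrakk> \<Longrightarrow> D = C \<or> D = K"
proof -
  define A where "A = {C. convex_subgroup K P C \<and> C \<noteq> K}"
  have "finite A" by (rule finite_subset[OF _ finite_convex_subgroups[OF assms(1)]]) (auto simp: A_def)
  moreover have "{\<one>} \<in> A" using convex_one assms(2) by (simp add: A_def)
  ultimately obtain C where C: "C \<in> A" "\<forall>D\<in>A. C \<subseteq> D \<longrightarrow> C = D"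
    using finite_has_maximal[of A] by (metis empty_iff)
  show thesis
  proof (rule that[of C])
    show "convex_subgroup K P C" "C \<noteq> K" using C(1) by (simp_all add: A_def)
    show "D = C \<or> D = K" if "convex_subgroup K P D" "C \<subseteq> D" for D
      using C(2)[rule_format, of D] that by (auto simp: A_def)
  qed
qed

end

section \<open>Homomorphisms to the reals and cocycle orders\<close>

context group
begin

lemma real_hom_one:
  assumes "subgroup K G" "real_hom K f" shows "f \<one> = 0"
  using assms(2) subgroup.one_closed[OF assms(1)] unfolding real_hom_def
  by (metis add_cancel_right_right l_one one_closed)

lemma real_hom_inv:
  assumes "subgroup K G" "real_hom K f" "x \<in> K" shows "f (inv x) = - f x"
proof -
  have "f (x \<otimes> inv x) = f x + f (inv x)"
    using assms subgroup.m_inv_closed[OF assms(1)] by (simp add: real_hom_def)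
  then show ?thesis using real_hom_one[OF assms(1,2)] subgroup.mem_carrier[OF assms(1,3)] by simp
qed

lemma subgroup_nat_pow: assumes "subgroup K G" "x \<in> K" shows "x [^] (n::nat) \<in> K"
proof (induction n)
  case 0
  show ?case using subgroup.one_closed[OF assms(1)] by simp
next
  case (Suc n)
  show ?case unfolding nat_pow_Suc using subgroup.m_closed[OF assms(1)] Suc assms(2) by blast
qed

lemma subgroup_int_pow: assumes "subgroup K G" "x \<in> K" shows "x [^] (n::int) \<in> K"
  using subgroup_nat_pow[OF assms] subgroup.m_inv_closed[OF assms(1)] subgroup.mem_carrier[OF assms]
  by (cases n rule: int_cases2) (simp_all add: int_pow_int int_pow_neg_int)

lemma real_hom_nat_pow:
  assumes "subgroup K G" "real_hom K f" "x \<in> K" shows "f (x [^] (n::nat)) = real n * f x"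
proof (induction n)
  case 0
  show ?case using real_hom_one[OF assms(1,2)] by simp
next
  case (Suc n)
  have "f (x [^] n \<otimes> x) = f (x [^] n) + f x"
    using assms subgroup_nat_pow[OF assms(1,3)] by (simp add: real_hom_def)
  then show ?case using Suc by (simp add: algebra_simps)
qed

lemma real_hom_int_pow:
  assumes "subgroup K G" "real_hom K f" "x \<in> K" shows "f (x [^] (n::int)) = of_int n * f x"
  using real_hom_nat_pow[OF assms] real_hom_inv[OF assms(1,2) subgroup_nat_pow[OF assms(1,3)]]
    subgroup.mem_carrier[OF assms(1,3)]
  by (cases n rule: int_cases2) (simp_all add: int_pow_int int_pow_neg_int)

text \<open>If \<open>(f a, g a)\<close> and \<open>(f b, g b)\<close> were linearly independent, the integral combinations of these two
vectors would come within bounded distance of each point of the plane, in particular of a point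
\<open>(M, - M)\<close> deep inside the quadrant of opposite signs.\<close>

lemma proportional_if_no_opposite_signs:
  assumes K: "subgroup K G" and f: "real_hom K f" and g: "real_hom K g"
    and no: "\<And>x. \<lbrakk>x \<in> K; f x > 0\<rbrakk> \<Longrightarrow> g x \<ge> 0"
    and ab: "a \<in> K" "b \<in> K"
  shows "f a * g b = g a * f b"
proof (rule ccontr)
  define d where "d = f a * g b - g a * f b"
  assume "\<not> ?thesis"
  then have d: "d \<noteq> 0" by (simp add: d_def)
  \<comment> \<open>\<open>\<sigma>\<close> and \<open>\<rho>\<close> are the real coordinates of \<open>(M, - M)\<close>, and \<open>M\<close> exceeds the error made by rounding them.\<close>
  define M where "M = \<bar>f a\<bar> + \<bar>f b\<bar> + \<bar>g a\<bar> + \<bar>g b\<bar> + 1"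
  define \<sigma> where "\<sigma> = M * (g b + f b) / d"
  define \<rho> where "\<rho> = - M * (f a + g a) / d"
  have "\<sigma> * f a + \<rho> * f b = M * (f a * g b - g a * f b) / d"
    by (simp add: \<sigma>_def \<rho>_def diff_divide_distrib add_divide_distrib algebra_simps)
  then have 1: "\<sigma> * f a + \<rho> * f b = M" using d by (simp add: d_def)
  have "\<sigma> * g a + \<rho> * g b = - M * (f a * g b - g a * f b) / d"
    by (simp add: \<sigma>_def \<rho>_def diff_divide_distrib add_divide_distrib algebra_simps)
  then have 2: "\<sigma> * g a + \<rho> * g b = - M" using d by (simp add: d_def)
  have near: "\<bar>of_int \<lfloor>r\<rfloor> * t - r * t\<bar> \<le> \<bar>t\<bar>" for r t :: real
  proof -
    have "\<bar>of_int \<lfloor>r\<rfloor> - r\<bar> * \<bar>t\<bar> \<le> 1 * \<bar>t\<bar>" by (intro mult_right_mono) linarith+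
    then show ?thesis by (simp add: left_diff_distrib[symmetric] abs_mult)
  qed
  define x where "x = a [^] \<lfloor>\<sigma>\<rfloor> \<otimes> b [^] \<lfloor>\<rho>\<rfloor>"
  have xK: "x \<in> K"
    using ab subgroup_int_pow[OF K] subgroup.m_closed[OF K] by (simp add: x_def)
  have val: "h x = of_int \<lfloor>\<sigma>\<rfloor> * h a + of_int \<lfloor>\<rho>\<rfloor> * h b" if "real_hom K h" for h
    using that ab subgroup_int_pow[OF K] real_hom_int_pow[OF K that] by (simp add: x_def real_hom_def)
  have "f x > 0" "g x < 0"
    unfolding val[OF f] val[OF g]
    using near[of \<sigma> "f a"] near[of \<rho> "f b"] near[of \<sigma> "g a"] near[of \<rho> "g b"] 1 2 unfolding M_def by linarith+
  then show False using no[OF xK] by simp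
qed

text \<open>Equivalently, \<open>x\<close> acts on the real line by the orientation-preserving affine map \<open>t \<mapsto> l x * t + c x\<close>.
For \<open>l = 1\<close> these are the homomorphisms to the additive group of the reals.\<close>

definition cocycle :: "'a set \<Rightarrow> ('a \<Rightarrow> real) \<Rightarrow> ('a \<Rightarrow> real) \<Rightarrow> bool" where
  "cocycle K l c \<longleftrightarrow> (\<forall>x\<in>K. l x > 0) \<and> (\<forall>x\<in>K. \<forall>y\<in>K. l (x \<otimes> y) = l x * l y \<and> c (x \<otimes> y) = c x + l x * c y)"

lemma real_hom_cocycle: "real_hom K f \<longleftrightarrow> cocycle K (\<lambda>_. 1) f"
  by (simp add: real_hom_def cocycle_def)

lemma cocycle_combine: "\<lbrakk>cocycle K l c; cocycle K l d\<rbrakk> \<Longrightarrow> cocycle K l (\<lambda>x. c x + \<epsilon> * d x)"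
  by (auto simp: cocycle_def algebra_simps)

lemma real_hom_combine: "\<lbrakk>real_hom K c; real_hom K d\<rbrakk> \<Longrightarrow> real_hom K (\<lambda>x. c x + \<epsilon> * d x)"
  by (auto simp: real_hom_def algebra_simps)

end

context ordered_subgroup
begin

text \<open>The order by the sign of \<open>c\<close>, with ties broken by \<open>P\<close>. The zeros of a cocycle form a subgroup, and
products of elements with positive values have positive values because the factors \<open>l x\<close> are positive.\<close>

definition cocycle_order where
  "cocycle_order c = {x \<in> K. c x > 0 \<or> (c x = (0::real) \<and> x \<in> P)}"

lemma cocycle_cone:
  assumes c: "cocycle K l c"
  shows "ordered_subgroup G K (cocycle_order c)"
proof (rule ordered_subgroupI)
  have l: "l x > 0" if "x \<in> K" for x using c that by (simp add: cocycle_def)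
  have m: "c (x \<otimes> y) = c x + l x * c y" if "x \<in> K" "y \<in> K" for x y
    using c that by (simp add: cocycle_def)
  have "l (\<one> \<otimes> \<one>) = l \<one> * l \<one>" using c K_one unfolding cocycle_def by blast
  then have "l \<one> = 1" using l[OF K_one] by simp
  then have c1: "c \<one> = 0" using m[of \<one> \<one>] by simp
  show "subgroup K G" by (rule subgroup_K)
  show "cocycle_order c \<subseteq> K" by (auto simp: cocycle_order_def)
  show "\<one> \<notin> cocycle_order c" using c1 pos_one by (simp add: cocycle_order_def)
  show "x \<otimes> y \<in> cocycle_order c" if "x \<in> cocycle_order c" "y \<in> cocycle_order c" for x y
  proof -
    have K: "x \<in> K" "y \<in> K" and xy: "c x > 0 \<or> (c x = 0 \<and> x \<in> P)" "c y > 0 \<or> (c y = 0 \<and> y \<in> P)"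
      using that by (auto simp: cocycle_order_def)
    have "c y > 0 \<Longrightarrow> l x * c y > 0" using l[OF K(1)] by simp
    then show ?thesis using xy m[OF K] K pos_mult[of x y] by (auto simp: cocycle_order_def)
  qed
  show "x \<in> cocycle_order c \<or> inv x \<in> cocycle_order c" if x: "x \<in> K" "x \<noteq> \<one>" for x
  proof -
    have "0 = c x + l x * c (inv x)" using m[of x "inv x"] x c1 by simp
    then have "c x = - (l x * c (inv x))" by simp
    then have "c x > 0 \<or> c (inv x) > 0 \<or> (c x = 0 \<and> c (inv x) = 0)"
      using l[OF x(1)] by (cases "c (inv x)" "0::real" rule: linorder_cases) (auto simp: mult_pos_neg)
    then show ?thesis using pos_total[OF x] x by (auto simp: cocycle_order_def)
  qed
qed

text \<open>For small \<open>\<epsilon>\<close> the order by the sign of \<open>c + \<epsilon> * d\<close> contains the finite set that determines \<open>P\<close>, and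
hence is \<open>P\<close>.\<close>

lemma perturbation:
  assumes iso: "isolated_cone K P" and c: "cocycle K l c" and d: "cocycle K l d"
    and nonneg: "\<And>x. x \<in> P \<Longrightarrow> c x \<ge> 0" "\<And>x. \<lbrakk>x \<in> P; c x = 0\<rbrakk> \<Longrightarrow> d x \<ge> 0"
  obtains \<epsilon> where "\<epsilon> > 0" "\<And>x. x \<in> P \<Longrightarrow> c x + \<epsilon> * d x \<ge> 0"
proof -
  obtain F where F: "finite F" "F \<subseteq> P" "\<And>Q. \<lbrakk>ordered_subgroup G K Q; F \<subseteq> Q\<rbrakk> \<Longrightarrow> Q = P"
    using iso unfolding isolated_cone_def by blast
  have "\<forall>\<^sub>F \<epsilon> in at_right 0. c x + \<epsilon> * d x \<ge> 0" if x: "x \<in> F" for x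
  proof (cases "c x = 0")
    case True
    have "\<forall>\<^sub>F \<epsilon> in at_right (0::real). \<epsilon> > 0" by (rule eventually_at_right_less)
    then show ?thesis
      by eventually_elim (use True nonneg x F(2) in auto)
  next
    case False
    then have pos: "c x > 0" using nonneg(1)[of x] x F(2) by (simp add: less_le subset_iff)
    have "((\<lambda>\<epsilon>. c x + \<epsilon> * d x) \<longlongrightarrow> c x + 0 * d x) (at_right 0)" by (intro tendsto_intros)
    then have "\<forall>\<^sub>F \<epsilon> in at_right 0. 0 < c x + \<epsilon> * d x" using pos by (intro order_tendstoD(1)) auto
    then show ?thesis by eventually_elim simp
  qed
  then have "\<forall>\<^sub>F \<epsilon> in at_right 0. \<forall>x\<in>F. c x + \<epsilon> * d x \<ge> 0"
    using F(1) by (simp add: eventually_ball_finite)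
  moreover have "\<forall>\<^sub>F \<epsilon> in at_right (0::real). \<epsilon> > 0" by (rule eventually_at_right_less)
  ultimately have "\<forall>\<^sub>F \<epsilon> in at_right 0. \<epsilon> > 0 \<and> (\<forall>x\<in>F. c x + \<epsilon> * d x \<ge> 0)"
    by eventually_elim simp
  then obtain \<epsilon> where \<epsilon>: "\<epsilon> > 0" "\<And>x. x \<in> F \<Longrightarrow> c x + \<epsilon> * d x \<ge> 0"
    using eventually_happens'[OF trivial_limit_at_right_real] by blast
  have "F \<subseteq> cocycle_order (\<lambda>x. c x + \<epsilon> * d x)"
  proof
    fix x assume x: "x \<in> F"
    then have "x \<in> P" "x \<in> K" using F(2) by auto
    then show "x \<in> cocycle_order (\<lambda>x. c x + \<epsilon> * d x)"
      using \<epsilon>(2)[OF x] unfolding cocycle_order_def by auto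
  qed
  then have "cocycle_order (\<lambda>x. c x + \<epsilon> * d x) = P"
    using F(3)[OF cocycle_cone[OF cocycle_combine[OF c d]]] by simp
  then have mem: "x \<in> cocycle_order (\<lambda>x. c x + \<epsilon> * d x)" if "x \<in> P" for x using that by simp
  have "c x + \<epsilon> * d x \<ge> 0" if "x \<in> P" for x
    using mem[OF that] unfolding cocycle_order_def by auto
  then show thesis using \<epsilon>(1) that by blast
qed

text \<open>There are infinitely many homomorphisms \<open>g + s * f\<close> with real \<open>s\<close>, so two of them define the same
cone. They never have opposite signs, hence are proportional to each other.\<close>

lemma homs_proportional_if_finite:
  assumes fin: "finite (cones K)" and f: "real_hom K f" and g: "real_hom K g" and ab: "a \<in> K" "b \<in> K"
  shows "f a * g b = g a * f b"
proof -
  define h where "h s = (\<lambda>x. g x + s * f x)" for s :: real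
  have hom: "real_hom K (h s)" for s unfolding h_def using g f by (rule real_hom_combine)
  have "cocycle_order (h s) \<in> cones K" for s
    using cocycle_cone[OF hom[unfolded real_hom_cocycle]] by (simp add: cones_def)
  then have "range (\<lambda>s. cocycle_order (h s)) \<subseteq> cones K" by (rule image_subsetI)
  then have "finite (range (\<lambda>s. cocycle_order (h s)))" using fin by (rule finite_subset)
  then have "\<not> inj (\<lambda>s. cocycle_order (h s))"
    using finite_imageD infinite_UNIV_char_0 by blast
  then obtain s t where st: "s \<noteq> t" "cocycle_order (h s) = cocycle_order (h t)"
    unfolding inj_def by blast
  have "h t x \<ge> 0" if "x \<in> K" "h s x > 0" for x
  proof -
    have "x \<in> cocycle_order (h s)" using that by (simp add: cocycle_order_def)
    then have "x \<in> cocycle_order (h t)" unfolding st(2) .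
    then show ?thesis by (auto simp: cocycle_order_def)
  qed
  then have "h s a * h t b = h t a * h s b"
    using proportional_if_no_opposite_signs[OF subgroup_K hom hom _ ab] by blast
  moreover have "h s a * h t b - h t a * h s b = (t - s) * (g a * f b - f a * g b)"
    by (simp add: h_def algebra_simps)
  ultimately have "(t - s) * (g a * f b - f a * g b) = 0" by simp
  then show ?thesis using st(1) by simp
qed

text \<open>Consider the topmost jump. When there are only finitely many cones, finitely many elements separate
those that agree with \<open>P\<close> outside the maximal convex subgroup from all others, and the accumulation alternative is impossible.\<close>

lemma monotone_hom_if_finite:
  assumes fin: "finite (cones K)" and ne: "K \<noteq> {\<one>}"
  obtains \<tau> where "real_hom K \<tau>" "\<And>x. x \<in> P \<Longrightarrow> \<tau> x \<ge> 0" "\<exists>x\<in>P. \<tau> x > 0"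
proof -
  obtain C where C: "convex_subgroup K P C" "C \<noteq> K"
    "\<And>D. \<lbrakk>convex_subgroup K P D; C \<subseteq> D\<rbrakk> \<Longrightarrow> D = C \<or> D = K"
    using maximal_convex_subgroup[OF isolated_if_finite[OF fin] ne] by blast
  interpret C: ordered_with_convex G K P C by unfold_locales (rule C(1))
  show thesis
  proof (rule C.jump_dichotomy[OF C(2,3)])
    fix \<tau> assume \<tau>: "real_hom K \<tau>" "\<And>x. x \<in> P - C \<Longrightarrow> \<tau> x > 0" "\<And>x. x \<in> C \<Longrightarrow> \<tau> x = 0"
    obtain x where "x \<in> K" "x \<notin> C" using C(2) C.C_sub by blast
    then obtain y where "y \<in> P - C" using C.S_total[of x] by blast
    then show thesis using that[of \<tau>] \<tau> by (metis DiffD1 DiffI less_eq_real_def)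
  next
    assume acc: "conjugates_accumulate K P C"
    define B where "B = {Q \<in> cones K. \<not> P - C \<subseteq> Q}"
    define E where "E = (\<lambda>Q. SOME x. x \<in> P - C - Q) ` B"
    have mem: "(SOME x. x \<in> P - C - Q) \<in> P - C - Q" if "Q \<in> B" for Q
      by (rule someI_ex) (use that in \<open>auto simp: B_def\<close>)
    have "finite E" "E \<subseteq> P - C" using fin mem by (auto simp: E_def B_def)
    with acc obtain g where "g \<in> K" "E \<subseteq> conj_by g P" "\<not> P - C \<subseteq> conj_by g P"
      using ordered_subgroup_axioms by (metis conjugates_accumulateE Diff_subset)
    then have "conj_by g P \<in> B" using conj_cone_K by (simp add: B_def cones_def)
    then show thesis using mem[of "conj_by g P"] \<open>E \<subseteq> conj_by g P\<close> by (auto simp: E_def)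
  qed
qed

end

section \<open>Archimedean jumps under an isolated cone\<close>

text \<open>\<open>L\<close> is linear over the rational numbers, over which \<open>1\<close> and \<open>r\<close> are linearly independent.\<close>

lemma additive_separating_irrational:
  fixes r :: real
  assumes "r \<notin> \<rat>"
  shows "\<exists>L::real \<Rightarrow> real. (\<forall>x y. L (x + y) = L x + L y) \<and> L 1 = 0 \<and> L r = 1"
proof -
  interpret Q: vector_space "\<lambda>(q::rat) (x::real). of_rat q * x"
    by unfold_locales (simp_all add: algebra_simps of_rat_add of_rat_mult)
  interpret Q2: vector_space_pair "\<lambda>(q::rat) (x::real). of_rat q * x" "\<lambda>(q::rat) (x::real). of_rat q * x"
    by unfold_locales
  have "r \<notin> Q.span {1}"
  proof
    assume "r \<in> Q.span {1}"
    then obtain q :: rat where "r = of_rat q * 1" unfolding Q.span_singleton by blast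
    then show False using assms by (simp add: Rats_def)
  qed
  then have "Q.independent {r, 1}"
    by (intro Q.independent_insertI) (simp_all add: Q.independent_empty Q.dependent_single)
  then obtain L where L: "Vector_Spaces.linear (\<lambda>(q::rat) (x::real). of_rat q * x) (\<lambda>(q::rat) (x::real). of_rat q * x) L"
    "\<forall>x\<in>{r, 1}. L x = (if x = 1 then 0 else 1)"
    using Q2.linear_independent_extend[of "{r, 1}" "\<lambda>x. if x = 1 then 0 else 1"] by blast
  have "r \<noteq> 1" using assms by auto
  then show ?thesis using L Vector_Spaces.linear.axioms module_hom.add[OF Vector_Spaces.linear.axioms(3)[OF L(1)]]
    by (intro exI[of _ L]) auto
qed

text \<open>A jump \<open>C < K\<close> of convex subgroups with archimedean quotient, at the top of an isolated cone.\<close>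

locale archimedean_jump = ordered_with_convex +
  fixes \<tau> :: "'a \<Rightarrow> real"
  assumes hom: "real_hom K \<tau>" and tau_pos: "x \<in> P - C \<Longrightarrow> \<tau> x > 0" and tau_C: "x \<in> C \<Longrightarrow> \<tau> x = 0"
    and isolated: "isolated_cone K P" and proper: "C \<noteq> K"
begin

lemma tau_mult: "\<lbrakk>x \<in> K; y \<in> K\<rbrakk> \<Longrightarrow> \<tau> (x \<otimes> y) = \<tau> x + \<tau> y"
  using hom by (simp add: real_hom_def)
lemma tau_inv: "x \<in> K \<Longrightarrow> \<tau> (inv x) = - \<tau> x"
  using real_hom_inv[OF subgroup_K hom] .
lemma tau_one: "\<tau> \<one> = 0"
  using real_hom_one[OF subgroup_K hom] .
lemma tau_pow: "x \<in> K \<Longrightarrow> \<tau> (x [^] (n::nat)) = real n * \<tau> x"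
  using real_hom_nat_pow[OF subgroup_K hom] .
lemma tau_int_pow: "x \<in> K \<Longrightarrow> \<tau> (x [^] (n::int)) = of_int n * \<tau> x"
  using real_hom_int_pow[OF subgroup_K hom] .

lemma C_iff: "x \<in> K \<Longrightarrow> x \<in> C \<longleftrightarrow> \<tau> x = 0"
  using S_total[of x] tau_pos[of x] tau_pos[of "inv x"] tau_inv[of x] tau_C[of x] by force

lemma C_I: "\<lbrakk>x \<in> K; \<tau> x = 0\<rbrakk> \<Longrightarrow> x \<in> C" using C_iff by blast

lemma P_tau: assumes "x \<in> P" shows "\<tau> x \<ge> 0"
  using tau_pos[of x] tau_C[of x] assms by (cases "x \<in> C") auto

lemma P_I: assumes "x \<in> K" "\<tau> x > 0" shows "x \<in> P"
proof (rule ccontr)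
  assume "x \<notin> P"
  moreover have "x \<noteq> \<one>" using assms tau_one by auto
  ultimately have "inv x \<in> P" using pos_total assms by blast
  then show False using P_tau[of "inv x"] tau_inv[of x] assms by simp
qed

lemma conj_C: "\<lbrakk>g \<in> K; n \<in> C\<rbrakk> \<Longrightarrow> g \<otimes> n \<otimes> inv g \<in> C"
  by (rule C_I) (simp_all add: tau_mult tau_inv tau_C)

lemma conj_C': "\<lbrakk>g \<in> K; n \<in> C\<rbrakk> \<Longrightarrow> inv g \<otimes> n \<otimes> g \<in> C"
  by (rule C_I) (simp_all add: tau_mult tau_inv tau_C)

lemma positive_element: obtains t where "t \<in> K" "\<tau> t > 0"
proof -
  obtain x where "x \<in> K" "x \<notin> C" using proper C_sub by blast
  then have "x \<in> P - C \<or> inv x \<in> P - C" using S_total[of x] by blast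
  then show thesis using tau_pos that by (metis DiffD1 pos_K)
qed

text \<open>Perturbing \<open>\<tau>\<close> by a small multiple of \<open>f\<close> does not change the cone, so the perturbed homomorphism is
proportional to \<open>\<tau>\<close>.\<close>

lemma hom_trivial_on_C:
  assumes f: "real_hom K f" and "\<And>x. x \<in> C \<Longrightarrow> f x = 0" and ab: "a \<in> K" "b \<in> K"
  shows "\<tau> a * f b = f a * \<tau> b"
proof -
  have nn: "f x \<ge> 0" if "x \<in> P" "\<tau> x = 0" for x
    using assms(2)[of x] C_I[of x] that by simp
  obtain \<epsilon> where \<epsilon>: "\<epsilon> > 0" "\<And>x. x \<in> P \<Longrightarrow> \<tau> x + \<epsilon> * f x \<ge> 0"
    using perturbation[OF isolated hom[unfolded real_hom_cocycle] f[unfolded real_hom_cocycle] P_tau nn] by blast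
  have "\<tau> a * (\<tau> b + \<epsilon> * f b) = (\<tau> a + \<epsilon> * f a) * \<tau> b"
    using proportional_if_no_opposite_signs[OF subgroup_K hom real_hom_combine[OF hom f] _ ab] \<epsilon>(2) P_I by blast
  then have "\<epsilon> * (\<tau> a * f b - f a * \<tau> b) = 0" by (simp add: algebra_simps)
  then show ?thesis using \<epsilon>(1) by simp
qed

text \<open>The quotient \<open>K / C\<close> has rank one: if two values of \<open>\<tau>\<close> had an irrational ratio, a \<open>\<rat>\<close>-linear function
composed with \<open>\<tau>\<close> would be a homomorphism that vanishes on \<open>C\<close> and is not proportional to \<open>\<tau>\<close>.\<close>

lemma commensurable:
  assumes a: "a \<in> K" and t: "t \<in> K" "\<tau> t \<noteq> 0"
  obtains k :: nat and m :: int where "k \<ge> 1" "real k * \<tau> a = of_int m * \<tau> t"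
proof -
  have "\<tau> a / \<tau> t \<in> \<rat>"
  proof (rule ccontr)
    assume "\<tau> a / \<tau> t \<notin> \<rat>"
    then obtain L :: "real \<Rightarrow> real" where L: "\<And>x y. L (x + y) = L x + L y" "L 1 = 0" "L (\<tau> a / \<tau> t) = 1"
      using additive_separating_irrational by metis
    define f where "f x = L (\<tau> x / \<tau> t)" for x
    have "real_hom K f" using tau_mult by (simp add: real_hom_def f_def add_divide_distrib L(1))
    moreover have "L 0 = 0" using L(1)[of 0 0] by simp
    then have "f x = 0" if "x \<in> C" for x using tau_C[OF that] by (simp add: f_def)
    ultimately have "\<tau> a * f t = f a * \<tau> t" using hom_trivial_on_C a t by blast
    then show False using t L by (simp add: f_def)
  qed
  then obtain m :: int and k :: nat where "k > 0" "\<tau> a / \<tau> t = of_int m / real k"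
    by (metis Rats_cases' of_nat_0_less_iff of_int_of_nat_eq zero_less_imp_eq_int)
  then show thesis using t by (intro that[of k m]) (simp_all add: field_simps)
qed

text \<open>An order that is given first by \<open>c\<close>, which sees \<open>K / C\<close>, and then by \<open>d\<close> on \<open>C\<close> can be perturbed to the
order of \<open>c + \<epsilon> * d\<close>. The perturbation is a different order: for \<open>t\<close> above \<open>C\<close> all elements
\<open>t \<otimes> inv (n [^] M)\<close> are positive, but \<open>d\<close> tends to minus infinity on them while \<open>c\<close> is constant.\<close>

lemma no_cocycle_extension:
  assumes c: "cocycle K l c" and d: "cocycle K l d" and lC: "\<And>x. x \<in> C \<Longrightarrow> l x = 1"
    and c_pos: "\<And>x. x \<in> P \<Longrightarrow> c x \<ge> 0" and c_zero: "\<And>x. x \<in> K \<Longrightarrow> c x = 0 \<longleftrightarrow> x \<in> C"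
    and d_pos: "\<And>x. x \<in> P \<inter> C \<Longrightarrow> d x \<ge> 0" and n: "n \<in> C" "d n > 0"
  shows False
proof -
  have d_zero: "d x \<ge> 0" if "x \<in> P" "c x = 0" for x using d_pos[of x] c_zero[of x] that by simp
  obtain \<epsilon> where \<epsilon>: "\<epsilon> > 0" "\<And>x. x \<in> P \<Longrightarrow> c x + \<epsilon> * d x \<ge> 0"
    using perturbation[OF isolated c d c_pos d_zero] by blast
  obtain t where t: "t \<in> K" "\<tau> t > 0" by (rule positive_element)
  have tS: "t \<in> P - C" using P_I[OF t] C_iff[OF t(1)] t(2) by simp
  have cm: "c (x \<otimes> y) = c x + l x * c y" "d (x \<otimes> y) = d x + l x * d y" if "x \<in> K" "y \<in> K" for x y
    using c d that by (simp_all add: cocycle_def)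
  have lt: "l t > 0" using c t by (simp add: cocycle_def)
  have dC: "real_hom C d" using cm(2) lC by (simp add: real_hom_def)
  obtain M :: nat where "(c t + \<epsilon> * d t) / (\<epsilon> * l t * d n) < real M" using reals_Archimedean2 by blast
  then have M: "c t + \<epsilon> * (d t + l t * (- real M * d n)) < 0"
    using \<epsilon>(1) lt n(2) by (simp add: field_simps)
  define u where "u = inv (n [^] M)"
  have u: "u \<in> C" using n(1) subgroup_nat_pow[OF subgroup_C] by (simp add: u_def)
  have du: "d u = - real M * d n"
    using real_hom_inv[OF subgroup_C dC subgroup_nat_pow[OF subgroup_C n(1)]] real_hom_nat_pow[OF subgroup_C dC n(1)]
    by (simp add: u_def)
  have "t \<otimes> u \<in> P" using S_mult_C[OF tS u] by simp
  then have "c (t \<otimes> u) + \<epsilon> * d (t \<otimes> u) \<ge> 0" by (rule \<epsilon>(2))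
  moreover have "c u = 0" using c_zero[of u] u by simp
  ultimately show False using M t u by (simp add: cm du)
qed

end

section \<open>The action on the bottom of an archimedean jump\<close>

text \<open>When \<open>C\<close> has finitely many cones, a nonzero homomorphism \<open>\<alpha>\<close> from \<open>C\<close> to the reals is unique up to
a factor. Conjugation by elements of \<open>K\<close> therefore multiplies \<open>\<alpha>\<close> by scalars. Their signs decide
whether the number of cones remains finite.\<close>

locale archimedean_jump_finite = archimedean_jump +
  fixes \<alpha> :: "'a \<Rightarrow> real" and n0
  assumes finite_C: "finite (cones C)"
    and alpha_hom: "real_hom C \<alpha>" and alpha_pos: "x \<in> P \<inter> C \<Longrightarrow> \<alpha> x \<ge> 0"
    and n0: "n0 \<in> C" "\<alpha> n0 > 0"
begin

lemma alpha_mult: "\<lbrakk>x \<in> C; y \<in> C\<rbrakk> \<Longrightarrow> \<alpha> (x \<otimes> y) = \<alpha> x + \<alpha> y"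
  using alpha_hom by (simp add: real_hom_def)
lemma alpha_inv: "x \<in> C \<Longrightarrow> \<alpha> (inv x) = - \<alpha> x"
  using real_hom_inv[OF subgroup_C alpha_hom] .
lemma alpha_one: "\<alpha> \<one> = 0"
  using real_hom_one[OF subgroup_C alpha_hom] .

definition dilation where "dilation g = \<alpha> (g \<otimes> n0 \<otimes> inv g) / \<alpha> n0"

lemma alpha_conj:
  assumes g: "g \<in> K" and n: "n \<in> C"
  shows "\<alpha> (g \<otimes> n \<otimes> inv g) = dilation g * \<alpha> n"
proof -
  have "real_hom C (\<lambda>n. \<alpha> (g \<otimes> n \<otimes> inv g))"
    unfolding real_hom_def
  proof (intro ballI)
    fix x y assume xy: "x \<in> C" "y \<in> C"
    have "g \<otimes> (x \<otimes> y) \<otimes> inv g = (g \<otimes> x \<otimes> inv g) \<otimes> (g \<otimes> y \<otimes> inv g)"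
      using xy g by (simp add: group_word)
    then show "\<alpha> (g \<otimes> (x \<otimes> y) \<otimes> inv g) = \<alpha> (g \<otimes> x \<otimes> inv g) + \<alpha> (g \<otimes> y \<otimes> inv g)"
      using alpha_mult[OF conj_C[OF g xy(1)] conj_C[OF g xy(2)]] by simp
  qed
  then have "\<alpha> n0 * \<alpha> (g \<otimes> n \<otimes> inv g) = \<alpha> (g \<otimes> n0 \<otimes> inv g) * \<alpha> n"
    using ordered_subgroup.homs_proportional_if_finite[OF restrict_cone finite_C alpha_hom _ n0(1) n] by blast
  then show ?thesis using n0(2) by (simp add: dilation_def field_simps)
qed

lemma dilation_mult: assumes "g \<in> K" "h \<in> K" shows "dilation (g \<otimes> h) = dilation g * dilation h"
proof -
  have e: "(g \<otimes> h) \<otimes> n0 \<otimes> inv (g \<otimes> h) = g \<otimes> (h \<otimes> n0 \<otimes> inv h) \<otimes> inv g"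
    using assms n0 by (simp add: group_word)
  have "dilation (g \<otimes> h) * \<alpha> n0 = \<alpha> (g \<otimes> (h \<otimes> n0 \<otimes> inv h) \<otimes> inv g)"
    using alpha_conj[OF K_mult[OF assms] n0(1)] unfolding e by (rule sym)
  also have "\<dots> = (dilation g * dilation h) * \<alpha> n0"
    unfolding alpha_conj[OF assms(1) conj_C[OF assms(2) n0(1)]] alpha_conj[OF assms(2) n0(1)] by (rule mult.assoc[symmetric])
  finally show ?thesis using n0(2) by simp
qed

lemma dilation_C: assumes "n \<in> C" shows "dilation n = 1"
proof -
  have "\<alpha> (n \<otimes> n0 \<otimes> inv n) = \<alpha> n0"
    using assms n0(1) alpha_mult[of "n \<otimes> n0" "inv n"] alpha_mult[of n n0] alpha_inv by simp
  then show ?thesis using n0(2) by (simp add: dilation_def)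
qed

lemma dilation_one: "dilation \<one> = 1" by (rule dilation_C) simp

lemma dilation_inv: "g \<in> K \<Longrightarrow> dilation g * dilation (inv g) = 1"
  using dilation_mult[of g "inv g"] dilation_one by simp

text \<open>If conjugation preserves \<open>\<alpha>\<close>, then \<open>\<alpha>\<close> can be extended to a homomorphism on \<open>K\<close>, which contradicts
isolation. First, \<open>\<alpha>\<close> vanishes on commutators: \<open>g \<mapsto> \<alpha> (comm g h)\<close> is a homomorphism that is trivial
on \<open>C\<close>, hence a multiple of \<open>\<tau>\<close>, and it vanishes at \<open>h\<close>; this settles all \<open>h\<close> outside \<open>C\<close>, and
for \<open>h \<in> C\<close> the invariance of \<open>\<alpha>\<close> suffices. Now fix \<open>t\<close> with \<open>\<tau> t > 0\<close>. On the subgroup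
\<open>B\<close> where \<open>\<tau> / \<tau> t\<close> is an integer, \<open>\<beta>\<close> extends \<open>\<alpha>\<close> by the value 0 at \<open>t\<close>. As \<open>K / C\<close> has rank one, each
element of \<open>K\<close> has a power in \<open>B\<close>, so dividing by the exponent extends \<open>\<beta>\<close> to \<open>\<gamma>\<close> on \<open>K\<close>. Additivity
of \<open>\<gamma>\<close> uses that \<open>K\<close> is commutative modulo the kernel of \<open>\<alpha>\<close>.\<close>

lemma no_trivial_dilation:
  assumes one: "\<And>g. g \<in> K \<Longrightarrow> dilation g = 1"
  shows False
proof -
  obtain t where t: "t \<in> K" "\<tau> t > 0" by (rule positive_element)
  have conj: "\<alpha> (g \<otimes> n \<otimes> inv g) = \<alpha> n" if "g \<in> K" "n \<in> C" for g n
    using alpha_conj[OF that] one[OF that(1)] by simp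
  define comm where "comm g h = g \<otimes> h \<otimes> inv g \<otimes> inv h" for g h
  have comm_C: "comm g h \<in> C" if "g \<in> K" "h \<in> K" for g h
    by (rule C_I) (use that in \<open>simp_all add: comm_def tau_mult tau_inv\<close>)
  have comm_right: "\<alpha> (comm g n) = 0" if "g \<in> K" "n \<in> C" for g n
    using conj[OF that] alpha_mult[OF conj_C[OF that] C_inv[OF that(2)]] alpha_inv[OF that(2)]
    by (simp add: comm_def)
  have comm_left: "\<alpha> (comm n g) = 0" if "g \<in> K" "n \<in> C" for g n
  proof -
    have "comm n g = n \<otimes> (g \<otimes> inv n \<otimes> inv g)" using that by (simp add: comm_def group_word)
    then show ?thesis
      using conj[OF that(1) C_inv[OF that(2)]] alpha_mult[OF that(2) conj_C[OF that(1) C_inv[OF that(2)]]]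
        alpha_inv[OF that(2)] by simp
  qed
  have comm_zero: "\<alpha> (comm g h) = 0" if g: "g \<in> K" and h: "h \<in> K" for g h
  proof (cases "h \<in> C")
    case True
    then show ?thesis using comm_right g by blast
  next
    case False
    have "real_hom K (\<lambda>g. \<alpha> (comm g h))"
      unfolding real_hom_def
    proof (intro ballI)
      fix x y assume xy: "x \<in> K" "y \<in> K"
      have "comm (x \<otimes> y) h = (x \<otimes> comm y h \<otimes> inv x) \<otimes> comm x h"
        using xy h by (simp add: comm_def group_word)
      then show "\<alpha> (comm (x \<otimes> y) h) = \<alpha> (comm x h) + \<alpha> (comm y h)"
        using alpha_mult[OF conj_C[OF xy(1) comm_C[OF xy(2) h]] comm_C[OF xy(1) h]]
          conj[OF xy(1) comm_C[OF xy(2) h]] by simp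
    qed
    then have "\<tau> g * \<alpha> (comm h h) = \<alpha> (comm g h) * \<tau> h"
      using hom_trivial_on_C[of "\<lambda>g. \<alpha> (comm g h)" g h] comm_left h g by blast
    moreover have "comm h h = \<one>" using h by (simp add: comm_def group_word)
    ultimately show ?thesis using C_iff[OF h] False alpha_one by simp
  qed
  define B where "B = {x \<in> K. \<exists>i::int. \<tau> x = of_int i * \<tau> t}"
  define \<beta> where "\<beta> x = \<alpha> (x \<otimes> t [^] (- \<lfloor>\<tau> x / \<tau> t\<rfloor>))" for x
  have B: "x \<in> K" if "x \<in> B" for x using that by (simp add: B_def)
  have idx: "\<tau> x = of_int \<lfloor>\<tau> x / \<tau> t\<rfloor> * \<tau> t" if "x \<in> B" for x
    using that t(2) by (auto simp: B_def)
  have sub_B: "subgroup B G"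
  proof (rule subgroupI)
    show "B \<subseteq> carrier G" using B by auto
    have "\<one> \<in> B" using tau_one by (auto simp: B_def intro!: exI[of _ 0])
    then show "B \<noteq> {}" by blast
    show "inv x \<in> B" if "x \<in> B" for x
      using idx[OF that] tau_inv[OF B[OF that]] B[OF that] unfolding B_def
      by (auto intro!: exI[of _ "- \<lfloor>\<tau> x / \<tau> t\<rfloor>"])
    show "x \<otimes> y \<in> B" if "x \<in> B" "y \<in> B" for x y
      using idx[OF that(1)] idx[OF that(2)] tau_mult[OF B[OF that(1)] B[OF that(2)]] B[OF that(1)] B[OF that(2)]
      unfolding B_def by (auto intro!: exI[of _ "\<lfloor>\<tau> x / \<tau> t\<rfloor> + \<lfloor>\<tau> y / \<tau> t\<rfloor>"] simp: algebra_simps)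
  qed
  have shift_C: "x \<otimes> t [^] (- \<lfloor>\<tau> x / \<tau> t\<rfloor>) \<in> C" if "x \<in> B" for x
    by (rule C_I) (use idx[OF that] B[OF that] t in \<open>simp_all add: tau_mult tau_int_pow\<close>)
  have beta_C: "\<beta> x = \<alpha> x" "x \<in> B" if "x \<in> C" for x
    using that tau_C[OF that] t by (auto simp: \<beta>_def B_def intro!: exI[of _ 0])
  have beta_hom: "real_hom B \<beta>"
    unfolding real_hom_def
  proof (intro ballI)
    fix x y assume xy: "x \<in> B" "y \<in> B"
    define i where "i = \<lfloor>\<tau> x / \<tau> t\<rfloor>"
    define j where "j = \<lfloor>\<tau> y / \<tau> t\<rfloor>"
    have K: "x \<in> K" "y \<in> K" using xy B by auto
    have "\<tau> (x \<otimes> y) / \<tau> t = of_int (i + j)"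
      using tau_mult[OF K] idx[OF xy(1)] idx[OF xy(2)] t by (simp add: i_def j_def field_simps)
    then have ij: "\<lfloor>\<tau> (x \<otimes> y) / \<tau> t\<rfloor> = i + j" by (metis floor_of_int)
    have "t [^] (- (i + j)) = t [^] (- j) \<otimes> t [^] (- i)"
      using t int_pow_mult[of t "- j" "- i"] by (simp add: add.commute)
    moreover have "t [^] (- i) = inv (t [^] i)" using t by (simp add: int_pow_neg)
    ultimately have "x \<otimes> y \<otimes> t [^] (- (i + j)) = (x \<otimes> t [^] (- i)) \<otimes> (t [^] i \<otimes> (y \<otimes> t [^] (- j)) \<otimes> inv (t [^] i))"
      using K t by (simp add: group_word)
    then have "\<beta> (x \<otimes> y) = \<alpha> ((x \<otimes> t [^] (- i)) \<otimes> (t [^] i \<otimes> (y \<otimes> t [^] (- j)) \<otimes> inv (t [^] i)))"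
      using ij by (simp add: \<beta>_def)
    also have "\<dots> = \<alpha> (x \<otimes> t [^] (- i)) + \<alpha> (t [^] i \<otimes> (y \<otimes> t [^] (- j)) \<otimes> inv (t [^] i))"
      using shift_C[OF xy(1)] shift_C[OF xy(2)] t by (intro alpha_mult conj_C) (simp_all add: i_def j_def)
    also have "\<alpha> (t [^] i \<otimes> (y \<otimes> t [^] (- j)) \<otimes> inv (t [^] i)) = \<alpha> (y \<otimes> t [^] (- j))"
      using shift_C[OF xy(2)] t by (intro conj) (simp_all add: j_def)
    finally show "\<beta> (x \<otimes> y) = \<beta> x + \<beta> y" by (simp add: \<beta>_def i_def j_def)
  qed
  have beta_pow: "\<beta> (x [^] n) = real n * \<beta> x" if "x \<in> B" for x and n :: nat
    using real_hom_nat_pow[OF sub_B beta_hom that] .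
  have power_B: "\<exists>k::nat. k \<ge> 1 \<and> x [^] k \<in> B" if x: "x \<in> K" for x
  proof -
    obtain k :: nat and m :: int where "k \<ge> 1" "real k * \<tau> x = of_int m * \<tau> t"
      using commensurable[OF x t(1)] t(2) by auto
    then show ?thesis using x by (auto simp: B_def tau_pow intro!: exI[of _ k])
  qed
  define \<gamma> where "\<gamma> x = (let k = (SOME k::nat. k \<ge> 1 \<and> x [^] k \<in> B) in \<beta> (x [^] k) / real k)" for x
  have gamma: "real k * \<gamma> x = \<beta> (x [^] k)" if x: "x \<in> K" "x [^] k \<in> B" for x and k :: nat
  proof -
    define j where "j = (SOME k::nat. k \<ge> 1 \<and> x [^] k \<in> B)"
    have j: "j \<ge> 1" "x [^] j \<in> B" using someI_ex[OF power_B[OF x(1)]] by (simp_all add: j_def)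
    have "real j * \<beta> (x [^] k) = \<beta> (x [^] (k * j))"
      using beta_pow[OF x(2), of j] x(1) by (simp add: nat_pow_pow)
    also have "\<dots> = real k * \<beta> (x [^] j)"
      using beta_pow[OF j(2), of k] x(1) by (simp add: nat_pow_pow mult.commute)
    finally have "real j * \<beta> (x [^] k) = real k * \<beta> (x [^] j)" .
    moreover have "\<gamma> x = \<beta> (x [^] j) / real j" unfolding \<gamma>_def Let_def j_def ..
    ultimately have "real j * (real k * \<gamma> x) = real j * \<beta> (x [^] k)" using j(1) by simp
    then show ?thesis using j(1) by simp
  qed
  \<comment> \<open>powers distribute over products up to an element of the kernel of \<open>\<alpha>\<close>\<close>
  have distrib: "\<exists>z\<in>C. \<alpha> z = 0 \<and> (x \<otimes> y) [^] k = z \<otimes> (x [^] k \<otimes> y [^] k)"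
    if xy: "x \<in> K" "y \<in> K" for x y and k :: nat
  proof (induction k)
    case 0
    show ?case using alpha_one by (intro bexI[of _ \<one>]) simp_all
  next
    case (Suc k)
    then obtain z where z: "z \<in> C" "\<alpha> z = 0" "(x \<otimes> y) [^] k = z \<otimes> (x [^] k \<otimes> y [^] k)" by blast
    define w where "w = x [^] k \<otimes> comm (y [^] k) x \<otimes> inv (x [^] k)"
    have w: "w \<in> C" "\<alpha> w = 0"
      using conj_C[OF K_pow[OF xy(1)] comm_C[OF K_pow[OF xy(2)] xy(1)]]
        conj[OF K_pow[OF xy(1)] comm_C[OF K_pow[OF xy(2)] xy(1)]] comm_zero[OF K_pow[OF xy(2)] xy(1)]
      by (simp_all add: w_def)
    have "(x \<otimes> y) [^] Suc k = z \<otimes> (x [^] k \<otimes> y [^] k) \<otimes> (x \<otimes> y)" using z by simp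
    also have "\<dots> = z \<otimes> w \<otimes> ((x [^] k \<otimes> x) \<otimes> (y [^] k \<otimes> y))"
      using xy z(1) by (simp add: w_def comm_def group_word)
    finally have "(x \<otimes> y) [^] Suc k = z \<otimes> w \<otimes> (x [^] Suc k \<otimes> y [^] Suc k)" by simp
    moreover have "z \<otimes> w \<in> C" "\<alpha> (z \<otimes> w) = 0" using z w alpha_mult by simp_all
    ultimately show ?case by blast
  qed
  have gamma_hom: "real_hom K \<gamma>"
    unfolding real_hom_def
  proof (intro ballI)
    fix x y assume xy: "x \<in> K" "y \<in> K"
    obtain i j :: nat where i: "i \<ge> 1" "x [^] i \<in> B" and j: "j \<ge> 1" "y [^] j \<in> B"
      using power_B xy by blast
    have xB: "x [^] (i * j) \<in> B" and yB: "y [^] (i * j) \<in> B"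
      using subgroup_nat_pow[OF sub_B i(2), of j] subgroup_nat_pow[OF sub_B j(2), of i] xy
      by (simp_all add: nat_pow_pow mult.commute)
    obtain z where z: "z \<in> C" "\<alpha> z = 0" "(x \<otimes> y) [^] (i * j) = z \<otimes> (x [^] (i * j) \<otimes> y [^] (i * j))"
      using distrib[OF xy] by blast
    have xyB: "x [^] (i * j) \<otimes> y [^] (i * j) \<in> B" using subgroup.m_closed[OF sub_B xB yB] .
    have "(x \<otimes> y) [^] (i * j) \<in> B"
      unfolding z(3) using subgroup.m_closed[OF sub_B beta_C(2)[OF z(1)] xyB] .
    then have "real (i * j) * \<gamma> (x \<otimes> y) = \<beta> (z \<otimes> (x [^] (i * j) \<otimes> y [^] (i * j)))"
      using gamma[of "x \<otimes> y" "i * j"] xy z(3) by simp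
    also have "\<dots> = \<beta> z + (\<beta> (x [^] (i * j)) + \<beta> (y [^] (i * j)))"
      using beta_hom beta_C(2)[OF z(1)] xyB xB yB by (simp add: real_hom_def)
    also have "\<dots> = real (i * j) * (\<gamma> x + \<gamma> y)"
      using gamma[OF xy(1) xB] gamma[OF xy(2) yB] beta_C(1)[OF z(1)] z(2) by (simp add: algebra_simps)
    finally show "\<gamma> (x \<otimes> y) = \<gamma> x + \<gamma> y" using i(1) j(1) by simp
  qed
  have gamma_C: "\<gamma> n = \<alpha> n" if "n \<in> C" for n
    using gamma[of n "Suc 0"] beta_C[OF that] that by simp
  show False
    by (rule no_cocycle_extension[OF hom[unfolded real_hom_cocycle] gamma_hom[unfolded real_hom_cocycle] _ P_tau _ _ n0(1)])
      (use C_iff gamma_C alpha_pos n0 in auto)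
qed

text \<open>By \<open>no_trivial_dilation\<close> some scalar differs from 1. The logarithm of the scalars is then a nonzero multiple
\<open>\<kappa> * \<tau>\<close> of \<open>\<tau>\<close>, so the coboundary
\<open>c g = (dilation g - 1) / \<kappa>\<close> has the sign of \<open>\<tau>\<close>. The homomorphism \<open>\<alpha>\<close> extends to a cocycle \<open>d\<close>: \<open>C\<close>
acts on the line by translations through \<open>\<alpha>\<close>, and there is a unique way to let \<open>K\<close> act by affine maps
with linear parts \<open>dilation g\<close> such that a chosen \<open>h\<close> with \<open>dilation h \<noteq> 1\<close> fixes 0. Comparing \<open>g \<otimes> h\<close>
with \<open>h \<otimes> g\<close> gives the formula for \<open>d\<close>.\<close>

lemma no_positive_dilation:
  assumes pos: "\<And>g. g \<in> K \<Longrightarrow> dilation g > 0"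
  shows False
proof (cases "\<forall>g\<in>K. dilation g = 1")
  case True
  then show False using no_trivial_dilation by blast
next
  case False
  then obtain h where h: "h \<in> K" "dilation h \<noteq> 1" by blast
  obtain t where t: "t \<in> K" "\<tau> t > 0" by (rule positive_element)
  define \<kappa> where "\<kappa> = ln (dilation t) / \<tau> t"
  have ln_hom: "real_hom K (\<lambda>g. ln (dilation g))"
    unfolding real_hom_def
  proof (intro ballI)
    fix x y assume "x \<in> K" "y \<in> K"
    then show "ln (dilation (x \<otimes> y)) = ln (dilation x) + ln (dilation y)"
      using pos[of x] pos[of y] dilation_mult[of x y] by (simp add: ln_mult_pos)
  qed
  have ln_C: "ln (dilation x) = 0" if "x \<in> C" for x using dilation_C[OF that] by simp
  have "\<tau> t * ln (dilation g) = ln (dilation t) * \<tau> g" if "g \<in> K" for g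
    using hom_trivial_on_C[OF ln_hom ln_C t(1) that] .
  then have ln_dilation: "ln (dilation g) = \<kappa> * \<tau> g" if "g \<in> K" for g
    using that t(2) by (simp add: \<kappa>_def field_simps)
  have dilation_exp: "dilation g = exp (\<kappa> * \<tau> g)" if "g \<in> K" for g
    using ln_dilation[OF that] pos[OF that] by (metis exp_ln)
  have \<kappa>: "\<kappa> \<noteq> 0" using dilation_exp[OF h(1)] h(2) by auto
  define c where "c g = (dilation g - 1) / \<kappa>" for g
  have c: "cocycle K dilation c"
    using pos dilation_mult by (simp add: cocycle_def c_def diff_divide_distrib algebra_simps)
  define d where "d g = \<alpha> (g \<otimes> h \<otimes> inv g \<otimes> inv h) / (1 - dilation h)" for g
  have comm_C: "g \<otimes> h \<otimes> inv g \<otimes> inv h \<in> C" if "g \<in> K" for g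
    by (rule C_I) (use that h in \<open>simp_all add: tau_mult tau_inv\<close>)
  have d: "cocycle K dilation d"
    unfolding cocycle_def
  proof (intro conjI ballI)
    fix x y assume xy: "x \<in> K" "y \<in> K"
    show "dilation (x \<otimes> y) = dilation x * dilation y" using dilation_mult xy .
    have "(x \<otimes> y) \<otimes> h \<otimes> inv (x \<otimes> y) \<otimes> inv h
        = (x \<otimes> (y \<otimes> h \<otimes> inv y \<otimes> inv h) \<otimes> inv x) \<otimes> (x \<otimes> h \<otimes> inv x \<otimes> inv h)"
      using xy h by (simp add: group_word)
    then show "d (x \<otimes> y) = d x + dilation x * d y"
      using alpha_mult[OF conj_C[OF xy(1) comm_C[OF xy(2)]] comm_C[OF xy(1)]]
        alpha_conj[OF xy(1) comm_C[OF xy(2)]] by (simp add: d_def add_divide_distrib)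
  qed (rule pos)
  have dC: "d n = \<alpha> n" if n: "n \<in> C" for n
  proof -
    have "n \<otimes> h \<otimes> inv n \<otimes> inv h = n \<otimes> (h \<otimes> inv n \<otimes> inv h)" using n h by (simp add: group_word)
    then have "\<alpha> (n \<otimes> h \<otimes> inv n \<otimes> inv h) = (1 - dilation h) * \<alpha> n"
      using alpha_mult[OF n conj_C[OF h(1) C_inv[OF n]]] alpha_conj[OF h(1) C_inv[OF n]] alpha_inv[OF n]
      by (simp add: algebra_simps)
    then show ?thesis using h(2) by (simp add: d_def)
  qed
  show False
  proof (rule no_cocycle_extension[OF c d _ _ _ _ n0(1)])
    show "dilation x = 1" if "x \<in> C" for x using dilation_C that .
    show "c x \<ge> 0" if "x \<in> P" for x
    proof -
      have "x \<in> K" "\<tau> x \<ge> 0" using that P_tau by auto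
      then show ?thesis
        using \<kappa> dilation_exp[of x] by (cases "\<kappa> > 0") (auto simp: c_def field_simps mult_nonpos_nonneg)
    qed
    show "c x = 0 \<longleftrightarrow> x \<in> C" if "x \<in> K" for x
      using that dilation_exp[OF that] \<kappa> C_iff[OF that] by (simp add: c_def)
    show "d x \<ge> 0" if "x \<in> P \<inter> C" for x using that dC alpha_pos by simp
    show "d n0 > 0" using dC n0 by simp
  qed
qed

end

section \<open>Finitely many cones\<close>

context archimedean_jump
begin

text \<open>As \<open>K / C\<close> has rank one, it carries only two orders, so a cone on \<open>K\<close> is determined by its restriction
to \<open>C\<close> and by the sign of one element \<open>t\<close> outside \<open>C\<close>.\<close>

lemma finite_if_convex_in_all_cones:
  assumes fin: "finite (cones C)"
    and conv: "\<And>Q. ordered_subgroup G K Q \<Longrightarrow> convex_subgroup K Q C"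
  shows "finite (cones K)"
proof -
  obtain t where t: "t \<in> K" "\<tau> t > 0" by (rule positive_element)
  have side: "x \<in> Q \<longleftrightarrow> t \<in> Q" if Q: "ordered_subgroup G K Q" and x: "x \<in> K" "\<tau> x > 0" for Q x
  proof -
    interpret Q: ordered_with_convex G K Q C
      using Q conv[OF Q] by (intro ordered_with_convex.intro ordered_with_convex_axioms.intro)
    have pow: "y [^] k \<in> Q \<longleftrightarrow> y \<in> Q" if y: "y \<in> K" "\<tau> y > 0" and k: "k \<ge> 1" for y and k :: nat
    proof -
      have *: "z [^] k \<in> Q" if "z \<in> Q" for z
        using k
      proof (induction k rule: dec_induct)
        case base
        show ?case using that by simp
      next
        case (step k)
        then show ?case using Q.pos_mult that by simp
      qed
      have "y \<noteq> \<one>" using y tau_one by auto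
      moreover have "inv (y [^] k) = inv y [^] k" using y by (simp add: nat_pow_inv)
      ultimately show ?thesis using * Q.pos_total[OF y(1)] Q.pos_inv[of "y [^] k"] by metis
    qed
    obtain k :: nat and m :: int where km: "k \<ge> 1" "real k * \<tau> x = of_int m * \<tau> t"
      using commensurable[OF x(1) t(1)] t(2) by auto
    have "of_int m * \<tau> t > 0" using km x by (metis mult_pos_pos of_nat_0_less_iff not_one_le_zero gr0I)
    then have "m > 0" using t by (simp add: zero_less_mult_iff)
    then obtain j :: nat where j: "m = int j" "j \<ge> 1" by (metis int_one_le_iff_zero_less of_nat_1 pos_int_cases of_nat_le_iff)
    define n where "n = x [^] k \<otimes> inv (t [^] j)"
    have n: "n \<in> C" by (rule C_I) (use x t km j in \<open>simp_all add: n_def tau_mult tau_inv tau_pow\<close>)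
    have e: "x [^] k = n \<otimes> t [^] j" "t [^] j = inv n \<otimes> x [^] k" using x t by (simp_all add: n_def group_word)
    have xC: "x [^] k \<notin> C" and tC: "t [^] j \<notin> C"
      using C_iff[OF K_pow[OF x(1)], of k] C_iff[OF K_pow[OF t(1)], of j] x t km(1) j(2)
      by (simp_all add: tau_pow)
    have "x [^] k \<in> Q \<longleftrightarrow> t [^] j \<in> Q"
      using Q.C_mult_S[of "t [^] j" n] Q.C_mult_S[of "x [^] k" "inv n"] n xC tC e C_inv[OF n] by (metis DiffD1 DiffI)
    then show ?thesis using pow[OF x km(1)] pow[OF t j(2)] by blast
  qed
  have eq: "Q \<subseteq> R"
    if Q: "ordered_subgroup G K Q" and R: "ordered_subgroup G K R" and eqC: "Q \<inter> C = R \<inter> C"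
      and eqt: "t \<in> Q \<longleftrightarrow> t \<in> R" for Q R
  proof
    fix x assume x: "x \<in> Q"
    interpret Q: ordered_subgroup G K Q by (rule Q)
    interpret R: ordered_subgroup G K R by (rule R)
    have xK: "x \<in> K" using x by simp
    consider "\<tau> x = 0" | "\<tau> x > 0" | "\<tau> (inv x) > 0" using tau_inv[OF xK] by linarith
    then show "x \<in> R"
    proof cases
      case 1
      then have "x \<in> C" using C_I xK by blast
      then show ?thesis using eqC x by blast
    next
      case 2
      then show ?thesis using side[OF Q xK 2] side[OF R xK 2] eqt x by blast
    next
      case 3
      have "inv x \<notin> Q" using Q.pos_inv x by blast
      then have "inv x \<notin> R" using side[OF Q K_inv[OF xK] 3] side[OF R K_inv[OF xK] 3] eqt by blast
      moreover have "x \<noteq> \<one>" using x Q.pos_one by auto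
      ultimately show ?thesis using R.pos_total[OF xK] by blast
    qed
  qed
  have "inj_on (\<lambda>Q. (Q \<inter> C, t \<in> Q)) (cones K)"
  proof (rule inj_onI)
    fix Q R assume "Q \<in> cones K" "R \<in> cones K" "(Q \<inter> C, t \<in> Q) = (R \<inter> C, t \<in> R)"
    then show "Q = R" using eq[of Q R] eq[of R Q] by (auto simp: cones_def)
  qed
  moreover have "(\<lambda>Q. (Q \<inter> C, t \<in> Q)) ` cones K \<subseteq> cones C \<times> UNIV"
  proof (rule image_subsetI)
    fix Q assume "Q \<in> cones K"
    then have Q: "ordered_subgroup G K Q" by (simp add: cones_def)
    interpret Q: ordered_with_convex G K Q C
      using Q conv[OF Q] by (intro ordered_with_convex.intro ordered_with_convex_axioms.intro)
    show "(Q \<inter> C, t \<in> Q) \<in> cones C \<times> UNIV" using Q.restrict_cone by (simp add: cones_def)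
  qed
  ultimately show ?thesis by (rule inj_on_finite) (simp add: fin)
qed

end

context archimedean_jump_finite
begin

text \<open>Let \<open>Q\<close> be any cone and \<open>\<beta>\<close> a homomorphism on \<open>C\<close> that is monotone for \<open>Q\<close>. If conjugation by \<open>u\<close>
reverses the sign of \<open>\<beta>\<close>, then \<open>\<one> < u < n\<close> is impossible for \<open>n \<in> C\<close>: enlarging \<open>n\<close> one may assume
\<open>\<beta> n > 0\<close>, and then \<open>inv u \<otimes> n \<otimes> u\<close> is a product of two positive elements although its value under \<open>\<beta>\<close> is
negative. The elements squeezed between elements of \<open>C\<close> form a subgroup \<open>B\<close>. If it were larger than
\<open>C\<close>, it would contain a power of \<open>u\<close> because \<open>K / C\<close> has rank one, and then \<open>u\<close> would be squeezed as well.\<close>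

lemma convex_if_negative:
  assumes t: "t \<in> K" "dilation t < 0" and Q: "ordered_subgroup G K Q"
  shows "convex_subgroup K Q C"
proof -
  interpret Q: ordered_subgroup G K Q by (rule Q)
  have QC: "ordered_subgroup G C (Q \<inter> C)"
    by (rule ordered_subgroupI) (use subgroup_C Q.pos_mult Q.pos_one Q.pos_total in auto)
  have ne: "C \<noteq> {\<one>}" using n0 alpha_one by auto
  obtain \<beta> where \<beta>: "real_hom C \<beta>" "\<And>x. x \<in> Q \<inter> C \<Longrightarrow> \<beta> x \<ge> 0" "\<exists>x\<in>Q \<inter> C. \<beta> x > 0"
    using ordered_subgroup.monotone_hom_if_finite[OF QC finite_C ne] by blast
  obtain n1 where n1: "n1 \<in> Q" "n1 \<in> C" "\<beta> n1 > 0" using \<beta>(3) by blast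
  have beta_conj: "\<beta> (g \<otimes> n \<otimes> inv g) = dilation g * \<beta> n" if g: "g \<in> K" and n: "n \<in> C" for g n
  proof -
    have *: "\<alpha> a * \<beta> n0 = \<beta> a * \<alpha> n0" if "a \<in> C" for a
      using ordered_subgroup.homs_proportional_if_finite[OF QC finite_C alpha_hom \<beta>(1) that n0(1)] .
    have "\<beta> (g \<otimes> n \<otimes> inv g) * \<alpha> n0 = (dilation g * \<alpha> n) * \<beta> n0"
      using *[OF conj_C[OF g n]] alpha_conj[OF g n] by simp
    also have "\<dots> = dilation g * \<beta> n * \<alpha> n0" using *[OF n] by simp
    finally show ?thesis using n0(2) by simp
  qed
  \<comment> \<open>An element that reverses the sign of \<open>\<beta>\<close> is not squeezed between elements of \<open>C\<close>.\<close>
  have key: False if u: "u \<in> Q" "dilation u < 0" and n: "n \<in> C" "inv u \<otimes> n \<in> Q" for u n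
  proof -
    have uK: "u \<in> K" using u by simp
    obtain j :: nat where "- \<beta> n / \<beta> n1 < real j" using reals_Archimedean2 by blast
    then have j: "\<beta> n + real j * \<beta> n1 > 0" using n1(3) by (simp add: field_simps)
    define p where "p = n1 [^] j"
    have p: "p \<in> C" "\<beta> p = real j * \<beta> n1"
      using real_hom_nat_pow[OF subgroup_C \<beta>(1) n1(2)] subgroup_nat_pow[OF subgroup_C n1(2)] by (simp_all add: p_def)
    have up: "inv u \<otimes> n \<otimes> n1 [^] i \<in> Q" for i :: nat
    proof (induction i)
      case 0
      show ?case using n(2) uK n(1) by simp
    next
      case (Suc i)
      have "inv u \<otimes> n \<otimes> n1 [^] i \<otimes> n1 \<in> Q" using Suc n1(1) by (rule Q.pos_mult)
      then show ?case using uK n(1) n1(2) by (simp add: m_assoc)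
    qed
    have "inv u \<otimes> n \<otimes> p \<otimes> u \<in> Q" using Q.pos_mult[OF up u(1)] unfolding p_def .
    moreover have "inv u \<otimes> n \<otimes> p \<otimes> u = inv u \<otimes> (n \<otimes> p) \<otimes> inv (inv u)"
      using uK n(1) p(1) by (simp add: m_assoc)
    ultimately have "\<beta> (inv u \<otimes> (n \<otimes> p) \<otimes> inv (inv u)) \<ge> 0"
      using \<beta>(2) conj_C[OF K_inv[OF uK] C_mult[OF n(1) p(1)]] by simp
    then have "dilation (inv u) * \<beta> (n \<otimes> p) \<ge> 0"
      using beta_conj[OF K_inv[OF uK] C_mult[OF n(1) p(1)]] by simp
    moreover have "\<beta> (n \<otimes> p) > 0" using \<beta>(1) n(1) p j by (simp add: real_hom_def)
    moreover have "dilation (inv u) < 0" using dilation_inv[OF uK] u(2)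
      by (metis mult_nonpos_nonneg not_le not_one_le_zero less_imp_le)
    ultimately show False by (simp add: zero_le_mult_iff)
  qed
  define B where "B = {z \<in> K. (\<exists>n\<in>C. inv z \<otimes> n \<in> Q) \<and> (\<exists>n\<in>C. n \<otimes> z \<in> Q)}"
  have BK: "z \<in> K" if "z \<in> B" for z using that by (simp add: B_def)
  have B_inv: "inv z \<in> B" if z: "z \<in> B" for z
  proof -
    obtain n m where nm: "n \<in> C" "inv z \<otimes> n \<in> Q" "m \<in> C" "m \<otimes> z \<in> Q" using z by (auto simp: B_def)
    have "inv (inv z) \<otimes> (inv z \<otimes> m \<otimes> z) = m \<otimes> z" "(inv z \<otimes> n \<otimes> z) \<otimes> inv z = inv z \<otimes> n"
      using BK[OF z] nm by (simp_all add: group_word)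
    then show ?thesis
      using nm BK[OF z] conj_C'[OF BK[OF z] nm(1)] conj_C'[OF BK[OF z] nm(3)]
      unfolding B_def by (metis (no_types, lifting) K_inv mem_Collect_eq)
  qed
  have B_mult: "z \<otimes> w \<in> B" if z: "z \<in> B" and w: "w \<in> B" for z w
  proof -
    obtain n m where nm: "n \<in> C" "inv z \<otimes> n \<in> Q" "m \<in> C" "m \<otimes> z \<in> Q" using z by (auto simp: B_def)
    obtain n' m' where nm': "n' \<in> C" "inv w \<otimes> n' \<in> Q" "m' \<in> C" "m' \<otimes> w \<in> Q" using w by (auto simp: B_def)
    have K: "z \<in> K" "w \<in> K" using z w BK by auto
    have "inv (z \<otimes> w) \<otimes> ((z \<otimes> n' \<otimes> inv z) \<otimes> n) = (inv w \<otimes> n') \<otimes> (inv z \<otimes> n)"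
      using K nm(1) nm'(1) by (simp add: group_word)
    then have 1: "\<exists>n\<in>C. inv (z \<otimes> w) \<otimes> n \<in> Q"
      using Q.pos_mult[OF nm'(2) nm(2)] C_mult[OF conj_C[OF K(1) nm'(1)] nm(1)] by metis
    have "(m \<otimes> (z \<otimes> m' \<otimes> inv z)) \<otimes> (z \<otimes> w) = (m \<otimes> z) \<otimes> (m' \<otimes> w)"
      using K nm(3) nm'(3) by (simp add: group_word)
    then have 2: "\<exists>n\<in>C. n \<otimes> (z \<otimes> w) \<in> Q"
      using Q.pos_mult[OF nm(4) nm'(4)] C_mult[OF nm(3) conj_C[OF K(1) nm'(3)]] by metis
    show ?thesis using 1 2 K by (simp add: B_def)
  qed
  have B_C: "n \<in> B" if "n \<in> C" for n
  proof -
    have "inv n \<otimes> (n \<otimes> n1) = n1" "(n1 \<otimes> inv n) \<otimes> n = n1" using that n1(2) by (simp_all add: group_word)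
    then show ?thesis
      using C_mult[OF that n1(2)] C_mult[OF n1(2) C_inv[OF that]] n1(1) that unfolding B_def
      by (metis (no_types, lifting) C_K mem_Collect_eq)
  qed
  have B_pow: "z [^] (k::nat) \<in> B" if "z \<in> B" for z k
  proof (induction k)
    case 0
    show ?case using B_C[OF C_one] by simp
  next
    case (Suc k)
    show ?case unfolding nat_pow_Suc using Suc that by (rule B_mult)
  qed
  show ?thesis
    unfolding convex_subgroup_def
  proof (intro conjI ballI impI)
    show "subgroup C G" "C \<subseteq> K" by (rule subgroup_C C_sub)+
    fix x y assume xy: "x \<in> Q" "y \<in> Q" "x \<otimes> y \<in> C"
    show "x \<in> C"
    proof (rule ccontr)
      assume xC: "x \<notin> C"
      have K: "x \<in> K" "y \<in> K" using xy by auto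
      have "inv x \<otimes> (x \<otimes> y) = y" "\<one> \<otimes> x = x" using K by (simp_all add: group_word)
      then have xB: "x \<in> B" using xy K unfolding B_def by (metis (no_types, lifting) C_one mem_Collect_eq)
      \<comment> \<open>replace \<open>t\<close> by its inverse if necessary\<close>
      obtain u where u: "u \<in> Q" "dilation u < 0"
      proof -
        have "dilation (inv t) < 0" using dilation_inv[OF t(1)] t(2)
          by (metis mult_nonpos_nonneg not_le not_one_le_zero less_imp_le)
        moreover have "t \<noteq> \<one>" using t dilation_one by auto
        ultimately show thesis using that t Q.pos_total by blast
      qed
      have uK: "u \<in> K" using u by simp
      have "\<tau> u \<noteq> 0" using C_I[OF uK] dilation_C[of u] u(2) by auto
      then obtain k :: nat and m :: int where km: "k \<ge> 1" "real k * \<tau> x = of_int m * \<tau> u"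
        using commensurable[OF K(1) uK] by blast
      have "\<tau> x \<noteq> 0" using xC C_I[OF K(1)] by blast
      then have "m \<noteq> 0" using km by auto
      have pow_in: "u [^] j \<in> B \<Longrightarrow> j = 0" for j :: nat
      proof (rule ccontr)
        assume uB: "u [^] j \<in> B" and "j \<noteq> 0"
        then obtain i where i: "j = Suc i" using not0_implies_Suc by blast
        obtain n where n: "n \<in> C" "inv (u [^] j) \<otimes> n \<in> Q" using uB by (auto simp: B_def)
        have "u [^] l \<otimes> (inv (u [^] j) \<otimes> n) \<in> Q" for l :: nat
        proof (induction l)
          case 0
          show ?case using n uK by simp
        next
          case (Suc l)
          have "u [^] Suc l \<otimes> (inv (u [^] j) \<otimes> n) = u \<otimes> (u [^] l \<otimes> (inv (u [^] j) \<otimes> n))"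
            unfolding nat_pow_Suc2[OF K_carrier[OF uK]] using uK n(1) by (simp add: m_assoc)
          then show ?case using Q.pos_mult[OF u(1) Suc] by simp
        qed
        then have "u [^] i \<otimes> (inv (u [^] j) \<otimes> n) \<in> Q" .
        moreover have "u [^] i \<otimes> (inv (u [^] j) \<otimes> n) = inv u \<otimes> n"
          unfolding i nat_pow_Suc2[OF K_carrier[OF uK]] using uK n(1) by (simp add: group_word)
        ultimately show False using key[OF u n(1)] by simp
      qed
      define n where "n = inv (x [^] k) \<otimes> u [^] m"
      have nC: "n \<in> C" by (rule C_I) (use K uK km in \<open>simp_all add: n_def tau_mult tau_inv tau_pow tau_int_pow\<close>)
      have "u [^] m = x [^] k \<otimes> n" using K uK by (simp add: n_def group_word)
      then have um: "u [^] m \<in> B" using B_mult[OF B_pow[OF xB] B_C[OF nC]] by simp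
      have "u [^] nat \<bar>m\<bar> \<in> B"
      proof (cases "m \<ge> 0")
        case True
        then show ?thesis using um by (metis abs_of_nonneg int_pow_int zero_le_imp_eq_int nat_int)
      next
        case False
        then have "u [^] m = inv (u [^] nat \<bar>m\<bar>)"
          using int_pow_neg_int[OF K_carrier[OF uK], of "nat \<bar>m\<bar>"] by simp
        then show ?thesis using B_inv[OF um] uK by simp
      qed
      then show False using pow_in[of "nat \<bar>m\<bar>"] \<open>m \<noteq> 0\<close> by simp
    qed
  qed
qed

end

text \<open>The inductive step of Tararin's description of the groups with finitely many orders. If \<open>C\<close> is
nontrivial, isolation rules out that all dilations are positive, and an element with a negative one makes
\<open>C\<close> convex in each cone.\<close>

theorem (in archimedean_jump) finite_cones_extension:
  assumes fin: "finite (cones C)"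
  shows "finite (cones K)"
proof (cases "C = {\<one>}")
  case True
  show ?thesis
  proof (rule finite_if_convex_in_all_cones[OF fin])
    show "convex_subgroup K Q C" if "ordered_subgroup G K Q" for Q
      unfolding True using ordered_subgroup.convex_one[OF that] .
  qed
next
  case False
  obtain \<alpha> where \<alpha>: "real_hom C \<alpha>" "\<And>x. x \<in> P \<inter> C \<Longrightarrow> \<alpha> x \<ge> 0" "\<exists>x\<in>P \<inter> C. \<alpha> x > 0"
    using ordered_subgroup.monotone_hom_if_finite[OF restrict_cone fin False] by blast
  obtain n0 where n0: "n0 \<in> C" "\<alpha> n0 > 0" using \<alpha>(3) by blast
  interpret archimedean_jump_finite G K P C \<tau> \<alpha> n0
    by unfold_locales (use fin \<alpha> n0 in auto)
  obtain g where g: "g \<in> K" "\<not> dilation g > 0" using no_positive_dilation by blast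
  have "dilation g \<noteq> 0" using dilation_inv[OF g(1)] by auto
  then have "dilation g < 0" using g(2) by simp
  then show ?thesis
    using finite_if_convex_in_all_cones[OF fin] convex_if_negative[OF g(1)] by blast
qed

section \<open>Baire category and smoothness\<close>

definition meager_in :: "'x topology \<Rightarrow> 'x set \<Rightarrow> bool" where
  "meager_in X M \<longleftrightarrow> (\<exists>\<N>. countable \<N> \<and> (\<forall>N\<in>\<N>. closedin X N \<and> X interior_of N = {}) \<and> M \<subseteq> \<Union>\<N>)"

lemma meager_in_subset: "\<lbrakk>meager_in X M; L \<subseteq> M\<rbrakk> \<Longrightarrow> meager_in X L"
  unfolding meager_in_def by (meson order_trans)

lemma meager_in_Union:
  assumes "countable I" "\<And>i. i \<in> I \<Longrightarrow> meager_in X (M i)"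
  shows "meager_in X (\<Union>i\<in>I. M i)"
proof -
  obtain \<N> where \<N>: "\<And>i. i \<in> I \<Longrightarrow> countable (\<N> i)"
    "\<And>i N. \<lbrakk>i \<in> I; N \<in> \<N> i\<rbrakk> \<Longrightarrow> closedin X N \<and> X interior_of N = {}"
    "\<And>i. i \<in> I \<Longrightarrow> M i \<subseteq> \<Union>(\<N> i)"
    using assms(2) unfolding meager_in_def by metis
  show ?thesis unfolding meager_in_def
  proof (intro exI[of _ "\<Union>i\<in>I. \<N> i"] conjI ballI)
    show "countable (\<Union>i\<in>I. \<N> i)" using assms(1) \<N>(1) by (rule countable_UN)
    show "closedin X N" "X interior_of N = {}" if "N \<in> (\<Union>i\<in>I. \<N> i)" for N
      using that \<N>(2) by (metis UN_E)+
    show "(\<Union>i\<in>I. M i) \<subseteq> \<Union> (\<Union>i\<in>I. \<N> i)"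
    proof
      fix x assume "x \<in> (\<Union>i\<in>I. M i)"
      then obtain i where i: "i \<in> I" "x \<in> M i" by blast
      then obtain N where "N \<in> \<N> i" "x \<in> N" using \<N>(3)[OF i(1)] by blast
      then show "x \<in> \<Union> (\<Union>i\<in>I. \<N> i)" using i(1) by blast
    qed
  qed
qed

lemma meager_in_Un: "\<lbrakk>meager_in X M; meager_in X L\<rbrakk> \<Longrightarrow> meager_in X (M \<union> L)"
  using meager_in_Union[of "{True, False}" X "\<lambda>b. if b then M else L"] by (simp add: Un_commute)

lemma meager_in_closed: "\<lbrakk>closedin X N; X interior_of N = {}\<rbrakk> \<Longrightarrow> meager_in X N"
  unfolding meager_in_def by (intro exI[of _ "{N}"]) auto

lemma meager_in_empty: "meager_in X {}"
  by (rule meager_in_closed) auto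

text \<open>The Baire category theorem for compact Hausdorff spaces.\<close>

lemma meager_open_empty:
  assumes "compact_space X" "Hausdorff_space X" "openin X U" "meager_in X U"
  shows "U = {}"
proof -
  obtain \<N> where \<N>: "countable \<N>" "\<And>N. N \<in> \<N> \<Longrightarrow> closedin X N \<and> X interior_of N = {}" "U \<subseteq> \<Union>\<N>"
    using assms(4) unfolding meager_in_def by blast
  have "X interior_of \<Union>\<N> = {}"
    by (rule Baire_category_alt)
      (use assms \<N> in \<open>auto intro: compact_imp_locally_compact_space compact_Hausdorff_imp_regular_space\<close>)
  then show ?thesis using interior_of_maximal[OF \<N>(3) assms(3)] by blast
qed

lemma meager_in_homeomorphic_preimage:
  assumes f: "homeomorphic_map X X f" and M: "meager_in X M"
  shows "meager_in X {x \<in> topspace X. f x \<in> M}"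
proof -
  obtain g where "homeomorphic_maps X X f g" using f homeomorphic_map_maps by blast
  then have g: "homeomorphic_map X X g" and gf: "\<And>x. x \<in> topspace X \<Longrightarrow> g (f x) = x"
    using homeomorphic_maps_map by (blast, metis homeomorphic_maps_def)
  obtain \<N> where \<N>: "countable \<N>" "\<And>N. N \<in> \<N> \<Longrightarrow> closedin X N \<and> X interior_of N = {}" "M \<subseteq> \<Union>\<N>"
    using M unfolding meager_in_def by blast
  show ?thesis
    unfolding meager_in_def
  proof (intro exI[of _ "(\<lambda>N. g ` N) ` \<N>"] conjI ballI)
    show "countable ((\<lambda>N. g ` N) ` \<N>)" using \<N>(1) by simp
  next
    fix L assume "L \<in> (\<lambda>N. g ` N) ` \<N>"
    then obtain N where N: "N \<in> \<N>" "L = g ` N" by blast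
    have sub: "N \<subseteq> topspace X" using \<N>(2)[OF N(1)] closedin_subset by blast
    show "closedin X L" using homeomorphic_map_closedness[OF g sub] \<N>(2)[OF N(1)] N(2) by simp
    show "X interior_of L = {}" using homeomorphic_map_interior_of[OF g sub] \<N>(2)[OF N(1)] N(2) by simp
  next
    show "{x \<in> topspace X. f x \<in> M} \<subseteq> \<Union>((\<lambda>N. g ` N) ` \<N>)"
    proof
      fix x assume x: "x \<in> {x \<in> topspace X. f x \<in> M}"
      then obtain N where N: "N \<in> \<N>" "f x \<in> N" using \<N>(3) by blast
      have "g (f x) \<in> g ` N" using N(2) by (rule imageI)
      then have "x \<in> g ` N" using gf x by simp
      then show "x \<in> \<Union>((\<lambda>N. g ` N) ` \<N>)" using N(1) by blast
    qed
  qed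
qed

definition baire_property :: "'x topology \<Rightarrow> 'x set \<Rightarrow> bool" where
  "baire_property X A \<longleftrightarrow> (\<exists>U. openin X U \<and> meager_in X (A - U) \<and> meager_in X (U - A))"

lemma baire_property_open: "openin X U \<Longrightarrow> baire_property X U"
  unfolding baire_property_def using meager_in_empty by (metis Diff_cancel)

text \<open>The complement of an open set \<open>U\<close> differs from the open complement of its closure by the boundary of
\<open>U\<close>, which is closed and has empty interior.\<close>

lemma baire_property_compl:
  assumes "baire_property X A" shows "baire_property X (topspace X - A)"
proof -
  obtain U where U: "openin X U" "meager_in X (A - U)" "meager_in X (U - A)"
    using assms unfolding baire_property_def by blast
  define V where "V = topspace X - X closure_of U"
  have V: "openin X V" by (simp add: V_def openin_diff)
  have closed: "closedin X (X closure_of U - U)" using U(1) by (simp add: closedin_diff)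
  have "X interior_of (X closure_of U - U) = {}"
  proof (rule ccontr)
    assume "X interior_of (X closure_of U - U) \<noteq> {}"
    then obtain x where x: "x \<in> X interior_of (X closure_of U - U)" by blast
    have int: "openin X (X interior_of (X closure_of U - U))"
      "X interior_of (X closure_of U - U) \<subseteq> X closure_of U - U"
      by (simp_all add: interior_of_subset)
    then have "x \<in> X closure_of U" using x by blast
    then obtain y where "y \<in> U" "y \<in> X interior_of (X closure_of U - U)"
      using int(1) x unfolding in_closure_of by blast
    then show False using int(2) by blast
  qed
  then have "meager_in X (X closure_of U - U)" using closed by (rule meager_in_closed[rotated])
  then have "meager_in X ((X closure_of U - U) \<union> (U - A))" using U(3) by (rule meager_in_Un)
  then have 1: "meager_in X (topspace X - A - V)"
    by (rule meager_in_subset) (auto simp: V_def)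
  have cl: "U \<subseteq> X closure_of U" by (rule closure_of_subset[OF openin_subset[OF U(1)]])
  have 2: "meager_in X (V - (topspace X - A))"
    by (rule meager_in_subset[OF U(2)]) (use cl in \<open>auto simp: V_def\<close>)
  show ?thesis unfolding baire_property_def using V 1 2 by blast
qed

lemma baire_property_Union:
  assumes "\<And>i::nat. baire_property X (A i)" shows "baire_property X (\<Union>i. A i)"
proof -
  obtain U where U: "\<And>i. openin X (U i)" "\<And>i. meager_in X (A i - U i)" "\<And>i. meager_in X (U i - A i)"
    using assms unfolding baire_property_def by metis
  have "openin X (\<Union>i. U i)" using U(1) by blast
  moreover have "meager_in X ((\<Union>i. A i) - (\<Union>i. U i))"
    by (rule meager_in_subset[OF meager_in_Union[of UNIV X "\<lambda>i. A i - U i"]]) (use U(2) in auto)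
  moreover have "meager_in X ((\<Union>i. U i) - (\<Union>i. A i))"
    by (rule meager_in_subset[OF meager_in_Union[of UNIV X "\<lambda>i. U i - A i"]]) (use U(3) in auto)
  ultimately show ?thesis unfolding baire_property_def by blast
qed

lemma baire_property_borel:
  assumes "A \<in> sets (borel_of X)"
  shows "baire_property (subtopology X Z) (A \<inter> Z)"
proof -
  have "{U. openin X U} \<subseteq> Pow (topspace X)" using openin_subset by blast
  then have "A \<in> sigma_sets (topspace X) {U. openin X U}"
    using assms by (simp add: borel_of_def)
  then show ?thesis
  proof (induction rule: sigma_sets.induct)
    case (Basic a)
    then have "openin (subtopology X Z) (a \<inter> Z)" by (auto simp: openin_subtopology)
    then show ?case by (rule baire_property_open)
  next
    case Empty
    then show ?case using baire_property_open[of _ "{}"] by simp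
  next
    case (Compl a)
    have "(topspace X - a) \<inter> Z = topspace (subtopology X Z) - a \<inter> Z" by auto
    then show ?case using baire_property_compl[OF Compl.IH] by simp
  next
    case (Union a)
    then show ?case using baire_property_Union[of "subtopology X Z" "\<lambda>i. a i \<inter> Z"] by simp
  qed
qed

text \<open>Let \<open>Z\<close> be the closure of the orbit of \<open>x0\<close>, a compact space without isolated points. Since the orbit
is dense in \<open>Z\<close>, an invariant Borel set is meager or comeager in \<open>Z\<close>. Apply this to the
preimages of a countable base under a reduction \<open>\<theta>\<close>: off a meager set all points of \<open>Z\<close>
have the same value under \<open>\<theta>\<close>, that is, they belong to one orbit. But an orbit is countable, hence
meager in \<open>Z\<close>, and this contradicts the Baire category theorem.\<close>

theorem not_smooth_if_recurrent:
  fixes X :: "'x topology" and \<Phi> :: "('x \<Rightarrow> 'x) set"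
  assumes X: "compact_space X" "Hausdorff_space X"
    and \<Phi>: "countable \<Phi>" "\<And>\<phi>. \<phi> \<in> \<Phi> \<Longrightarrow> homeomorphic_map X X \<phi>"
    and E: "equiv (topspace X) E" "\<And>x y. x \<in> topspace X \<Longrightarrow> (x, y) \<in> E \<longleftrightarrow> (\<exists>\<phi>\<in>\<Phi>. y = \<phi> x)"
    and x0: "x0 \<in> topspace X"
    and recurrent: "\<And>U. \<lbrakk>openin X U; x0 \<in> U\<rbrakk> \<Longrightarrow> \<exists>y\<in>U. y \<noteq> x0 \<and> (x0, y) \<in> E"
  shows "\<not> smooth TYPE('y) X E"
proof
  assume "smooth TYPE('y) X E"
  then obtain Y :: "'y measure" and \<theta> where Y: "standard_borel Y" and \<theta>: "\<theta> \<in> measurable (borel_of X) Y"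
    and red: "\<And>x y. \<lbrakk>x \<in> topspace X; y \<in> topspace X\<rbrakk> \<Longrightarrow> (x, y) \<in> E \<longleftrightarrow> \<theta> x = \<theta> y"
    unfolding smooth_def by blast
  obtain S where S: "polish_topology S" "space Y = topspace S" "sets Y = sets (borel_of S)"
    using Y unfolding standard_borel_def by blast
  have space_X: "space (borel_of X) = topspace X"
    by (simp add: borel_of_def space_measure_of_conv)
  have E_dom: "E \<subseteq> topspace X \<times> topspace X" and refl: "refl_on (topspace X) E" and sym: "sym E" and trans: "trans E"
    using E(1) by (auto elim: equivE)
  define O0 where "O0 = E `` {x0}"
  have O0: "O0 \<subseteq> topspace X" "x0 \<in> O0" using E_dom refl x0 by (auto simp: O0_def refl_on_def)
  define Z where "Z = X closure_of O0"
  define X0 where "X0 = subtopology X Z"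
  have Z: "closedin X Z" "Z \<subseteq> topspace X" "O0 \<subseteq> Z"
    using O0 closure_of_subset by (auto simp: Z_def closure_of_subset_topspace)
  have top0: "topspace X0 = Z" using Z by (auto simp: X0_def)
  have X0: "compact_space X0" "Hausdorff_space X0"
    unfolding X0_def using X Z(1)
    by (auto simp: compact_space_subtopology closedin_compact_space Hausdorff_space_subtopology)
  have nonmeager: "\<not> meager_in X0 U" if "openin X0 U" "U \<noteq> {}" for U
    using meager_open_empty[OF X0 that(1)] that(2) by blast
  have dense: "\<exists>y\<in>U. y \<in> O0" if U: "openin X0 U" "U \<noteq> {}" for U
  proof -
    obtain W where W: "openin X W" "U = W \<inter> Z" using U(1) unfolding X0_def openin_subtopology by blast
    then obtain x where "x \<in> W" "x \<in> X closure_of O0" using U(2) by (auto simp: Z_def)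
    then obtain y where "y \<in> O0" "y \<in> W" using W(1) unfolding in_closure_of by blast
    then show ?thesis using W Z by blast
  qed
  have image_O0: "\<phi> ` O0 = O0" if \<phi>: "\<phi> \<in> \<Phi>" for \<phi>
  proof
    show "\<phi> ` O0 \<subseteq> O0"
    proof (rule image_subsetI)
      fix x assume x: "x \<in> O0"
      then have "(x, \<phi> x) \<in> E" using E(2)[of x "\<phi> x"] O0(1) \<phi> by blast
      then show "\<phi> x \<in> O0" using x trans unfolding O0_def trans_def by blast
    qed
    show "O0 \<subseteq> \<phi> ` O0"
    proof
      fix y assume y: "y \<in> O0"
      then obtain x where x: "x \<in> topspace X" "y = \<phi> x"
        using homeomorphic_imp_surjective_map[OF \<Phi>(2)[OF \<phi>]] O0(1) by blast
      then have "(x, y) \<in> E" using E(2)[of x y] \<phi> by blast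
      then have "x \<in> O0" using y trans sym unfolding O0_def trans_def sym_def by blast
      then show "y \<in> \<phi> ` O0" using x by blast
    qed
  qed
  have homeo0: "homeomorphic_map X0 X0 \<phi>" if \<phi>: "\<phi> \<in> \<Phi>" for \<phi>
  proof -
    have "\<phi> ` Z = Z"
      using homeomorphic_map_closure_of[OF \<Phi>(2)[OF \<phi>] O0(1)] image_O0[OF \<phi>] by (simp add: Z_def)
    then show ?thesis unfolding X0_def
      using homeomorphic_map_subtopologies[OF \<Phi>(2)[OF \<phi>], of Z Z] Z(2) by (simp add: Int_absorb1)
  qed
  \<comment> \<open>Otherwise \<open>A\<close> is comeager in a nonempty open set \<open>U\<close> and its complement is comeager in a nonempty
    open set \<open>V\<close>; some \<open>\<phi> \<in> \<Phi>\<close> maps a point of \<open>U\<close> into \<open>V\<close>, so that a nonempty open set is meager.\<close>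
  have zero_one: "meager_in X0 (A \<inter> Z) \<or> meager_in X0 (Z - A)"
    if bp: "baire_property X0 (A \<inter> Z)" and inv: "\<And>x y. (x, y) \<in> E \<Longrightarrow> x \<in> A \<longleftrightarrow> y \<in> A" for A
  proof -
    obtain U where U: "openin X0 U" "meager_in X0 (A \<inter> Z - U)" "meager_in X0 (U - A \<inter> Z)"
      using bp unfolding baire_property_def by blast
    obtain V where V: "openin X0 V" "meager_in X0 (Z - A \<inter> Z - V)" "meager_in X0 (V - (Z - A \<inter> Z))"
      using baire_property_compl[OF bp] unfolding baire_property_def top0 by blast
    show ?thesis
    proof (cases "U = {} \<or> V = {}")
      case True
      then show ?thesis
      proof
        assume "U = {}"
        then show ?thesis using U(2) by simp
      next
        assume "V = {}"
        then have "meager_in X0 (Z - A)" using V(2) by (rule_tac meager_in_subset) auto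
        then show ?thesis ..
      qed
    next
      case False
      then obtain p q where pq: "p \<in> U" "p \<in> O0" "q \<in> V" "q \<in> O0" using dense U(1) V(1) by metis
      then have "(p, q) \<in> E" using sym trans unfolding O0_def sym_def trans_def by blast
      then obtain \<phi> where \<phi>: "\<phi> \<in> \<Phi>" "q = \<phi> p" using E(2)[of p q] pq O0 by blast
      define W where "W = U \<inter> {x \<in> topspace X0. \<phi> x \<in> V}"
      have "openin X0 {x \<in> topspace X0. \<phi> x \<in> V}"
        using homeomorphic_imp_continuous_map[OF homeo0[OF \<phi>(1)]] V(1) by (rule openin_continuous_map_preimage)
      then have W: "openin X0 W" "p \<in> W" using U(1) pq \<phi> Z(3) by (auto simp: W_def top0)
      have "W \<subseteq> (U - A \<inter> Z) \<union> {x \<in> topspace X0. \<phi> x \<in> V - (Z - A \<inter> Z)}"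
      proof
        fix x assume x: "x \<in> W"
        then have xX: "x \<in> topspace X" using Z(2) by (auto simp: W_def top0)
        then have "(x, \<phi> x) \<in> E" using E(2)[of x "\<phi> x"] \<phi>(1) by blast
        then have "x \<in> A \<longleftrightarrow> \<phi> x \<in> A" by (rule inv)
        moreover have "\<phi> x \<in> Z" using x openin_subset[OF V(1)] by (auto simp: W_def top0)
        ultimately show "x \<in> (U - A \<inter> Z) \<union> {x \<in> topspace X0. \<phi> x \<in> V - (Z - A \<inter> Z)}"
          using x by (auto simp: W_def)
      qed
      then have "meager_in X0 W"
        using meager_in_Un[OF U(3) meager_in_homeomorphic_preimage[OF homeo0[OF \<phi>(1)] V(3)]]
        by (rule meager_in_subset[rotated])
      then show ?thesis using nonmeager W by blast
    qed
  qed
  obtain \<B> where \<B>: "countable \<B>" "\<And>V. V \<in> \<B> \<Longrightarrow> openin S V"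
    "\<And>U x. \<lbrakk>openin S U; x \<in> U\<rbrakk> \<Longrightarrow> \<exists>V\<in>\<B>. x \<in> V \<and> V \<subseteq> U"
    using S(1) unfolding polish_topology_def second_countable_def by metis
  have haus: "Hausdorff_space S"
    using S(1) metrizable_imp_Hausdorff_space completely_metrizable_imp_metrizable_space
    unfolding polish_topology_def by blast
  define A where "A V = \<theta> -` V \<inter> topspace X" for V
  have A_zero_one: "meager_in X0 (A V \<inter> Z) \<or> meager_in X0 (Z - A V)" if V: "V \<in> \<B>" for V
  proof (rule zero_one)
    have "V \<in> sets Y"
      using \<B>(2)[OF V] openin_subset unfolding S(3) borel_of_def by (subst sets_measure_of) auto
    then have "A V \<in> sets (borel_of X)" using measurable_sets[OF \<theta>] by (simp add: A_def space_X)
    then show "baire_property X0 (A V \<inter> Z)" unfolding X0_def by (rule baire_property_borel)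
    show "x \<in> A V \<longleftrightarrow> y \<in> A V" if "(x, y) \<in> E" for x y
    proof -
      have "x \<in> topspace X" "y \<in> topspace X" using that E_dom by auto
      then show ?thesis using red[of x y] that by (simp add: A_def)
    qed
  qed
  define M where "M V = (if meager_in X0 (A V \<inter> Z) then A V \<inter> Z else Z - A V)" for V
  have M: "meager_in X0 (\<Union>V\<in>\<B>. M V)"
    using \<B>(1) A_zero_one by (intro meager_in_Union) (auto simp: M_def)
  have same: "\<theta> x = \<theta> y" if x: "x \<in> Z - (\<Union>V\<in>\<B>. M V)" and y: "y \<in> Z - (\<Union>V\<in>\<B>. M V)" for x y
  proof (rule ccontr)
    assume ne: "\<theta> x \<noteq> \<theta> y"
    have xy: "x \<in> topspace X" "y \<in> topspace X" using x y Z by auto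
    then have "\<theta> x \<in> topspace S" "\<theta> y \<in> topspace S"
      using measurable_space[OF \<theta>] by (simp_all add: space_X S(2))
    then obtain U W where UW: "openin S U" "openin S W" "\<theta> x \<in> U" "\<theta> y \<in> W" "disjnt U W"
      using haus ne unfolding Hausdorff_space_def by metis
    obtain V where V: "V \<in> \<B>" "\<theta> x \<in> V" "V \<subseteq> U" using \<B>(3) UW by metis
    have "\<theta> y \<notin> V" using V UW by (auto simp: disjnt_iff)
    then have "x \<in> A V" "y \<notin> A V" using V xy by (auto simp: A_def)
    then show False using x y V(1) by (auto simp: M_def split: if_splits)
  qed
  have x0Z: "x0 \<in> Z" using O0 Z by blast
  \<comment> \<open>An isolated point of \<open>Z\<close> is in the dense orbit, so \<open>x0\<close> would be isolated in \<open>Z\<close> too.\<close>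
  have perfect: "\<not> openin X0 {y}" if "y \<in> Z" for y
  proof
    assume y: "openin X0 {y}"
    then have "y \<in> O0" using dense by blast
    then have "(x0, y) \<in> E" by (simp add: O0_def)
    then obtain \<phi> where \<phi>: "\<phi> \<in> \<Phi>" "y = \<phi> x0" using E(2)[OF x0] by blast
    have "openin X0 (\<phi> ` {x0})" using y \<phi> by simp
    then have "openin X0 {x0}" using homeomorphic_map_openness[OF homeo0[OF \<phi>(1)], of "{x0}"] x0Z by (simp add: top0)
    then obtain W where W: "openin X W" "{x0} = W \<inter> Z" unfolding X0_def openin_subtopology by blast
    then obtain z where z: "z \<in> W" "z \<noteq> x0" "(x0, z) \<in> E" using recurrent[of W] by blast
    then have "z \<in> Z" using Z(3) by (auto simp: O0_def)
    then show False using z W by blast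
  qed
  have "\<not> meager_in X0 Z" using nonmeager[of Z] openin_topspace[of X0] x0Z unfolding top0 by blast
  then obtain x where x: "x \<in> Z - (\<Union>V\<in>\<B>. M V)" using M meager_in_subset by (metis DiffI subsetI)
  have xX: "x \<in> topspace X" using x Z by blast
  have orbit_x: "E `` {x} = (\<lambda>\<phi>. \<phi> x) ` \<Phi>" using E(2)[OF xX] by auto
  then have "countable (E `` {x} \<inter> Z)" using \<Phi>(1) by (simp add: orbit_x)
  moreover have "meager_in X0 {y}" if "y \<in> E `` {x} \<inter> Z" for y
  proof (rule meager_in_closed)
    show "closedin X0 {y}" using that X0(2) by (simp add: closedin_Hausdorff_singleton top0)
    show "X0 interior_of {y} = {}"
    proof (rule ccontr)
      assume "X0 interior_of {y} \<noteq> {}"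
      moreover have "X0 interior_of {y} \<subseteq> {y}" by (rule interior_of_subset)
      ultimately have "X0 interior_of {y} = {y}" by blast
      then have "openin X0 {y}" by (metis openin_interior_of)
      then show False using perfect that by blast
    qed
  qed
  ultimately have "meager_in X0 (\<Union>y\<in>E `` {x} \<inter> Z. {y})" by (rule meager_in_Union)
  then have "meager_in X0 ((\<Union>y\<in>E `` {x} \<inter> Z. {y}) \<union> (\<Union>V\<in>\<B>. M V))" using M by (rule meager_in_Un)
  moreover have "Z \<subseteq> (\<Union>y\<in>E `` {x} \<inter> Z. {y}) \<union> (\<Union>V\<in>\<B>. M V)"
  proof
    fix y assume y: "y \<in> Z"
    then have yX: "y \<in> topspace X" using Z by blast
    show "y \<in> (\<Union>y\<in>E `` {x} \<inter> Z. {y}) \<union> (\<Union>V\<in>\<B>. M V)"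
    proof (cases "y \<in> (\<Union>V\<in>\<B>. M V)")
      case False
      then have "(x, y) \<in> E" using same[OF x, of y] y red[OF xX yX] by blast
      then show ?thesis using y by blast
    qed blast
  qed
  ultimately have "meager_in X0 Z" by (rule meager_in_subset)
  then show False using \<open>\<not> meager_in X0 Z\<close> by blast
qed

section \<open>The topology of the space of left-orderings\<close>

context group
begin

lemma positive_cone_iff_ordered: "positive_cone G P \<longleftrightarrow> ordered_subgroup G (carrier G) P"
proof
  assume "positive_cone G P"
  then have P: "P \<subseteq> carrier G" "P <#> P \<subseteq> P" "P \<inter> set_inv P = {}" "P \<union> set_inv P = carrier G - {\<one>}"
    by (auto simp: positive_cone_def)
  show "ordered_subgroup G (carrier G) P"
  proof (rule ordered_subgroupI)
    show "subgroup (carrier G) G" by (rule subgroup_self)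
    show "P \<subseteq> carrier G" by (rule P)
    show "x \<otimes> y \<in> P" if "x \<in> P" "y \<in> P" for x y using P(2) that by (auto simp: set_mult_def)
    show "\<one> \<notin> P" using P(4) by blast
    show "x \<in> P \<or> inv x \<in> P" if "x \<in> carrier G" "x \<noteq> \<one>" for x
    proof -
      have "x \<in> P \<or> x \<in> set_inv P" using that P(4) by blast
      then show ?thesis using P(1) by (auto simp: SET_INV_def)
    qed
  qed
next
  assume P: "ordered_subgroup G (carrier G) P"
  interpret ordered_subgroup G "carrier G" P by (rule P)
  have si: "x \<in> set_inv P \<longleftrightarrow> inv x \<in> P" if "x \<in> carrier G" for x
    using that by (force simp: SET_INV_def)
  have sub: "set_inv P \<subseteq> carrier G" by (auto simp: SET_INV_def)
  show "positive_cone G P"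
    unfolding positive_cone_def
  proof (intro conjI)
    show "P \<subseteq> carrier G" by (rule pos_sub)
    show "P <#> P \<subseteq> P" using pos_mult by (auto simp: set_mult_def)
    show "P \<inter> set_inv P = {}" using si pos_inv by auto
    show "P \<union> set_inv P = carrier G - {\<one>}"
    proof (intro equalityI subsetI)
      fix x assume x: "x \<in> P \<union> set_inv P"
      then have xc: "x \<in> carrier G" using sub pos_carrier by blast
      have "x \<noteq> \<one>" using x si[OF xc] pos_one by auto
      then show "x \<in> carrier G - {\<one>}" using xc by simp
    next
      fix x assume "x \<in> carrier G - {\<one>}"
      then show "x \<in> P \<union> set_inv P" using pos_total[of x] si[of x] by blast
    qed
  qed
qed

lemma LO_eq_cones: "LO G = cones (carrier G)"
  by (simp add: LO_def cones_def positive_cone_iff_ordered)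

lemma LO_I: "ordered_subgroup G (carrier G) Q \<Longrightarrow> Q \<in> LO G"
  by (simp add: LO_eq_cones cones_def)

lemma LO_D: "Q \<in> LO G \<Longrightarrow> ordered_subgroup G (carrier G) Q"
  by (simp add: LO_eq_cones cones_def)

lemma LO_carrier: "Q \<in> LO G \<Longrightarrow> Q \<subseteq> carrier G"
  by (rule ordered_subgroup.pos_sub[OF LO_D])

lemma LO_total: "\<lbrakk>Q \<in> LO G; x \<in> carrier G; x \<noteq> \<one>\<rbrakk> \<Longrightarrow> x \<in> Q \<or> inv x \<in> Q"
  by (rule ordered_subgroup.pos_total[OF LO_D])

lemma LO_inv: "\<lbrakk>Q \<in> LO G; x \<in> Q\<rbrakk> \<Longrightarrow> inv x \<notin> Q"
  by (rule ordered_subgroup.pos_inv[OF LO_D])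

lemma LO_one: "Q \<in> LO G \<Longrightarrow> \<one> \<notin> Q"
  by (rule ordered_subgroup.pos_one[OF LO_D])

abbreviation (input) chi :: "'a set \<Rightarrow> 'a \<Rightarrow> bool" where
  "chi \<equiv> \<lambda>P. \<lambda>g\<in>carrier G. g \<in> P"

abbreviation (input) cube :: "('a \<Rightarrow> bool) topology" where
  "cube \<equiv> product_topology (\<lambda>_. discrete_topology (UNIV :: bool set)) (carrier G)"

lemma openin_LO_topology:
  "openin (LO_topology G) U \<longleftrightarrow> (\<exists>V. openin cube V \<and> U = {Q \<in> LO G. chi Q \<in> V})"
proof -
  have "chi -` V \<inter> Pow (carrier G) \<inter> LO G = {Q \<in> LO G. chi Q \<in> V}" for V
    using LO_carrier by auto
  moreover have "(\<exists>T. (\<exists>V. A V \<and> T = f V) \<and> U = T \<inter> L) \<longleftrightarrow> (\<exists>V. A V \<and> U = f V \<inter> L)"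
    for A :: "('a \<Rightarrow> bool) set \<Rightarrow> bool" and f and L :: "'a set set" by blast
  ultimately show ?thesis
    unfolding LO_topology_def openin_subtopology openin_pullback_topology by simp
qed

lemma openin_cube_coordinate: "x \<in> carrier G \<Longrightarrow> openin cube {v \<in> topspace cube. v x = b}"
  using openin_continuous_map_preimage[OF continuous_map_product_projection[of x "carrier G" "\<lambda>_. discrete_topology (UNIV :: bool set)"], of "{b}"]
  by simp

lemma openin_LO_contains:
  assumes E: "finite E"
  shows "openin (LO_topology G) {Q \<in> LO G. E \<subseteq> Q}"
proof (cases "E \<subseteq> carrier G")
  case True
  have one: "openin (LO_topology G) {Q \<in> LO G. x \<in> Q}" if x: "x \<in> carrier G" for x
  proof -
    have "{Q \<in> LO G. x \<in> Q} = {Q \<in> LO G. chi Q \<in> {v \<in> topspace cube. v x = True}}"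
      using x by auto
    then show ?thesis unfolding openin_LO_topology using openin_cube_coordinate[OF x] by blast
  qed
  show ?thesis using E True
  proof (induction E rule: finite_induct)
    case empty
    show ?case using openin_topspace[of "LO_topology G"] by simp
  next
    case (insert x F)
    have "{Q \<in> LO G. insert x F \<subseteq> Q} = {Q \<in> LO G. x \<in> Q} \<inter> {Q \<in> LO G. F \<subseteq> Q}" by blast
    then show ?case using insert one[of x] by (simp add: openin_Int)
  qed
next
  case False
  then have "{Q \<in> LO G. E \<subseteq> Q} = {}" using LO_carrier by blast
  then show ?thesis using openin_empty by metis
qed

text \<open>That \<open>x\<close> is not in a cone can be expressed by \<open>x = \<one>\<close> or by \<open>inv x\<close> being in it. So the sets of all
cones that contain a given finite set form a base of the topology.\<close>

lemma LO_neighbourhood: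
  assumes U: "openin (LO_topology G) U" and Q: "Q \<in> U"
  obtains E where "finite E" "E \<subseteq> Q" "\<And>R. \<lbrakk>R \<in> LO G; E \<subseteq> R\<rbrakk> \<Longrightarrow> R \<in> U"
proof -
  obtain V where V: "openin cube V" "U = {Q \<in> LO G. chi Q \<in> V}" using U unfolding openin_LO_topology by blast
  have QLO: "Q \<in> LO G" and "chi Q \<in> V" using Q V by auto
  then obtain W where W: "finite {i \<in> carrier G. W i \<noteq> UNIV}" "chi Q \<in> Pi\<^sub>E (carrier G) W" "Pi\<^sub>E (carrier G) W \<subseteq> V"
    using V(1) unfolding openin_product_topology_alt by auto
  define J where "J = {i \<in> carrier G. W i \<noteq> UNIV}"
  define E where "E = (J \<inter> Q) \<union> m_inv G ` (J - Q - {\<one>})"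
  show thesis
  proof (rule that[of E])
    show "finite E" using W(1) by (simp add: E_def J_def)
    show "E \<subseteq> Q" using LO_total[OF QLO] by (auto simp: E_def J_def)
    fix R assume R: "R \<in> LO G" "E \<subseteq> R"
    have "x \<in> R \<longleftrightarrow> x \<in> Q" if x: "x \<in> J" for x
    proof (cases "x \<in> Q")
      case True
      then have "x \<in> E" using x by (simp add: E_def)
      then show ?thesis using True R(2) by blast
    next
      case False
      have "x \<notin> R"
      proof (cases "x = \<one>")
        case True
        then show ?thesis using LO_one[OF R(1)] by simp
      next
        case neq: False
        then have "inv x \<in> E" using x False by (simp add: E_def)
        then have "inv x \<in> R" using R(2) by blast
        then show ?thesis using LO_inv[OF R(1)] by blast
      qed
      then show ?thesis using False by simp
    qed
    then have "(i \<in> R) \<in> W i" if "i \<in> carrier G" for i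
      using that W(2) by (cases "W i = UNIV") (auto simp: J_def PiE_iff)
    then have "chi R \<in> Pi\<^sub>E (carrier G) W" by (simp add: PiE_iff)
    then show "R \<in> U" using V(2) W(3) R(1) by blast
  qed
qed

lemma Hausdorff_LO: "Hausdorff_space (LO_topology G)"
  unfolding Hausdorff_space_def
proof (intro allI impI)
  fix P Q assume "P \<in> topspace (LO_topology G) \<and> Q \<in> topspace (LO_topology G) \<and> P \<noteq> Q"
  then have PQ: "P \<in> LO G" "Q \<in> LO G" "P \<noteq> Q" by auto
  interpret Q: ordered_subgroup G "carrier G" Q by (rule LO_D[OF PQ(2)])
  have "\<not> P \<subseteq> Q"
    using ordered_subgroup.cone_eqI[OF LO_D[OF PQ(1)] LO_D[OF PQ(2)]] PQ(3) by blast
  then obtain x where x: "x \<in> P" "x \<notin> Q" by blast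
  have "x \<in> carrier G" "x \<noteq> \<one>" using x LO_carrier[OF PQ(1)] LO_one[OF PQ(1)] by auto
  then have "inv x \<in> Q" using LO_total[OF PQ(2)] x by blast
  then show "\<exists>U V. openin (LO_topology G) U \<and> openin (LO_topology G) V \<and> P \<in> U \<and> Q \<in> V \<and> disjnt U V"
    using openin_LO_contains[of "{x}"] openin_LO_contains[of "{inv x}"] x PQ LO_inv
    by (intro exI[of _ "{R \<in> LO G. {x} \<subseteq> R}"] exI[of _ "{R \<in> LO G. {inv x} \<subseteq> R}"]) (auto simp: disjnt_iff)
qed

text \<open>The indicator functions of cones form a closed subset \<open>L\<close> of the compact cube: each axiom of a
cone concerns at most three coordinates.\<close>

lemma compact_LO: "compact_space (LO_topology G)"
proof -
  define c where "c v = {x \<in> carrier G. v x}" for v :: "'a \<Rightarrow> bool"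
  have chi_c: "chi (c v) = v" if "v \<in> topspace cube" for v
    using that by (auto simp: c_def PiE_iff extensional_def fun_eq_iff)
  have c_chi: "c (chi Q) = Q" if "Q \<in> LO G" for Q using LO_carrier[OF that] by (auto simp: c_def)
  have clopen: "closedin cube {v \<in> topspace cube. v x = b}" if "x \<in> carrier G" for x b
  proof -
    have eq: "{v \<in> topspace cube. v x = b} = topspace cube - {v \<in> topspace cube. v x = (\<not> b)}" by auto
    show ?thesis unfolding eq by (intro closedin_diff closedin_topspace openin_cube_coordinate that)
  qed
  \<comment> \<open>one closed condition for each axiom: products of positive elements are positive (\<open>M\<close>), and one
    of \<open>x\<close> and \<open>inv x\<close> is positive (\<open>N\<close>)\<close>
  define M where "M p = {v \<in> topspace cube. v (fst p) = False} \<union> {v \<in> topspace cube. v (snd p) = False} \<union>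
      {v \<in> topspace cube. v (fst p \<otimes> snd p) = True}" for p
  define N where "N x = {v \<in> topspace cube. v x = True} \<union> {v \<in> topspace cube. v (inv x) = True}" for x
  define X1 where "X1 = \<Inter>(insert (topspace cube) (M ` (carrier G \<times> carrier G)))"
  define X2 where "X2 = \<Inter>(insert (topspace cube) (N ` (carrier G - {\<one>})))"
  define L where "L = X1 \<inter> {v \<in> topspace cube. v \<one> = False} \<inter> X2"
  have M: "closedin cube (M p)" if "p \<in> carrier G \<times> carrier G" for p
    unfolding M_def using that by (intro closedin_Un clopen) auto
  have N: "closedin cube (N x)" if "x \<in> carrier G - {\<one>}" for x
    unfolding N_def using that by (intro closedin_Un clopen) auto
  have "closedin cube X1" unfolding X1_def
    by (rule closedin_Inter) (use M closedin_topspace in blast)+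
  moreover have "closedin cube X2" unfolding X2_def
    by (rule closedin_Inter) (use N closedin_topspace in blast)+
  ultimately have L: "closedin cube L" unfolding L_def using clopen[OF one_closed] by (intro closedin_Int)
  have cL: "c v \<in> LO G" if v: "v \<in> L" for v
  proof (rule LO_I, rule ordered_subgroupI)
    show "subgroup (carrier G) G" by (rule subgroup_self)
    show "c v \<subseteq> carrier G" by (auto simp: c_def)
    show "x \<otimes> y \<in> c v" if "x \<in> c v" "y \<in> c v" for x y
    proof -
      have xy: "x \<in> carrier G" "y \<in> carrier G" "v x" "v y" using that by (auto simp: c_def)
      have "v \<in> X1" using v by (simp add: L_def)
      then have "v \<in> M (x, y)" using xy(1,2) unfolding X1_def by blast
      then have "v x = False \<or> v y = False \<or> v (x \<otimes> y) = True" by (auto simp: M_def)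
      then show ?thesis using xy by (simp add: c_def)
    qed
    show "\<one> \<notin> c v" using v by (auto simp: L_def c_def)
    show "x \<in> c v \<or> inv x \<in> c v" if x: "x \<in> carrier G" "x \<noteq> \<one>" for x
    proof -
      have "v \<in> X2" using v by (simp add: L_def)
      then have "v \<in> N x" using x unfolding X2_def by blast
      then have "v x = True \<or> v (inv x) = True" by (auto simp: N_def)
      then show ?thesis using x by (auto simp: c_def)
    qed
  qed
  have chiL: "chi Q \<in> L" if Q: "Q \<in> LO G" for Q
  proof -
    interpret Q: ordered_subgroup G "carrier G" Q using LO_D Q .
    have top: "chi Q \<in> topspace cube" by auto
    have "chi Q \<in> M p" if p: "p \<in> carrier G \<times> carrier G" for p
    proof -
      have "fst p \<in> carrier G" "snd p \<in> carrier G" using p by auto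
      then show ?thesis using top Q.pos_mult[of "fst p" "snd p"] unfolding M_def
        by (cases "fst p \<in> Q"; cases "snd p \<in> Q") simp_all
    qed
    then have "chi Q \<in> X1" using top unfolding X1_def by blast
    moreover have "chi Q \<in> N x" if x: "x \<in> carrier G - {\<one>}" for x
      using top Q.pos_total[of x] x unfolding N_def by (cases "x \<in> Q") simp_all
    then have "chi Q \<in> X2" using top unfolding X2_def by blast
    ultimately show ?thesis using top Q.pos_one by (simp add: L_def)
  qed
  have Ltop: "L \<subseteq> topspace cube" using L closedin_subset by blast
  have "compact_space cube"
    by (simp add: compact_space_product_topology compact_space_discrete_topology)
  then have comp: "compactin cube L" using L closedin_compact_space by blast
  have cont: "continuous_map (subtopology cube L) (LO_topology G) c"
    unfolding continuous_map_def
  proof (intro conjI allI impI)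
    show "c \<in> topspace (subtopology cube L) \<rightarrow> topspace (LO_topology G)" using cL by auto
    fix U assume "openin (LO_topology G) U"
    then obtain V where V: "openin cube V" "U = {Q \<in> LO G. chi Q \<in> V}" unfolding openin_LO_topology by blast
    have "{v \<in> topspace (subtopology cube L). c v \<in> U} = V \<inter> L"
      using V(2) cL chi_c Ltop by auto
    then show "openin (subtopology cube L) {v \<in> topspace (subtopology cube L). c v \<in> U}"
      using V(1) by (auto simp: openin_subtopology)
  qed
  have "compactin (subtopology cube L) L" using comp by (simp add: compactin_subtopology)
  then have "compactin (LO_topology G) (c ` L)" using cont by (rule image_compactin)
  moreover have "c ` L = LO G"
  proof
    show "c ` L \<subseteq> LO G" using cL by (rule image_subsetI)
    show "LO G \<subseteq> c ` L"
    proof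
      fix Q assume Q: "Q \<in> LO G"
      have "c (chi Q) \<in> c ` L" using chiL[OF Q] by (rule imageI)
      then show "Q \<in> c ` L" unfolding c_chi[OF Q] .
    qed
  qed
  ultimately show ?thesis by (simp add: compact_space_def)
qed

lemma cone_conjugation_eq: "P \<in> LO G \<Longrightarrow> cone_conjugation G g P = conj_by g P"
  unfolding cone_conjugation_def conj_by_def l_coset_def r_coset_def by auto

lemma conj_by_LO: "\<lbrakk>P \<in> LO G; g \<in> carrier G\<rbrakk> \<Longrightarrow> conj_by g P \<in> LO G"
  by (rule LO_I[OF ordered_subgroup.conj_cone_K[OF LO_D]])

lemma E_lo_iff: "(P, Q) \<in> E_lo G \<longleftrightarrow> P \<in> LO G \<and> (\<exists>g\<in>carrier G. Q = conj_by g P)"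
  unfolding E_lo_def orbit_def using cone_conjugation_eq by auto

lemma continuous_conj_by:
  assumes g: "g \<in> carrier G"
  shows "continuous_map (LO_topology G) (LO_topology G) (conj_by g)"
  unfolding continuous_map_def
proof (intro conjI allI impI)
  show "conj_by g \<in> topspace (LO_topology G) \<rightarrow> topspace (LO_topology G)" using conj_by_LO g by auto
  fix U assume U: "openin (LO_topology G) U"
  show "openin (LO_topology G) {P \<in> topspace (LO_topology G). conj_by g P \<in> U}"
  proof (subst openin_subopen, intro ballI)
    fix P assume "P \<in> {P \<in> topspace (LO_topology G). conj_by g P \<in> U}"
    then have P: "P \<in> LO G" "conj_by g P \<in> U" by auto
    obtain E where E: "finite E" "E \<subseteq> conj_by g P" "\<And>R. \<lbrakk>R \<in> LO G; E \<subseteq> R\<rbrakk> \<Longrightarrow> R \<in> U"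
      using LO_neighbourhood[OF U P(2)] by blast
    have "finite (conj_by (inv g) E)" using E(1) by (simp add: conj_by_def)
    then have op: "openin (LO_topology G) {R \<in> LO G. conj_by (inv g) E \<subseteq> R}" by (rule openin_LO_contains)
    have Pin: "conj_by (inv g) E \<subseteq> P"
      using conj_by_mono[OF E(2), of "inv g"] conj_by_inv(1)[OF LO_carrier[OF P(1)] g] by simp
    have Ec: "E \<subseteq> carrier G" using E(2) conj_by_subset[OF LO_carrier[OF P(1)] g] by blast
    have "conj_by g R \<in> U" if "R \<in> LO G" "conj_by (inv g) E \<subseteq> R" for R
    proof (rule E(3))
      show "conj_by g R \<in> LO G" using conj_by_LO that(1) g .
      show "E \<subseteq> conj_by g R" using conj_by_mono[OF that(2), of g] conj_by_inv(2)[OF Ec g] by simp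
    qed
    then show "\<exists>T. openin (LO_topology G) T \<and> P \<in> T \<and> T \<subseteq> {P \<in> topspace (LO_topology G). conj_by g P \<in> U}"
      using op Pin P(1) by (intro exI[of _ "{R \<in> LO G. conj_by (inv g) E \<subseteq> R}"]) auto
  qed
qed

lemma homeomorphic_conj_by:
  assumes g: "g \<in> carrier G"
  shows "homeomorphic_map (LO_topology G) (LO_topology G) (conj_by g)"
proof -
  have "homeomorphic_maps (LO_topology G) (LO_topology G) (conj_by g) (conj_by (inv g))"
    unfolding homeomorphic_maps_def
    using continuous_conj_by[OF g] continuous_conj_by[of "inv g"] conj_by_inv[OF LO_carrier g] g by auto
  then show ?thesis using homeomorphic_map_maps by blast
qed

lemma isolated_point_cone:
  assumes "isolated_point (LO_topology G) P"
  shows "ordered_subgroup G (carrier G) P" "isolated_cone (carrier G) P"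
proof -
  have P: "P \<in> LO G" "openin (LO_topology G) {P}" using assms by (auto simp: isolated_point_def)
  show "ordered_subgroup G (carrier G) P" using LO_D P(1) .
  obtain E where "finite E" "E \<subseteq> P" "\<And>R. \<lbrakk>R \<in> LO G; E \<subseteq> R\<rbrakk> \<Longrightarrow> R \<in> {P}"
    using LO_neighbourhood[OF P(2)] by blast
  then show "isolated_cone (carrier G) P" unfolding isolated_cone_def using LO_I by blast
qed

lemma infinite_LO_if_not_tararin:
  assumes "\<not> tararin G" "P \<in> LO G"
  shows "infinite (cones (carrier G))"
proof
  assume "finite (cones (carrier G))"
  then have "finite {P. positive_cone G P}" by (simp add: LO_eq_cones[symmetric] LO_def)
  then have "finite {r. left_ordering G r}"
    using bij_betw_finite[OF bij_betw_left_orderings_positive_cones] by simp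
  moreover have "left_orderable G" using assms(2) by (auto simp: left_orderable_def LO_def)
  ultimately show False using assms(1) by (simp add: tararin_def)
qed

end

section \<open>From an isolated cone to a self-accumulating cone\<close>

context group
begin

text \<open>\<open>C\<close> is the largest convex subgroup with finitely many cones, and \<open>D\<close> is the next convex subgroup; both
exist because an isolated cone has finitely many convex subgroups. If the jump from \<open>C\<close> to \<open>D\<close>
were archimedean, \<open>D\<close> would have finitely many cones too. So the accumulation alternative
holds for this jump. It is inherited by \<open>K\<close>: elements of \<open>P\<close> outside \<open>D\<close> remain positive
when they are conjugated by \<open>g \<in> D\<close>.\<close>

lemma isolated_cone_gap:
  assumes P: "ordered_subgroup G K P" and iso: "isolated_cone K P" and inf: "infinite (cones K)"
  obtains C where "convex_subgroup K P C" "finite (cones C)" "conjugates_accumulate K P C"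
proof -
  interpret P: ordered_subgroup G K P by (rule P)
  have fin: "finite {C. convex_subgroup K P C}" using P.finite_convex_subgroups[OF iso] .
  define \<C> where "\<C> = {C. convex_subgroup K P C \<and> finite (cones C)}"
  have "cones {\<one>} \<subseteq> {{}}"
  proof
    fix R assume "R \<in> cones {\<one>}"
    then interpret R: ordered_subgroup G "{\<one>}" R by (simp add: cones_def)
    show "R \<in> {{}}" using R.pos_sub R.pos_one by blast
  qed
  then have "finite (cones {\<one>})" by (rule finite_subset) simp
  then have "{\<one>} \<in> \<C>" using P.convex_one by (simp add: \<C>_def)
  moreover have "finite \<C>" by (rule finite_subset[OF _ fin]) (auto simp: \<C>_def)
  ultimately obtain C where C: "C \<in> \<C>" and C_max: "\<forall>D\<in>\<C>. C \<subseteq> D \<longrightarrow> C = D"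
    using finite_has_maximal[of \<C>] by (metis empty_iff)
  have conv_C: "convex_subgroup K P C" and fin_C: "finite (cones C)" using C by (simp_all add: \<C>_def)
  have "C \<noteq> K" using fin_C inf by blast
  interpret C: ordered_with_convex G K P C by unfold_locales (rule conv_C)
  define \<D> where "\<D> = {D. convex_subgroup K P D \<and> C \<subset> D}"
  have "K \<in> \<D>" using P.convex_K C.C_sub \<open>C \<noteq> K\<close> by (auto simp: \<D>_def)
  moreover have "finite \<D>" by (rule finite_subset[OF _ fin]) (auto simp: \<D>_def)
  ultimately obtain D where D: "D \<in> \<D>" and D_min: "\<forall>B\<in>\<D>. B \<subseteq> D \<longrightarrow> D = B"
    using finite_has_minimal[of \<D>] by (metis empty_iff)
  have conv_D: "convex_subgroup K P D" and CD: "C \<subset> D" using D by (simp_all add: \<D>_def)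
  interpret D: ordered_with_convex G K P D by unfold_locales (rule conv_D)
  interpret PD: ordered_subgroup G D "P \<inter> D" by (rule D.restrict_cone)
  have conv_CD: "convex_subgroup D (P \<inter> D) C"
    using conv_C CD unfolding convex_subgroup_def by blast
  interpret J: ordered_with_convex G D "P \<inter> D" C by unfold_locales (rule conv_CD)
  have max_C: "B = C \<or> B = D" if B: "convex_subgroup D (P \<inter> D) B" "C \<subseteq> B" for B
  proof -
    have "convex_subgroup K P B"
      unfolding convex_subgroup_def
    proof (intro conjI ballI impI)
      show "subgroup B G" using B(1) by (simp add: convex_subgroup_def)
      have "B \<subseteq> D" using B(1) by (simp add: convex_subgroup_def)
      then show "B \<subseteq> K" using D.C_sub by blast
      fix x y assume xy: "x \<in> P" "y \<in> P" "x \<otimes> y \<in> B"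
      then have xyD: "x \<otimes> y \<in> D" using \<open>B \<subseteq> D\<close> by blast
      have "x \<in> P \<inter> D" "y \<in> P \<inter> D" using D.convexD[OF xy(1,2) xyD] D.convexD2[OF xy(1,2) xyD] xy by auto
      then show "x \<in> B" using B(1) xy(3) unfolding convex_subgroup_def by meson
    qed
    moreover have "B \<subseteq> D" using B(1) by (simp add: convex_subgroup_def)
    ultimately show ?thesis using D_min B(2) by (auto simp: \<D>_def)
  qed
  have iso_D: "isolated_cone D (P \<inter> D)" using P.isolated_restrict[OF conv_D iso] .
  have neq: "C \<noteq> D" using CD by blast
  show thesis
  proof (rule J.jump_dichotomy[OF neq max_C])
    fix \<tau> assume \<tau>: "real_hom D \<tau>" "\<And>x. x \<in> P \<inter> D - C \<Longrightarrow> \<tau> x > 0" "\<And>x. x \<in> C \<Longrightarrow> \<tau> x = 0"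
    interpret archimedean_jump G D "P \<inter> D" C \<tau>
      by unfold_locales (use \<tau> iso_D neq in auto)
    have "finite (cones D)" using finite_cones_extension fin_C .
    then have "D \<in> \<C>" using conv_D by (simp add: \<C>_def)
    then show thesis using C_max CD by blast
  next
    assume acc: "conjugates_accumulate D (P \<inter> D) C"
    show thesis
    proof (rule that[OF conv_C fin_C], unfold conjugates_accumulate_def, intro allI impI)
      fix E assume E: "finite E" "E \<subseteq> P - C"
      then have "finite (E \<inter> D)" "E \<inter> D \<subseteq> P \<inter> D - C" by auto
      with acc obtain g where g: "g \<in> D" and acc_g: "\<And>Q. \<lbrakk>ordered_subgroup G D Q; P \<inter> D - C \<subseteq> Q\<rbrakk> \<Longrightarrow>
          E \<inter> D \<subseteq> conj_by g Q \<and> \<not> P \<inter> D - C \<subseteq> conj_by g Q"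
        by (rule conjugates_accumulateE) (rule that)
      have gK: "g \<in> K" using g by simp
      have gc: "g \<in> carrier G" using gK by simp
      have "E \<subseteq> conj_by g Q \<and> \<not> P - C \<subseteq> conj_by g Q"
        if Q: "ordered_subgroup G K Q" and sub: "P - C \<subseteq> Q" for Q
      proof -
        have conv_DQ: "convex_subgroup K Q D" using C.convex_agree[OF Q sub, of D] CD conv_D by blast
        interpret Q: ordered_with_convex G K Q D
          using Q conv_DQ by (intro ordered_with_convex.intro ordered_with_convex_axioms.intro)
        have Qc: "Q \<subseteq> carrier G" by auto
        have QDc: "Q \<inter> D \<subseteq> carrier G" by auto
        have in_D: "E \<inter> D \<subseteq> conj_by g (Q \<inter> D)" and not: "\<not> P \<inter> D - C \<subseteq> conj_by g (Q \<inter> D)"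
          using acc_g[OF Q.restrict_cone] sub by blast+
        have "e \<in> conj_by g Q" if e: "e \<in> E" for e
        proof (cases "e \<in> D")
          case True
          then show ?thesis using in_D e conj_by_mono[of "Q \<inter> D" Q g] by blast
        next
          case False
          then have eQ: "e \<in> Q - D" using e E(2) sub by blast
          then have "inv g \<otimes> e \<otimes> g \<in> Q - D" using Q.S_mult_C[OF Q.C_mult_S[OF eQ D.C_inv[OF g]] g] by blast
          then show ?thesis using mem_conj_by_iff[OF Qc gc, of e] eQ Qc by blast
        qed
        moreover have "\<not> P - C \<subseteq> conj_by g Q"
        proof
          assume all: "P - C \<subseteq> conj_by g Q"
          have "x \<in> conj_by g (Q \<inter> D)" if x: "x \<in> P \<inter> D - C" for x
          proof -
            have xc: "x \<in> carrier G" using x by auto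
            have "inv g \<otimes> x \<otimes> g \<in> Q" using mem_conj_by_iff[OF Qc gc xc] all x by blast
            moreover have "inv g \<otimes> x \<otimes> g \<in> D" using D.C_mult[OF D.C_mult[OF D.C_inv[OF g]] g] x by blast
            ultimately show ?thesis using mem_conj_by_iff[OF QDc gc xc] by blast
          qed
          then show False using not by blast
        qed
        ultimately show ?thesis by blast
      qed
      then show "\<exists>g\<in>K. \<forall>Q. ordered_subgroup G K Q \<longrightarrow> P - C \<subseteq> Q \<longrightarrow>
        E \<subseteq> conj_by g Q \<and> \<not> P - C \<subseteq> conj_by g Q" using gK by blast
    qed
  qed
qed

lemma finite_cones_agreeing:
  assumes P: "ordered_with_convex G K P C" and fin: "finite (cones C)"
  shows "finite {Q \<in> cones K. P - C \<subseteq> Q}"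
proof -
  interpret P: ordered_with_convex G K P C by (rule P)
  have *: "Q - C = P - C" if "Q \<in> {Q \<in> cones K. P - C \<subseteq> Q}" for Q
    using P.agree_outside[of Q] that by (simp add: cones_def)
  have "inj_on (\<lambda>Q. Q \<inter> C) {Q \<in> cones K. P - C \<subseteq> Q}"
  proof (rule inj_onI)
    fix Q R assume Q: "Q \<in> {Q \<in> cones K. P - C \<subseteq> Q}" and R: "R \<in> {Q \<in> cones K. P - C \<subseteq> Q}"
      and eq: "Q \<inter> C = R \<inter> C"
    show "Q = R" using *[OF Q] *[OF R] eq by blast
  qed
  moreover have "(\<lambda>Q. Q \<inter> C) ` {Q \<in> cones K. P - C \<subseteq> Q} \<subseteq> cones C"
  proof (rule image_subsetI)
    fix Q assume "Q \<in> {Q \<in> cones K. P - C \<subseteq> Q}"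
    then have Q: "ordered_subgroup G K Q" "P - C \<subseteq> Q" by (auto simp: cones_def)
    have "convex_subgroup K Q C" using P.convex_agree[OF Q, of C] P.convex_C by blast
    then interpret Q: ordered_with_convex G K Q C
      using Q by (intro ordered_with_convex.intro ordered_with_convex_axioms.intro)
    show "Q \<inter> C \<in> cones C" using Q.restrict_cone by (simp add: cones_def)
  qed
  ultimately show ?thesis using fin by (rule inj_on_finite)
qed

definition conj_orbit :: "'a set \<Rightarrow> 'a set set" where
  "conj_orbit P = (\<lambda>g. conj_by g P) ` carrier G"

lemma conj_orbit_LO: "P \<in> LO G \<Longrightarrow> conj_orbit P \<subseteq> LO G"
  using conj_by_LO by (auto simp: conj_orbit_def)

lemma conj_orbit_conj:
  assumes "P \<in> LO G" "R \<in> conj_orbit P" "g \<in> carrier G"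
  shows "conj_by g R \<in> conj_orbit P"
proof -
  obtain h where h: "h \<in> carrier G" "R = conj_by h P" using assms(2) by (auto simp: conj_orbit_def)
  then have "conj_by g R = conj_by (g \<otimes> h) P" using conj_by_mult[OF LO_carrier[OF assms(1)] assms(3)] by simp
  then show ?thesis using h(1) assms(3) by (auto simp: conj_orbit_def)
qed

lemma closure_conj_orbit_invariant:
  assumes P: "P \<in> LO G" and R: "R \<in> LO_topology G closure_of conj_orbit P" and g: "g \<in> carrier G"
  shows "conj_by g R \<in> LO_topology G closure_of conj_orbit P"
proof -
  have "conj_by g ` (LO_topology G closure_of conj_orbit P) = LO_topology G closure_of (conj_by g ` conj_orbit P)"
    using homeomorphic_map_closure_of[OF homeomorphic_conj_by[OF g]] conj_orbit_LO[OF P] by simp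
  moreover have "conj_by g ` conj_orbit P \<subseteq> conj_orbit P" using conj_orbit_conj[OF P] g by blast
  then have "LO_topology G closure_of (conj_by g ` conj_orbit P) \<subseteq> LO_topology G closure_of conj_orbit P" by (rule closure_of_mono)
  ultimately show ?thesis using R by blast
qed

text \<open>Let \<open>\<Q>\<close> be the finite set of cones that agree with \<open>P\<close> outside \<open>C\<close>. By compactness each
\<open>Q \<in> \<Q>\<close> has conjugates outside \<open>\<Q>\<close> that accumulate at some \<open>R \<in> \<Q>\<close>. Choose \<open>Q\<close> such that the closure
of its orbit is minimal. Then the orbits of \<open>Q\<close> and \<open>R\<close> have the same closure, so each neighbourhood \<open>U\<close> of \<open>Q\<close>
contains a conjugate of \<open>R\<close>, and near this conjugate there are infinitely many conjugates of \<open>Q\<close>.\<close>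

lemma self_accumulating_cone:
  assumes P: "ordered_with_convex G (carrier G) P C" and fin: "finite (cones C)"
    and acc: "conjugates_accumulate (carrier G) P C"
  obtains Q where "Q \<in> LO G"
    "\<And>U. \<lbrakk>openin (LO_topology G) U; Q \<in> U\<rbrakk> \<Longrightarrow> \<exists>R\<in>U. R \<noteq> Q \<and> R \<in> conj_orbit Q"
proof -
  interpret P: ordered_with_convex G "carrier G" P C by (rule P)
  let ?X = "LO_topology G"
  define \<Q> where "\<Q> = {Q \<in> LO G. P - C \<subseteq> Q}"
  have fin_Q: "finite \<Q>" using finite_cones_agreeing[OF P fin] by (simp add: \<Q>_def LO_eq_cones)
  have P_Q: "P \<in> \<Q>" using LO_I[OF P.ordered_subgroup_axioms] by (simp add: \<Q>_def)
  have limit: "\<exists>R\<in>\<Q>. R \<in> ?X closure_of (conj_orbit Q - \<Q>)" if Q: "Q \<in> \<Q>" for Q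
  proof (rule ccontr)
    assume "\<not> ?thesis"
    then have not_limit: "R \<notin> ?X closure_of (conj_orbit Q - \<Q>)" if "R \<in> \<Q>" for R using that by blast
    have "\<exists>U. openin ?X U \<and> R \<in> U \<and> U \<inter> (conj_orbit Q - \<Q>) = {}" if R: "R \<in> \<Q>" for R
    proof -
      have "R \<in> topspace ?X" using R by (simp add: \<Q>_def)
      then obtain U where "openin ?X U" "R \<in> U" "\<nexists>y. y \<in> conj_orbit Q - \<Q> \<and> y \<in> U"
        using not_limit[OF R] unfolding in_closure_of by meson
      then show ?thesis by blast
    qed
    then obtain U where U: "\<And>R. R \<in> \<Q> \<Longrightarrow> openin ?X (U R)" "\<And>R. R \<in> \<Q> \<Longrightarrow> R \<in> U R"
      "\<And>R. R \<in> \<Q> \<Longrightarrow> U R \<inter> (conj_orbit Q - \<Q>) = {}" by metis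
    define V where "V s = {R \<in> LO G. {inv s} \<subseteq> R}" for s
    define \<U> where "\<U> = U ` \<Q> \<union> V ` (P - C)"
    have V_open: "openin ?X (V s)" for s unfolding V_def by (rule openin_LO_contains) simp
    have cover: "topspace ?X \<subseteq> \<Union>\<U>"
    proof
      fix R assume "R \<in> topspace ?X"
      then have R: "R \<in> LO G" by simp
      show "R \<in> \<Union>\<U>"
      proof (cases "R \<in> \<Q>")
        case True
        then show ?thesis using U(2) by (auto simp: \<U>_def)
      next
        case False
        then obtain s where s: "s \<in> P - C" "s \<notin> R" using R by (auto simp: \<Q>_def)
        have "s \<in> carrier G" "s \<noteq> \<one>" using s P.pos_one by auto
        then have "R \<in> V s" using LO_total[OF R] s(2) R by (auto simp: V_def)
        then show ?thesis using s(1) by (auto simp: \<U>_def)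
      qed
    qed
    have "\<forall>W\<in>\<U>. openin ?X W" using U(1) V_open by (auto simp: \<U>_def)
    then obtain \<F> where F: "finite \<F>" "\<F> \<subseteq> \<U>" "topspace ?X \<subseteq> \<Union>\<F>"
      using compact_LO cover unfolding compact_space_alt by meson
    have "finite (\<F> \<inter> V ` (P - C))" "\<F> \<inter> V ` (P - C) \<subseteq> V ` (P - C)" using F(1) by auto
    then obtain E where E: "E \<subseteq> P - C" "finite E" "\<F> \<inter> V ` (P - C) = V ` E"
      using finite_subset_image by metis
    have QLO: "Q \<in> LO G" and QP: "P - C \<subseteq> Q" using Q by (simp_all add: \<Q>_def)
    obtain g where "g \<in> carrier G" and "\<And>Q. \<lbrakk>ordered_subgroup G (carrier G) Q; P - C \<subseteq> Q\<rbrakk> \<Longrightarrow>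
        E \<subseteq> conj_by g Q \<and> \<not> P - C \<subseteq> conj_by g Q"
      by (rule conjugates_accumulateE[OF acc E(2,1)]) (rule that)
    then have g: "g \<in> carrier G" "E \<subseteq> conj_by g Q" "\<not> P - C \<subseteq> conj_by g Q"
      using LO_D[OF QLO] QP by auto
    have R: "conj_by g Q \<in> LO G" "conj_by g Q \<in> conj_orbit Q - \<Q>"
      using g conj_by_LO[OF QLO g(1)] by (auto simp: \<Q>_def conj_orbit_def)
    then obtain W where W: "W \<in> \<F>" "conj_by g Q \<in> W" using F(3) by auto
    have "W \<in> U ` \<Q> \<or> W \<in> V ` (P - C)" using W(1) F(2) unfolding \<U>_def by blast
    then consider "W \<in> U ` \<Q>" | "W \<in> V ` E" using W(1) unfolding E(3)[symmetric] by blast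
    then show False
    proof cases
      case 1
      then show False using W(2) R(2) U(3) by blast
    next
      case 2
      then obtain s where "s \<in> E" "inv s \<in> conj_by g Q" using W(2) by (auto simp: V_def)
      then show False using g(2) LO_inv[OF R(1)] by blast
    qed
  qed
  define cl where "cl Q = ?X closure_of conj_orbit Q" for Q
  have "finite (cl ` \<Q>)" "cl ` \<Q> \<noteq> {}" using fin_Q P_Q by auto
  then obtain m where m: "m \<in> cl ` \<Q>" "\<forall>b\<in>cl ` \<Q>. b \<subseteq> m \<longrightarrow> m = b"
    using finite_has_minimal[of "cl ` \<Q>"] by metis
  then obtain Q where Q: "Q \<in> \<Q>" "m = cl Q" by blast
  have QLO: "Q \<in> LO G" using Q by (simp add: \<Q>_def)
  obtain R where R: "R \<in> \<Q>" "R \<in> ?X closure_of (conj_orbit Q - \<Q>)" using limit Q(1) by blast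
  have RLO: "R \<in> LO G" using R by (simp add: \<Q>_def)
  have Rcl: "R \<in> cl Q" using R(2) closure_of_mono[of "conj_orbit Q - \<Q>" "conj_orbit Q" ?X] by (auto simp: cl_def)
  have "conj_orbit R \<subseteq> cl Q"
    using closure_conj_orbit_invariant[OF QLO Rcl[unfolded cl_def]] by (auto simp: cl_def conj_orbit_def)
  then have "cl R \<subseteq> cl Q" unfolding cl_def by (simp add: closure_of_minimal)
  then have "cl R = cl Q" using m R(1) Q(2) by blast
  moreover have "Q \<in> conj_orbit Q" using conj_by_one[OF LO_carrier[OF QLO]] by (force simp: conj_orbit_def)
  then have "Q \<in> cl Q" using closure_of_subset[of "conj_orbit Q" ?X] conj_orbit_LO[OF QLO] by (auto simp: cl_def)
  ultimately have QclR: "Q \<in> ?X closure_of conj_orbit R" by (simp add: cl_def)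
  show thesis
  proof (rule that[OF QLO], rule ccontr)
    fix U assume U: "openin ?X U" "Q \<in> U" and no: "\<not> (\<exists>R\<in>U. R \<noteq> Q \<and> R \<in> conj_orbit Q)"
    obtain R' where "R' \<in> conj_orbit R" "R' \<in> U" using QclR U unfolding in_closure_of by blast
    then obtain g where g: "g \<in> carrier G" "conj_by g R \<in> U" by (auto simp: conj_orbit_def)
    define W where "W = {T \<in> topspace ?X. conj_by g T \<in> U}"
    have W: "openin ?X W" "R \<in> W"
      using openin_continuous_map_preimage[OF continuous_conj_by[OF g(1)] U(1)] RLO g(2) by (auto simp: W_def)
    \<comment> \<open>Conjugates \<open>T\<close> of \<open>Q\<close> close to \<open>R\<close> are moved into \<open>U\<close> by \<open>g\<close>, hence to \<open>Q\<close>. But there are two of them.\<close>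
    have fixed: "conj_by g T = Q" if "T \<in> conj_orbit Q" "T \<in> W" for T
      using no that conj_orbit_conj[OF QLO that(1) g(1)] by (auto simp: W_def)
    have near: "\<exists>T. T \<in> conj_orbit Q - \<Q> \<and> T \<in> V" if "openin ?X V" "R \<in> V" for V
      using R(2)[unfolded in_closure_of, THEN conjunct2, rule_format, of V] that by simp
    obtain T where T: "T \<in> conj_orbit Q - \<Q>" "T \<in> W" using near[OF W] by metis
    have TLO: "T \<in> LO G" using T conj_orbit_LO[OF QLO] by blast
    have "closedin ?X {T}" using closedin_Hausdorff_singleton[OF Hausdorff_LO, of T] TLO by simp
    with W(1) have WT: "openin ?X (W - {T})" by (rule openin_diff)
    have "R \<in> W - {T}" using W(2) T(1) R(1) by blast
    then obtain T' where T': "T' \<in> conj_orbit Q - \<Q>" "T' \<in> W - {T}" using near[OF WT] by metis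
    have T'LO: "T' \<in> LO G" using T' conj_orbit_LO[OF QLO] by blast
    have "conj_by g T = conj_by g T'" using fixed[of T] fixed[of T'] T T' by blast
    then have "T = T'" using conj_by_inv(1)[OF LO_carrier[OF TLO] g(1)] conj_by_inv(1)[OF LO_carrier[OF T'LO] g(1)] by metis
    then show False using T' by blast
  qed
qed

end

theorem corollary3p8:
  fixes G :: "('a, 'm) monoid_scheme"
  assumes "group G"
    and "countable (carrier G)"
    and "\<not> tararin G"
    and "\<exists>P. isolated_point (LO_topology G) P"
  shows "\<not> smooth TYPE('y) (LO_topology G) (E_lo G)"
proof -
  interpret group G by (rule assms(1))
  obtain P where P: "isolated_point (LO_topology G) P" using assms(4) by blast
  note cone = isolated_point_cone[OF P]
  have inf: "infinite (cones (carrier G))"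
    by (rule infinite_LO_if_not_tararin[OF assms(3) LO_I[OF cone(1)]])
  obtain C where C: "convex_subgroup (carrier G) P C" "finite (cones C)"
    "conjugates_accumulate (carrier G) P C"
    using isolated_cone_gap[OF cone inf] by metis
  have "ordered_with_convex G (carrier G) P C"
    using cone(1) C(1) by (intro ordered_with_convex.intro ordered_with_convex_axioms.intro)
  then obtain Q where Q: "Q \<in> LO G"
    "\<And>U. \<lbrakk>openin (LO_topology G) U; Q \<in> U\<rbrakk> \<Longrightarrow> \<exists>R\<in>U. R \<noteq> Q \<and> R \<in> conj_orbit Q"
    using self_accumulating_cone[OF _ C(2,3)] by metis
  show ?thesis
  proof (rule not_smooth_if_recurrent[of _ "conj_by ` carrier G" _ Q])
    show "compact_space (LO_topology G)" by (rule compact_LO)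
    show "Hausdorff_space (LO_topology G)" by (rule Hausdorff_LO)
    show "countable (conj_by ` carrier G)" using assms(2) by simp
    show "homeomorphic_map (LO_topology G) (LO_topology G) \<phi>" if "\<phi> \<in> conj_by ` carrier G" for \<phi>
      using that homeomorphic_conj_by by blast
    show "equiv (topspace (LO_topology G)) (E_lo G)" using equiv_E_lo by simp
    show "(R, T) \<in> E_lo G \<longleftrightarrow> (\<exists>\<phi>\<in>conj_by ` carrier G. T = \<phi> R)" if "R \<in> topspace (LO_topology G)" for R T
      using that E_lo_iff by auto
    show "Q \<in> topspace (LO_topology G)" using Q(1) by simp
    show "\<exists>R\<in>U. R \<noteq> Q \<and> (Q, R) \<in> E_lo G" if "openin (LO_topology G) U" "Q \<in> U" for U
      using Q(2)[OF that] Q(1) unfolding E_lo_iff conj_orbit_def by blast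
  qed
qed

end
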